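(* Let $G$ be a graph and suppose $X\subseteq\Omega(G)$ (with the subspace topology) satisfies $|X|<2^{\aleph_0}$. Then the following are equivalent: (a) $X$ is scattered (i.e. every non-empty $Y\subseteq X$ has an isolated point). (b) $X$ is an end space.
   Context: For a graph $G$, a ray of $G$ is a one-way infinite path; two rays are equivalent if no finite set of vertices separates them (i.e. for every finite set $F$ of vertices, they have tails in the same component of $G-F$). The equivalence classes are the ends of $G$, and $\Omega(G)$ is the set of ends with the topology having as basic open sets, for $\varepsilon\in\Omega(G)$ and $F$ a finite set of vertices, $\Omega(\varepsilon,F)=\{\eta\in\Omega(G):\text{no }R\in\varepsilon\text{ and }R'\in\eta\text{ are separated by }F\}$. A space is an end space if it is homeomorphic to $\Omega(H)$ for some graph $H$. *)

theory Defs
  imports "HOL-Analysis.Analysis"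
begin

section \<open>Graphs, rays and ends\<close>

definition simple_graph :: "'v set \<Rightarrow> 'v set set \<Rightarrow> bool" where
  "simple_graph V E \<longleftrightarrow> (\<forall>e\<in>E. e \<subseteq> V \<and> card e = 2)"

text \<open>Edges of \<open>E\<close> not contained in \<open>V\<close> are ignored here, so for a graph \<open>G = (V, E)\<close> the components
  of \<open>G - F\<close> are \<open>components_of_graph (V - F) E\<close>.\<close>

definition joined :: "'v set \<Rightarrow> 'v set set \<Rightarrow> ('v \<times> 'v) set" where
  "joined V E = {(u, v). u \<in> V \<and> v \<in> V \<and> (u, v) \<in> {(x, y). x \<in> V \<and> y \<in> V \<and> {x, y} \<in> E}\<^sup>*}"

definition components_of_graph :: "'v set \<Rightarrow> 'v set set \<Rightarrow> 'v set set" where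
  "components_of_graph V E = V // joined V E"

text \<open>A one-way infinite path has a unique first vertex, so it is the same thing as the sequence
  enumerating its vertices from there.\<close>

definition rays :: "'v set \<Rightarrow> 'v set set \<Rightarrow> (nat \<Rightarrow> 'v) set" where
  "rays V E = {r. inj r \<and> range r \<subseteq> V \<and> (\<forall>n. {r n, r (Suc n)} \<in> E)}"

definition separates :: "'v set \<Rightarrow> 'v set set \<Rightarrow> 'v set \<Rightarrow> (nat \<Rightarrow> 'v) \<Rightarrow> (nat \<Rightarrow> 'v) \<Rightarrow> bool" where
  "separates V E F r s \<longleftrightarrow>
     \<not> (\<exists>C \<in> components_of_graph (V - F) E. \<exists>m n. r ` {m..} \<subseteq> C \<and> s ` {n..} \<subseteq> C)"

definition ray_equiv :: "'v set \<Rightarrow> 'v set set \<Rightarrow> ((nat \<Rightarrow> 'v) \<times> (nat \<Rightarrow> 'v)) set" where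
  "ray_equiv V E = {(r, s). r \<in> rays V E \<and> s \<in> rays V E \<and>
     (\<forall>F. finite F \<and> F \<subseteq> V \<longrightarrow> \<not> separates V E F r s)}"

definition graph_ends :: "'v set \<Rightarrow> 'v set set \<Rightarrow> (nat \<Rightarrow> 'v) set set" where
  "graph_ends V E = rays V E // ray_equiv V E"

definition end_nbhd :: "'v set \<Rightarrow> 'v set set \<Rightarrow> (nat \<Rightarrow> 'v) set \<Rightarrow> 'v set \<Rightarrow> (nat \<Rightarrow> 'v) set set" where
  "end_nbhd V E \<epsilon> F = {\<eta> \<in> graph_ends V E. \<not> (\<exists>r\<in>\<epsilon>. \<exists>s\<in>\<eta>. separates V E F r s)}"

definition end_topology :: "'v set \<Rightarrow> 'v set set \<Rightarrow> (nat \<Rightarrow> 'v) set topology" where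
  "end_topology V E = topology_generated_by
     {end_nbhd V E \<epsilon> F | \<epsilon> F. \<epsilon> \<in> graph_ends V E \<and> finite F \<and> F \<subseteq> V}"


section \<open>Scattered spaces and end spaces\<close>

definition scattered_space :: "'a topology \<Rightarrow> bool" where
  "scattered_space S \<longleftrightarrow>
     (\<forall>Y \<subseteq> topspace S. Y \<noteq> {} \<longrightarrow> (\<exists>y\<in>Y. openin (subtopology S Y) {y}))"

text \<open>HOL cannot quantify over the vertex type of \<open>H\<close> inside a formula. Fixing it to
  \<open>nat + 'a\<close> loses nothing: by \<open>end_space_if_homeomorphic\<close> below, a space on \<open>'a\<close> that is
  homeomorphic to the end space of a graph with vertices in any type whatsoever is also
  homeomorphic to the end space of a graph with vertices in \<open>nat + 'a\<close>.\<close>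

definition end_space :: "'a topology \<Rightarrow> bool" where
  "end_space S \<longleftrightarrow>
     (\<exists>(W :: (nat + 'a) set) D. simple_graph W D \<and> S homeomorphic_space end_topology W D)"


section \<open>Independence of the vertex type\<close>

lemma equiv_joined: "equiv V (joined V E)"
proof (rule equivI)
  show "joined V E \<subseteq> V \<times> V" and "refl_on V (joined V E)"
    by (auto simp: joined_def refl_on_def)
  have "sym ({(x, y). x \<in> V \<and> y \<in> V \<and> {x, y} \<in> E}\<^sup>*)"
    by (intro sym_rtrancl symI) (auto simp: insert_commute)
  then show "sym (joined V E)"
    by (auto simp: joined_def sym_def)
  show "trans (joined V E)"
    by (auto simp: joined_def trans_def)
qed

lemma joined_sym: "(x, y) \<in> joined V E \<Longrightarrow> (y, x) \<in> joined V E"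
  using equiv_joined[of V E] unfolding equiv_def by (blast dest: symD)

lemma joined_trans: "(x, y) \<in> joined V E \<Longrightarrow> (y, z) \<in> joined V E \<Longrightarrow> (x, z) \<in> joined V E"
  using equiv_joined[of V E] unfolding equiv_def by (meson transD)

lemma joined_map:
  assumes "(x, y) \<in> joined A E'"
    and "\<phi> ` A \<subseteq> B"
    and "\<And>u v. u \<in> A \<Longrightarrow> v \<in> A \<Longrightarrow> {u, v} \<in> E' \<Longrightarrow> {\<phi> u, \<phi> v} \<in> E"
  shows "(\<phi> x, \<phi> y) \<in> joined B E"
proof -
  let ?R = "{(x, y). x \<in> A \<and> y \<in> A \<and> {x, y} \<in> E'}"
  let ?S = "{(x, y). x \<in> B \<and> y \<in> B \<and> {x, y} \<in> E}"
  have "(x, y) \<in> ?R\<^sup>*" "x \<in> A" "y \<in> A" using assms(1) by (auto simp: joined_def)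
  from this(1) have "(\<phi> x, \<phi> y) \<in> ?S\<^sup>*"
  proof (induction rule: rtrancl_induct)
    case (step y z)
    then have "(\<phi> y, \<phi> z) \<in> ?S" using assms(2,3) by blast
    with step.IH show ?case by (rule rtrancl.rtrancl_into_rtrancl)
  qed simp
  with \<open>x \<in> A\<close> \<open>y \<in> A\<close> assms(2) show ?thesis by (auto simp: joined_def)
qed

lemma joined_mono: "(x, y) \<in> joined A E \<Longrightarrow> A \<subseteq> B \<Longrightarrow> (x, y) \<in> joined B E"
  using joined_map[where \<phi> = id and E = E and E' = E] by simp

lemma joined_finite:
  assumes "(x, y) \<in> joined A E"
  shows "\<exists>P. finite P \<and> P \<subseteq> A \<and> (x, y) \<in> joined P E"
proof -
  have "(x, y) \<in> {(x, y). x \<in> A \<and> y \<in> A \<and> {x, y} \<in> E}\<^sup>*" and "x \<in> A"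
    using assms by (auto simp: joined_def)
  then show ?thesis
  proof (induction rule: rtrancl_induct)
    case base
    then show ?case by (intro exI[of _ "{x}"]) (auto simp: joined_def)
  next
    case (step y z)
    then obtain P where P: "finite P" "P \<subseteq> A" "(x, y) \<in> joined P E" by blast
    have "(x, y) \<in> joined (insert z P) E" by (rule joined_mono[OF P(3)]) blast
    moreover have "y \<in> P" using P(3) by (auto simp: joined_def)
    with step.hyps have "(y, z) \<in> joined (insert z P) E" by (auto simp: joined_def)
    ultimately have "(x, z) \<in> joined (insert z P) E" by (rule joined_trans)
    with P step.hyps show ?case by (intro exI[of _ "insert z P"]) auto
  qed
qed

lemma not_separates_iff:
  "\<not> separates V E F r s \<longleftrightarrow> (\<exists>m n. \<forall>i\<ge>m. \<forall>j\<ge>n. (r i, s j) \<in> joined (V - F) E)"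
proof
  assume "\<not> separates V E F r s"
  then obtain C m n where C: "C \<in> components_of_graph (V - F) E"
    and "r ` {m..} \<subseteq> C" "s ` {n..} \<subseteq> C"
    by (auto simp: separates_def)
  then show "\<exists>m n. \<forall>i\<ge>m. \<forall>j\<ge>n. (r i, s j) \<in> joined (V - F) E"
    using quotient_eq_iff[OF equiv_joined C[unfolded components_of_graph_def]
        C[unfolded components_of_graph_def]]
    by blast
next
  assume "\<exists>m n. \<forall>i\<ge>m. \<forall>j\<ge>n. (r i, s j) \<in> joined (V - F) E"
  then obtain m n where mn: "\<And>i j. i \<ge> m \<Longrightarrow> j \<ge> n \<Longrightarrow> (r i, s j) \<in> joined (V - F) E"
    by blast
  let ?C = "joined (V - F) E `` {r m}"
  have "r m \<in> V - F" using mn[of m n] by (auto simp: joined_def)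
  then have "?C \<in> components_of_graph (V - F) E"
    by (auto simp: components_of_graph_def quotient_def)
  moreover have "s ` {n..} \<subseteq> ?C" using mn by auto
  moreover have "r i \<in> ?C" if "i \<ge> m" for i
    using joined_trans[OF mn[of m n] joined_sym[OF mn[of i n]]] that by auto
  then have "r ` {m..} \<subseteq> ?C" by auto
  ultimately show "\<not> separates V E F r s" unfolding separates_def by blast
qed

lemma not_separates_sym: "\<not> separates V E F r s \<Longrightarrow> \<not> separates V E F s r"
  by (auto simp: separates_def)

lemma not_separates_trans:
  assumes "\<not> separates V E F r s" "\<not> separates V E F s t"
  shows "\<not> separates V E F r t"
proof -
  obtain m n where 1: "\<And>i j. i \<ge> m \<Longrightarrow> j \<ge> n \<Longrightarrow> (r i, s j) \<in> joined (V - F) E"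
    using assms(1) unfolding not_separates_iff by blast
  obtain p q where 2: "\<And>i j. i \<ge> p \<Longrightarrow> j \<ge> q \<Longrightarrow> (s i, t j) \<in> joined (V - F) E"
    using assms(2) unfolding not_separates_iff by blast
  have "(r i, t j) \<in> joined (V - F) E" if "i \<ge> m" "j \<ge> q" for i j
    using joined_trans[OF 1[of i "max n p"] 2[of "max n p" j]] that by simp
  then show ?thesis unfolding not_separates_iff by blast
qed

lemma not_separates_refl:
  assumes r: "r \<in> rays V E" and "finite F"
  shows "\<not> separates V E F r r"
proof -
  have "finite (r -` F)" using assms by (intro finite_vimageI) (auto simp: rays_def)
  then obtain m where m: "\<And>i. r i \<in> F \<Longrightarrow> i < m"
    unfolding finite_nat_set_iff_bounded by auto
  have V: "r i \<in> V - F" if "i \<ge> m" for i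
    using r m[of i] that by (auto simp: rays_def)
  have from_m: "(r m, r i) \<in> joined (V - F) E" if "i \<ge> m" for i
    using that
  proof (induction i rule: dec_induct)
    case base
    then show ?case using V by (auto simp: joined_def)
  next
    case (step i)
    have "(r i, r (Suc i)) \<in> joined (V - F) E"
      using V[of i] V[of "Suc i"] step.hyps r by (auto simp: joined_def rays_def)
    with step.IH show ?case by (rule joined_trans)
  qed
  have "(r i, r j) \<in> joined (V - F) E" if "i \<ge> m" "j \<ge> m" for i j
    by (rule joined_trans[OF joined_sym[OF from_m] from_m]) (use that in auto)
  then show ?thesis unfolding not_separates_iff by blast
qed

lemma equiv_ray_equiv: "equiv (rays V E) (ray_equiv V E)"
proof (rule equivI)
  show "ray_equiv V E \<subseteq> rays V E \<times> rays V E" by (auto simp: ray_equiv_def)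
  show "refl_on (rays V E) (ray_equiv V E)"
    using not_separates_refl by (fastforce simp: ray_equiv_def refl_on_def)
  show "sym (ray_equiv V E)"
    by (rule symI) (auto simp: ray_equiv_def dest: not_separates_sym)
  show "trans (ray_equiv V E)"
  proof (rule transI)
    fix r s t assume "(r, s) \<in> ray_equiv V E" "(s, t) \<in> ray_equiv V E"
    then show "(r, t) \<in> ray_equiv V E"
      using not_separates_trans[of V E _ r s t] by (simp add: ray_equiv_def)
  qed
qed

lemma end_nbhd_class_iff:
  assumes "r \<in> rays V E" "s \<in> rays V E" "finite F" "F \<subseteq> V"
  shows "ray_equiv V E `` {s} \<in> end_nbhd V E (ray_equiv V E `` {r}) F \<longleftrightarrow> \<not> separates V E F r s"
proof
  assume "ray_equiv V E `` {s} \<in> end_nbhd V E (ray_equiv V E `` {r}) F"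
  then show "\<not> separates V E F r s"
    using assms equiv_class_self[OF equiv_ray_equiv] unfolding end_nbhd_def by blast
next
  assume rs: "\<not> separates V E F r s"
  have "\<not> separates V E F r' s'" if "(r, r') \<in> ray_equiv V E" "(s, s') \<in> ray_equiv V E" for r' s'
  proof -
    have "\<not> separates V E F r r'" "\<not> separates V E F s s'"
      using that assms by (auto simp: ray_equiv_def)
    with rs show ?thesis using not_separates_sym not_separates_trans by metis
  qed
  then show "ray_equiv V E `` {s} \<in> end_nbhd V E (ray_equiv V E `` {r}) F"
    using assms by (auto simp: end_nbhd_def graph_ends_def intro: quotientI)
qed

lemma topspace_end_topology: "topspace (end_topology V E) = graph_ends V E"
proof
  show "topspace (end_topology V E) \<subseteq> graph_ends V E"
    by (auto simp: end_topology_def end_nbhd_def)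
  show "graph_ends V E \<subseteq> topspace (end_topology V E)"
  proof
    fix \<epsilon> assume e: "\<epsilon> \<in> graph_ends V E"
    then obtain r where r: "r \<in> rays V E" "\<epsilon> = ray_equiv V E `` {r}"
      by (auto simp: graph_ends_def elim: quotientE)
    then have "\<epsilon> \<in> end_nbhd V E \<epsilon> {}"
      using end_nbhd_class_iff[of r V E r "{}"] not_separates_refl[of r V E "{}"] by simp
    with e show "\<epsilon> \<in> topspace (end_topology V E)"
      unfolding end_topology_def topology_generated_by_topspace by blast
  qed
qed

lemma Union_nbhds:
  "\<Union> {end_nbhd V E \<epsilon> F | \<epsilon> F. \<epsilon> \<in> graph_ends V E \<and> finite F \<and> F \<subseteq> V} = graph_ends V E"
  using topspace_end_topology[of V E] unfolding end_topology_def topology_generated_by_topspace .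

lemma openin_end_nbhd:
  "\<epsilon> \<in> graph_ends V E \<Longrightarrow> finite F \<Longrightarrow> F \<subseteq> V \<Longrightarrow> openin (end_topology V E) (end_nbhd V E \<epsilon> F)"
  unfolding end_topology_def by (rule topology_generated_by_Basis) blast

lemma end_topology_homeomorphic:
  fixes \<phi> :: "'u \<Rightarrow> 'w"
  assumes inj: "inj_on \<phi> W" and sub: "\<phi> ` W \<subseteq> V"
    and D: "\<And>u v. u \<in> W \<Longrightarrow> v \<in> W \<Longrightarrow> {u, v} \<in> D \<longleftrightarrow> {\<phi> u, \<phi> v} \<in> E"
    and closed: "\<And>F x y. finite F \<Longrightarrow> F \<subseteq> W \<Longrightarrow> x \<in> W \<Longrightarrow> y \<in> W \<Longrightarrow>
      (\<phi> x, \<phi> y) \<in> joined (V - \<phi> ` F) E \<Longrightarrow> (x, y) \<in> joined (W - F) D"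
    and hit: "\<And>\<epsilon>. \<epsilon> \<in> graph_ends V E \<Longrightarrow> \<exists>r \<in> rays W D. \<phi> \<circ> r \<in> \<epsilon>"
  shows "end_topology V E homeomorphic_space end_topology W D"
proof -
  let ?c = "\<lambda>r. ray_equiv V E `` {r}" and ?d = "\<lambda>r. ray_equiv W D `` {r}"
  have ray: "\<phi> \<circ> r \<in> rays V E" if "r \<in> rays W D" for r
  proof -
    have "inj r" "range r \<subseteq> W" "\<And>n. {r n, r (Suc n)} \<in> D" using that by (auto simp: rays_def)
    then have "inj (\<phi> \<circ> r)" using inj by (auto intro: comp_inj_on inj_on_subset)
    moreover have "{\<phi> (r n), \<phi> (r (Suc n))} \<in> E" for n
      using D[of "r n" "r (Suc n)"] \<open>range r \<subseteq> W\<close> \<open>{r n, r (Suc n)} \<in> D\<close> by auto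
    moreover have "range (\<phi> \<circ> r) \<subseteq> V" using sub \<open>range r \<subseteq> W\<close> by fastforce
    ultimately show ?thesis by (simp add: rays_def)
  qed
  have inW: "r i \<in> W" if "r \<in> rays W D" for r i using that by (auto simp: rays_def)
  have up: "\<not> separates V E F (\<phi> \<circ> r) (\<phi> \<circ> s)"
    if "\<not> separates W D {x \<in> W. \<phi> x \<in> F} r s" for F r s
  proof -
    have "(\<phi> x, \<phi> y) \<in> joined (V - F) E" if "(x, y) \<in> joined (W - {x \<in> W. \<phi> x \<in> F}) D" for x y
      by (rule joined_map[OF that]) (use sub D in auto)
    with that show ?thesis unfolding not_separates_iff comp_def by meson
  qed
  have down: "\<not> separates W D F r s"
    if "\<not> separates V E (\<phi> ` F) (\<phi> \<circ> r) (\<phi> \<circ> s)"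
      and "finite F" "F \<subseteq> W" "r \<in> rays W D" "s \<in> rays W D" for F r s
    using that closed[OF that(2,3) inW[OF that(4)] inW[OF that(5)]]
    unfolding not_separates_iff comp_def by meson
  have fin: "finite {x \<in> W. \<phi> x \<in> F}" if "finite F" for F
    using finite_vimage_IntI[OF that inj] by (rule rev_finite_subset) auto
  have pull: "{x \<in> W. \<phi> x \<in> \<phi> ` F} = F" if "F \<subseteq> W" for F
    using inj that by (auto dest: inj_onD)
  have sep_iff: "separates W D F r s \<longleftrightarrow> separates V E (\<phi> ` F) (\<phi> \<circ> r) (\<phi> \<circ> s)"
    if "finite F" "F \<subseteq> W" "r \<in> rays W D" "s \<in> rays W D" for F r s
    using up[of "\<phi> ` F" r s] down[of F r s] that pull[of F] by auto
  have eq_iff: "(\<phi> \<circ> r, \<phi> \<circ> s) \<in> ray_equiv V E \<longleftrightarrow> (r, s) \<in> ray_equiv W D"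
    if rs: "r \<in> rays W D" "s \<in> rays W D" for r s
  proof
    assume L: "(\<phi> \<circ> r, \<phi> \<circ> s) \<in> ray_equiv V E"
    have "\<not> separates W D F r s" if "finite F" "F \<subseteq> W" for F
    proof -
      have "finite (\<phi> ` F)" "\<phi> ` F \<subseteq> V" using that sub by auto
      then have "\<not> separates V E (\<phi> ` F) (\<phi> \<circ> r) (\<phi> \<circ> s)" using L by (auto simp: ray_equiv_def)
      then show ?thesis using sep_iff[OF that rs] by simp
    qed
    with rs show "(r, s) \<in> ray_equiv W D" by (auto simp: ray_equiv_def)
  next
    assume L: "(r, s) \<in> ray_equiv W D"
    have "\<not> separates V E F (\<phi> \<circ> r) (\<phi> \<circ> s)" if "finite F" for F
      by (rule up) (use L fin[OF that] in \<open>auto simp: ray_equiv_def\<close>)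
    with rs ray show "(\<phi> \<circ> r, \<phi> \<circ> s) \<in> ray_equiv V E" by (auto simp: ray_equiv_def)
  qed
  define g where "g \<epsilon> = {r \<in> rays W D. \<phi> \<circ> r \<in> \<epsilon>}" for \<epsilon>
  define h where "h \<eta> = ray_equiv V E `` ((\<circ>) \<phi> ` \<eta>)" for \<eta>
  have g: "g (?c (\<phi> \<circ> r)) = ?d r" if "r \<in> rays W D" for r
    using eq_iff[OF that] by (auto simp: g_def ray_equiv_def)
  have h: "h (?d r) = ?c (\<phi> \<circ> r)" if r: "r \<in> rays W D" for r
  proof
    show "h (?d r) \<subseteq> ?c (\<phi> \<circ> r)"
    proof
      fix t assume "t \<in> h (?d r)"
      then obtain s where s: "(r, s) \<in> ray_equiv W D" "(\<phi> \<circ> s, t) \<in> ray_equiv V E"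
        by (auto simp: h_def)
      then have "(\<phi> \<circ> r, \<phi> \<circ> s) \<in> ray_equiv V E" using eq_iff r by (auto simp: ray_equiv_def)
      with s show "t \<in> ?c (\<phi> \<circ> r)"
        using equiv_ray_equiv[of V E] unfolding equiv_def by (auto dest: transD)
    qed
    show "?c (\<phi> \<circ> r) \<subseteq> h (?d r)"
      using equiv_class_self[OF equiv_ray_equiv r] by (auto simp: h_def)
  qed
  have V_end: "\<exists>r \<in> rays W D. \<epsilon> = ?c (\<phi> \<circ> r)" if e: "\<epsilon> \<in> graph_ends V E" for \<epsilon>
  proof -
    obtain r where "r \<in> rays W D" "\<phi> \<circ> r \<in> \<epsilon>" using hit[OF e] by blast
    moreover obtain s where "\<epsilon> = ?c s" using e by (auto simp: graph_ends_def elim: quotientE)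
    ultimately show ?thesis using equiv_class_eq[OF equiv_ray_equiv] by blast
  qed
  have W_end: "\<exists>r \<in> rays W D. \<eta> = ?d r" if "\<eta> \<in> graph_ends W D" for \<eta>
    using that by (auto simp: graph_ends_def elim: quotientE)
  have c_in: "?c r \<in> graph_ends V E" if "r \<in> rays V E" for r
    using that by (auto simp: graph_ends_def intro: quotientI)
  have d_in: "?d r \<in> graph_ends W D" if "r \<in> rays W D" for r
    using that by (auto simp: graph_ends_def intro: quotientI)
  have g_in: "g \<epsilon> \<in> graph_ends W D" if "\<epsilon> \<in> graph_ends V E" for \<epsilon>
    using V_end[OF that] g d_in by auto
  have h_in: "h \<eta> \<in> graph_ends V E" if "\<eta> \<in> graph_ends W D" for \<eta>
    using W_end[OF that] h c_in ray by auto
  have cont_g: "continuous_map (end_topology V E) (end_topology W D) g"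
    unfolding end_topology_def[of W D]
  proof (rule continuous_on_generated_topo)
    show "g ` topspace (end_topology V E)
        \<subseteq> \<Union> {end_nbhd W D \<epsilon> F |\<epsilon> F. \<epsilon> \<in> graph_ends W D \<and> finite F \<and> F \<subseteq> W}"
      using g_in unfolding Union_nbhds topspace_end_topology by blast
    fix U assume "U \<in> {end_nbhd W D \<epsilon> F |\<epsilon> F. \<epsilon> \<in> graph_ends W D \<and> finite F \<and> F \<subseteq> W}"
    then obtain \<epsilon> F where F: "\<epsilon> \<in> graph_ends W D" "finite F" "F \<subseteq> W" "U = end_nbhd W D \<epsilon> F"
      by blast
    then obtain r where r: "r \<in> rays W D" "\<epsilon> = ?d r" using W_end by blast
    have F': "finite (\<phi> ` F)" "\<phi> ` F \<subseteq> V" using F sub by auto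
    have mem: "g (?c (\<phi> \<circ> s)) \<in> U \<longleftrightarrow> ?c (\<phi> \<circ> s) \<in> end_nbhd V E (?c (\<phi> \<circ> r)) (\<phi> ` F)"
      if "s \<in> rays W D" for s
      using end_nbhd_class_iff[OF r(1) that F(2,3)] sep_iff[OF F(2,3) r(1) that]
        end_nbhd_class_iff[OF ray[OF r(1)] ray[OF that] F'] g[OF that] F(4) r(2) by simp
    have "g -` U \<inter> topspace (end_topology V E) = end_nbhd V E (?c (\<phi> \<circ> r)) (\<phi> ` F)"
    proof (intro set_eqI)
      fix \<zeta>
      show "\<zeta> \<in> g -` U \<inter> topspace (end_topology V E)
          \<longleftrightarrow> \<zeta> \<in> end_nbhd V E (?c (\<phi> \<circ> r)) (\<phi> ` F)"
      proof (cases "\<zeta> \<in> graph_ends V E")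
        case True
        then obtain s where "s \<in> rays W D" "\<zeta> = ?c (\<phi> \<circ> s)" using V_end by blast
        with True mem[of s] show ?thesis by (simp add: topspace_end_topology)
      next
        case False
        then show ?thesis by (auto simp: topspace_end_topology end_nbhd_def)
      qed
    qed
    then show "openin (end_topology V E) (g -` U \<inter> topspace (end_topology V E))"
      using openin_end_nbhd[OF c_in[OF ray[OF r(1)]] F'] by simp
  qed
  have cont_h: "continuous_map (end_topology W D) (end_topology V E) h"
    unfolding end_topology_def[of V E]
  proof (rule continuous_on_generated_topo)
    show "h ` topspace (end_topology W D)
        \<subseteq> \<Union> {end_nbhd V E \<epsilon> F |\<epsilon> F. \<epsilon> \<in> graph_ends V E \<and> finite F \<and> F \<subseteq> V}"
      using h_in unfolding Union_nbhds topspace_end_topology by blast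
    fix U assume "U \<in> {end_nbhd V E \<epsilon> F |\<epsilon> F. \<epsilon> \<in> graph_ends V E \<and> finite F \<and> F \<subseteq> V}"
    then obtain \<epsilon> F where F: "\<epsilon> \<in> graph_ends V E" "finite F" "F \<subseteq> V" "U = end_nbhd V E \<epsilon> F"
      by blast
    then obtain r where r: "r \<in> rays W D" "\<epsilon> = ?c (\<phi> \<circ> r)" using V_end by blast
    let ?F = "{x \<in> W. \<phi> x \<in> F}"
    have F': "finite ?F" "?F \<subseteq> W" using fin[OF F(2)] by auto
    have mem: "h (?d s) \<in> U \<longleftrightarrow> \<not> separates V E F (\<phi> \<circ> r) (\<phi> \<circ> s)" if "s \<in> rays W D" for s
      using end_nbhd_class_iff[OF ray[OF r(1)] ray[OF that] F(2,3)] h[OF that] F(4) r(2) by simp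
    show "openin (end_topology W D) (h -` U \<inter> topspace (end_topology W D))"
    proof (subst openin_subopen, intro ballI)
      fix \<zeta> assume z: "\<zeta> \<in> h -` U \<inter> topspace (end_topology W D)"
      then obtain s where s: "s \<in> rays W D" "\<zeta> = ?d s" using W_end by (auto simp: topspace_end_topology)
      have "openin (end_topology W D) (end_nbhd W D \<zeta> ?F)"
        using openin_end_nbhd[OF d_in[OF s(1)] F'] s(2) by simp
      moreover have "\<zeta> \<in> end_nbhd W D \<zeta> ?F"
        using end_nbhd_class_iff[OF s(1) s(1) F'] not_separates_refl[OF s(1) F'(1)] s(2) by simp
      moreover have "end_nbhd W D \<zeta> ?F \<subseteq> h -` U \<inter> topspace (end_topology W D)"
      proof
        fix \<xi> assume x: "\<xi> \<in> end_nbhd W D \<zeta> ?F"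
        then have "\<xi> \<in> graph_ends W D" by (auto simp: end_nbhd_def)
        then obtain t where t: "t \<in> rays W D" "\<xi> = ?d t" using W_end by blast
        have "\<not> separates W D ?F s t" using end_nbhd_class_iff[OF s(1) t(1) F'] x t(2) s(2) by simp
        then have "\<not> separates V E F (\<phi> \<circ> s) (\<phi> \<circ> t)" by (rule up)
        moreover have "\<not> separates V E F (\<phi> \<circ> r) (\<phi> \<circ> s)" using z mem[OF s(1)] s(2) by simp
        ultimately have "h \<xi> \<in> U" using mem[OF t(1)] t(2) not_separates_trans by blast
        with \<open>\<xi> \<in> graph_ends W D\<close> show "\<xi> \<in> h -` U \<inter> topspace (end_topology W D)"
          by (simp add: topspace_end_topology)
      qed
      ultimately show "\<exists>T. openin (end_topology W D) T \<and> \<zeta> \<in> T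
          \<and> T \<subseteq> h -` U \<inter> topspace (end_topology W D)" by blast
    qed
  qed
  have "h (g \<epsilon>) = \<epsilon>" if "\<epsilon> \<in> graph_ends V E" for \<epsilon>
    using V_end[OF that] g h by auto
  moreover have "g (h \<eta>) = \<eta>" if "\<eta> \<in> graph_ends W D" for \<eta>
    using W_end[OF that] g h by auto
  ultimately have "homeomorphic_maps (end_topology V E) (end_topology W D) g h"
    using cont_g cont_h by (simp add: homeomorphic_maps_def topspace_end_topology)
  then show ?thesis by (auto simp: homeomorphic_space_def)
qed

lemma UN_lepoll:
  assumes "infinite B" "I \<lesssim> B" "\<And>i. i \<in> I \<Longrightarrow> A i \<lesssim> B"
  shows "(\<Union>i\<in>I. A i) \<lesssim> B"
  using assms card_of_UNION_ordLeq_infinite[of B I A]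
  unfolding lepoll_def card_of_ordLeq by blast

lemma lists_lepoll:
  assumes "infinite B" "A \<lesssim> B"
  shows "lists A \<lesssim> B"
proof -
  have "{xs \<in> lists A. length xs = n} \<lesssim> B" for n
  proof (induction n)
    case 0
    have "finite {xs \<in> lists A. length xs = 0}" by (rule finite_subset[of _ "{[]}"]) auto
    then show ?case by (intro finite_lepoll_infinite[OF assms(1)])
  next
    case (Suc n)
    have "{xs \<in> lists A. length xs = Suc n}
        = (\<Union>x\<in>A. (#) x ` {xs \<in> lists A. length xs = n})"
      by (auto simp: length_Suc_conv image_iff)
    also have "\<dots> \<lesssim> B"
      by (rule UN_lepoll[OF assms]) (use Suc.IH image_lepoll lepoll_trans in blast)
    finally show ?case .
  qed
  then have "(\<Union>n\<in>(UNIV :: nat set). {xs \<in> lists A. length xs = n}) \<lesssim> B"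
    using assms(1) by (intro UN_lepoll) (auto simp: infinite_le_lepoll)
  also have "(\<Union>n\<in>(UNIV :: nat set). {xs \<in> lists A. length xs = n}) = lists A" by auto
  finally show ?thesis .
qed

lemma closed_vertex_set:
  assumes B: "infinite B" and U0: "U0 \<subseteq> V" "U0 \<lesssim> B"
  obtains U where "U0 \<subseteq> U" "U \<subseteq> V" "U \<lesssim> B"
    and "\<And>F x y. finite F \<Longrightarrow> F \<subseteq> U \<Longrightarrow> x \<in> U \<Longrightarrow> y \<in> U \<Longrightarrow>
      (x, y) \<in> joined (V - F) E \<Longrightarrow> (x, y) \<in> joined (U - F) E"
proof -
  define P where "P F x y = (if (x, y) \<in> joined (V - F) E
    then SOME P. finite P \<and> P \<subseteq> V - F \<and> (x, y) \<in> joined P E else {})" for F x y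
  have P: "finite (P F x y) \<and> P F x y \<subseteq> V - F \<and> (x, y) \<in> joined (P F x y) E"
    if "(x, y) \<in> joined (V - F) E" for F x y
    using someI_ex[OF joined_finite[OF that]] that by (simp add: P_def)
  have finP: "finite (P F x y)" and subP: "P F x y \<subseteq> V" for F x y
    using P[of x y F] by (cases "(x, y) \<in> joined (V - F) E"; force simp: P_def)+
  define st where "st U = U \<union> (\<Union>xs\<in>lists U. \<Union>x\<in>U. \<Union>y\<in>U. P (set xs) x y)" for U
  define Us where "Us n = (st ^^ n) U0" for n
  have step: "st U \<subseteq> V \<and> st U \<lesssim> B" if "U \<subseteq> V" "U \<lesssim> B" for U
  proof
    show "st U \<subseteq> V" using that subP by (fastforce simp: st_def)
    have "(\<Union>xs\<in>lists U. \<Union>x\<in>U. \<Union>y\<in>U. P (set xs) x y) \<lesssim> B"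
      by (intro UN_lepoll[OF B] lists_lepoll[OF B] that(2) finite_lepoll_infinite[OF B] finP)
    then have "(\<Union>b\<in>(UNIV :: bool set). if b then U
        else (\<Union>xs\<in>lists U. \<Union>x\<in>U. \<Union>y\<in>U. P (set xs) x y)) \<lesssim> B"
      using that B by (intro UN_lepoll) (auto intro: finite_lepoll_infinite)
    then show "st U \<lesssim> B" by (simp add: UNIV_bool st_def Un_commute)
  qed
  have Us: "Us n \<subseteq> V \<and> Us n \<lesssim> B" for n
    by (induction n) (use U0 step in \<open>auto simp: Us_def\<close>)
  have inc: "Us n \<subseteq> Us (Suc n)" for n by (auto simp: Us_def st_def)
  have mono: "Us m \<subseteq> Us n" if "m \<le> n" for m n
    using inc that by (rule lift_Suc_mono_le)
  let ?U = "\<Union>n. Us n"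
  show thesis
  proof
    show "U0 \<subseteq> ?U" by (rule SUP_upper2[of 0]) (auto simp: Us_def)
    show "?U \<subseteq> V" using Us by blast
    show "?U \<lesssim> B" using Us B by (intro UN_lepoll) (auto simp: infinite_le_lepoll)
    fix F x y
    assume F: "finite F" "F \<subseteq> ?U" and "x \<in> ?U" "y \<in> ?U" and xy: "(x, y) \<in> joined (V - F) E"
    have fin: "\<exists>n. A \<subseteq> Us n" if "finite A" "A \<subseteq> ?U" for A
      using that
    proof (induction A rule: finite_induct)
      case (insert a A)
      then obtain m n where "A \<subseteq> Us n" "a \<in> Us m" by blast
      then have "insert a A \<subseteq> Us (max m n)" using mono[of m "max m n"] mono[of n "max m n"] by auto
      then show ?case by blast
    qed simp
    have "finite (insert x (insert y F))" "insert x (insert y F) \<subseteq> ?U"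
      using F \<open>x \<in> ?U\<close> \<open>y \<in> ?U\<close> by auto
    then obtain n where n: "insert x (insert y F) \<subseteq> Us n" using fin by blast
    obtain xs where xs: "set xs = F" using finite_list[OF F(1)] by blast
    have "P F x y \<subseteq> st (Us n)" using n xs unfolding st_def by fastforce
    then have "P F x y \<subseteq> Us (Suc n)" by (simp add: Us_def)
    then have "P F x y \<subseteq> ?U - F" using P[OF xy] by blast
    with P[OF xy] show "(x, y) \<in> joined (?U - F) E" using joined_mono[of x y "P F x y" E] by simp
  qed
qed

lemma end_space_if_homeomorphic:
  fixes S :: "'a topology" and V :: "'w set"
  assumes "simple_graph V E" and S: "S homeomorphic_space end_topology V E"
  shows "end_space S"
proof -
  let ?B = "UNIV :: (nat + 'a) set"
  have B: "infinite ?B" by simp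
  obtain k where "homeomorphic_map S (end_topology V E) k"
    using S unfolding homeomorphic_space by blast
  then have "graph_ends V E \<subseteq> k ` topspace S"
    using homeomorphic_imp_surjective_map topspace_end_topology by (metis order_refl)
  then have "graph_ends V E \<lesssim> topspace S" by (rule subset_image_lepoll)
  also have "topspace S \<lesssim> ?B" unfolding lepoll_def by (rule exI[of _ Inr]) simp
  finally have endsB: "graph_ends V E \<lesssim> ?B" .
  define \<rho> where "\<rho> \<epsilon> = (SOME r. r \<in> \<epsilon>)" for \<epsilon> :: "(nat \<Rightarrow> 'w) set"
  have \<rho>: "\<rho> \<epsilon> \<in> \<epsilon>" "\<rho> \<epsilon> \<in> rays V E" if "\<epsilon> \<in> graph_ends V E" for \<epsilon>
  proof -
    have "\<epsilon> \<in> rays V E // ray_equiv V E" using that by (simp only: graph_ends_def)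
    then have "\<epsilon> \<noteq> {}" "\<epsilon> \<subseteq> rays V E"
      using in_quotient_imp_non_empty[OF equiv_ray_equiv] in_quotient_imp_subset[OF equiv_ray_equiv]
      by blast+
    then show "\<rho> \<epsilon> \<in> \<epsilon>" "\<rho> \<epsilon> \<in> rays V E" unfolding \<rho>_def using some_in_eq[of \<epsilon>] by blast+
  qed
  let ?U0 = "\<Union>\<epsilon>\<in>graph_ends V E. range (\<rho> \<epsilon>)"
  have "?U0 \<subseteq> V" using \<rho>(2) by (fastforce simp: rays_def)
  moreover have "range (\<rho> \<epsilon>) \<lesssim> ?B" for \<epsilon>
    by (rule lepoll_trans[OF image_lepoll B[unfolded infinite_le_lepoll]])
  then have "?U0 \<lesssim> ?B" by (intro UN_lepoll B endsB)
  ultimately obtain U where U: "?U0 \<subseteq> U" "U \<subseteq> V" "U \<lesssim> ?B"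
    and closed: "\<And>F x y. finite F \<Longrightarrow> F \<subseteq> U \<Longrightarrow> x \<in> U \<Longrightarrow> y \<in> U \<Longrightarrow>
      (x, y) \<in> joined (V - F) E \<Longrightarrow> (x, y) \<in> joined (U - F) E"
    using closed_vertex_set[OF B] by blast
  obtain f :: "'w \<Rightarrow> nat + 'a" where f: "inj_on f U" using U(3) by (auto simp: lepoll_def)
  let ?W = "f ` U"
  define D where "D = {{f u, f v} | u v. u \<in> U \<and> v \<in> U \<and> {u, v} \<in> E}"
  let ?\<phi> = "the_inv_into U f"
  have \<phi>f: "?\<phi> (f u) = u" if "u \<in> U" for u using the_inv_into_f_f[OF f that] .
  have D_iff: "{f u, f v} \<in> D \<longleftrightarrow> {u, v} \<in> E" if "u \<in> U" "v \<in> U" for u v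
  proof
    assume "{f u, f v} \<in> D"
    then obtain x y where xy: "{f u, f v} = {f x, f y}" "x \<in> U" "y \<in> U" "{x, y} \<in> E" unfolding D_def by blast
    then have "f ` {u, v} = f ` {x, y}" by simp
    then have "{u, v} = {x, y}" using inj_on_image_eq_iff[OF f, of "{u, v}" "{x, y}"] that xy by simp
    with xy show "{u, v} \<in> E" by simp
  next
    assume "{u, v} \<in> E"
    with that show "{f u, f v} \<in> D" unfolding D_def by (intro CollectI exI conjI) (rule refl)
  qed
  have "simple_graph ?W D"
    unfolding simple_graph_def
  proof
    fix e assume "e \<in> D"
    then obtain u v where uv: "e = f ` {u, v}" "u \<in> U" "v \<in> U" "{u, v} \<in> E" unfolding D_def by auto
    then have "card e = card {u, v}"
      using card_image[OF inj_on_subset[OF f, of "{u, v}"]] by simp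
    with uv assms(1) show "e \<subseteq> ?W \<and> card e = 2" by (auto simp: simple_graph_def)
  qed
  moreover have "end_topology V E homeomorphic_space end_topology ?W D"
  proof (rule end_topology_homeomorphic[where \<phi> = ?\<phi>])
    show "inj_on ?\<phi> ?W" by (rule inj_on_the_inv_into[OF f])
    show "?\<phi> ` ?W \<subseteq> V" using \<phi>f U(2) by auto
    show "{u, v} \<in> D \<longleftrightarrow> {?\<phi> u, ?\<phi> v} \<in> E" if uv: "u \<in> ?W" "v \<in> ?W" for u v
    proof -
      obtain a b where ab: "u = f a" "v = f b" "a \<in> U" "b \<in> U" using uv by blast
      show ?thesis using D_iff[OF ab(3,4)] by (simp only: ab(1,2) \<phi>f[OF ab(3)] \<phi>f[OF ab(4)])
    qed
  next
    fix F x y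
    assume F: "finite F" "F \<subseteq> ?W" and xy: "x \<in> ?W" "y \<in> ?W"
      and j: "(?\<phi> x, ?\<phi> y) \<in> joined (V - ?\<phi> ` F) E"
    have in_U: "?\<phi> z \<in> U" and f\<phi>: "f (?\<phi> z) = z" if "z \<in> ?W" for z using that \<phi>f by auto
    have "(?\<phi> x, ?\<phi> y) \<in> joined (U - ?\<phi> ` F) E"
      by (rule closed) (use F xy j in_U in auto)
    then have "(f (?\<phi> x), f (?\<phi> y)) \<in> joined (?W - F) D"
    proof (rule joined_map)
      show "f ` (U - ?\<phi> ` F) \<subseteq> ?W - F"
      proof
        fix z assume "z \<in> f ` (U - ?\<phi> ` F)"
        then obtain u where u: "u \<in> U" "u \<notin> ?\<phi> ` F" "z = f u" by blast
        then have "z \<notin> F" using \<phi>f[OF u(1)] by force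
        with u show "z \<in> ?W - F" by blast
      qed
      show "{f u, f v} \<in> D"
        if "u \<in> U - ?\<phi> ` F" "v \<in> U - ?\<phi> ` F" "{u, v} \<in> E" for u v
        using D_iff[of u v] that by simp
    qed
    then show "(x, y) \<in> joined (?W - F) D" using f\<phi> xy by simp
  next
    fix \<epsilon> assume e: "\<epsilon> \<in> graph_ends V E"
    then have r: "range (\<rho> \<epsilon>) \<subseteq> U" using U(1) by blast
    have "inj (\<rho> \<epsilon>)" "\<And>n. {\<rho> \<epsilon> n, \<rho> \<epsilon> (Suc n)} \<in> E" using \<rho>(2)[OF e] by (auto simp: rays_def)
    then have "inj (f \<circ> \<rho> \<epsilon>)" using r f by (auto intro: comp_inj_on inj_on_subset)
    moreover have "{f (\<rho> \<epsilon> n), f (\<rho> \<epsilon> (Suc n))} \<in> D" for n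
      using D_iff[of "\<rho> \<epsilon> n" "\<rho> \<epsilon> (Suc n)"] \<open>{\<rho> \<epsilon> n, \<rho> \<epsilon> (Suc n)} \<in> E\<close> r by auto
    moreover have "range (f \<circ> \<rho> \<epsilon>) \<subseteq> ?W" using r by auto
    ultimately have "f \<circ> \<rho> \<epsilon> \<in> rays ?W D" by (simp add: rays_def)
    moreover have "?\<phi> \<circ> (f \<circ> \<rho> \<epsilon>) = \<rho> \<epsilon>" using r \<phi>f by (auto simp: fun_eq_iff)
    ultimately show "\<exists>r \<in> rays ?W D. ?\<phi> \<circ> r \<in> \<epsilon>" using \<rho>(1)[OF e] by metis
  qed
  with S have "S homeomorphic_space end_topology ?W D" by (rule homeomorphic_space_trans)
  ultimately show ?thesis unfolding end_space_def by blast
qed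

end

theory Submission
  imports Defs
begin

text \<open>
  If \<open>X\<close> is an end space with a nonempty subset without isolated points, then any component containing an
  end of that subset can be split, by deleting finitely many vertices, into two such components. Every
  branch of the resulting binary tree carries an end, so there are at least \<open>2\<^sup>\<aleph>\<^sup>0\<close> ends.

  For the converse, call a set of vertices with finite neighbourhood good if all of its subsets with
  finite neighbourhood contribute an end space to \<open>X\<close>. The key fact is that locally good ends can be
  partitioned: there are disjoint good sets such that every ray of a locally good end has a tail in one
  of them. Otherwise there is a descending sequence of sets which cannot be so partitioned, where at step
  \<open>n\<close> all minimal separators of size at most \<open>n\<close> between a root and a set which cannot be partitioned
  have been deleted; a ray through the roots yields a contradiction with a good neighbourhood of its end.
  If some end in \<open>X\<close> were not locally good, scatteredness would give a neighbourhood in which it is the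
  only one, say \<open>x\<close>. A maximal family of disjoint rays of \<open>x\<close>, together with the vertices that no finite
  set separates from it, leaves components with finite neighbourhoods. Contracting them gives a
  graph with \<open>x\<close> as its only end, and attaching to the contracted vertices graphs that represent the
  components shows that \<open>x\<close> was locally good after all.
\<close>


section \<open>Components and rays\<close>

text \<open>The delicate direction is from scattered to end space. Topological sums of end spaces
  are easy to realise, but a cover by overlapping good open sets is not a sum, so everything turns
  on making such a cover disjoint. Two choices make this possible. The pieces have finite
  neighbourhood, since a ray crosses the boundary of such a set only finitely often; and goodness is
  inherited by smaller pieces, so that pieces may be intersected freely. An infinite vertex set
  cannot simply be deleted, as the components left over may have infinite neighbourhoods. Passing to
  the vertex closure repairs this, provided that every ray in the remainder has a tail component
  missing the original set. The bound n on the separators comes from this proviso: only for bounded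
  size are there finitely many minimal separators between two given vertices, while any given finite
  set is within the bound from some step on. Scatteredness is used for a single point, an isolated
  point of the set of ends in X that are not locally good.\<close>

lemma joined_mem: "(x, y) \<in> joined A E \<Longrightarrow> x \<in> A \<and> y \<in> A"
  by (simp add: joined_def)

lemma joined_refl: "x \<in> A \<Longrightarrow> (x, x) \<in> joined A E"
  by (simp add: joined_def)

lemma joined_edge: "x \<in> A \<Longrightarrow> y \<in> A \<Longrightarrow> {x, y} \<in> E \<Longrightarrow> (x, y) \<in> joined A E"
  by (auto simp: joined_def)

lemma joined_induct [consumes 1, case_names base step]:
  assumes "(x, y) \<in> joined A E"
    and "P x"
    and "\<And>y z. (x, y) \<in> joined A E \<Longrightarrow> P y \<Longrightarrow> z \<in> A \<Longrightarrow> {y, z} \<in> E \<Longrightarrow> P z"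
  shows "P y"
proof -
  have x: "x \<in> A" and "(x, y) \<in> {(x, y). x \<in> A \<and> y \<in> A \<and> {x, y} \<in> E}\<^sup>*"
    using assms(1) by (auto simp: joined_def)
  from this(2) have "P y \<and> y \<in> A"
  proof (induction rule: rtrancl_induct)
    case (step y z)
    then have "(x, y) \<in> joined A E" using x by (auto simp: joined_def)
    with step assms(3) show ?case by auto
  qed (use assms(2) x in auto)
  then show ?thesis ..
qed

text \<open>Stop the walk at its first vertex \<open>z\<close> in \<open>D\<close>; everything
  before it lies in \<open>A - D\<close>.\<close>

lemma joined_enter:
  assumes "(x, y) \<in> joined A E" "x \<notin> D" "y \<in> D"
  shows "\<exists>z \<in> D \<inter> A. (x, z) \<in> joined (insert z (A - D)) E"
proof -
  have "(x, y) \<in> joined (A - D) E \<or> (\<exists>z \<in> D \<inter> A. (x, z) \<in> joined (insert z (A - D)) E)"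
    using assms(1)
  proof (induction rule: joined_induct)
    case base
    then show ?case using assms joined_mem by (fastforce intro: joined_refl)
  next
    case (step y z)
    show ?case
    proof (cases "(x, y) \<in> joined (A - D) E")
      case True
      then have "(x, y) \<in> joined (insert z (A - D)) E" by (rule joined_mono) blast
      moreover have "(y, z) \<in> joined (insert z (A - D)) E"
        using joined_mem[OF True] step.hyps by (intro joined_edge) auto
      ultimately have *: "(x, z) \<in> joined (insert z (A - D)) E" by (rule joined_trans)
      show ?thesis
      proof (cases "z \<in> D")
        case False
        with step.hyps have "insert z (A - D) = A - D" by blast
        with * show ?thesis by simp
      qed (use * step.hyps in blast)
    qed (use step.IH in blast)
  qed
  then show ?thesis using assms(3) joined_mem by fastforce
qed

lemma joined_component:
  assumes "(x, y) \<in> joined A E"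
  shows "(x, y) \<in> joined (joined A E `` {x}) E"
  using assms
proof (induction rule: joined_induct)
  case base
  then show ?case using joined_mem[OF assms] by (auto intro!: joined_refl)
next
  case (step y z)
  then have "(x, z) \<in> joined A E" using joined_trans joined_edge joined_mem by metis
  with step have "(y, z) \<in> joined (joined A E `` {x}) E" by (intro joined_edge) auto
  with step.IH show ?case by (rule joined_trans)
qed

text \<open>Follow the walk from \<open>x\<close> to \<open>y\<close> up to its first visit to
  \<open>t\<close>: before that it stays in the component of \<open>x\<close> in
  \<open>A - {t}\<close>. So the vertex \<open>t\<close>, whose deletion separates \<open>x\<close>
  from \<open>y\<close>, is attached to that component.\<close>

lemma joined_through:
  assumes "(x, y) \<in> joined A E" "(x, y) \<notin> joined (A - {t}) E" "x \<noteq> t"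
  shows "(x, t) \<in> joined (insert t (joined (A - {t}) E `` {x})) E"
proof -
  let ?C = "joined (A - {t}) E `` {x}"
  have "(x, y) \<in> joined (A - {t}) E \<or> (x, t) \<in> joined (insert t ?C) E"
    using assms(1)
  proof (induction rule: joined_induct)
    case base
    then show ?case using assms joined_mem by (fastforce intro: joined_refl)
  next
    case (step y z)
    show ?case
    proof (cases "(x, y) \<in> joined (A - {t}) E")
      case True
      show ?thesis
      proof (cases "z = t")
        case True
        from joined_component[OF \<open>(x, y) \<in> joined (A - {t}) E\<close>]
        have "(x, y) \<in> joined (insert t ?C) E" by (rule joined_mono) blast
        moreover have "(y, t) \<in> joined (insert t ?C) E"
          using \<open>(x, y) \<in> joined (A - {t}) E\<close> step.hyps True by (intro joined_edge) auto
        ultimately show ?thesis using joined_trans by metis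
      next
        case False
        have "(y, z) \<in> joined (A - {t}) E"
          using joined_mem[OF \<open>(x, y) \<in> joined (A - {t}) E\<close>] step.hyps False by (intro joined_edge) auto
        with True show ?thesis using joined_trans by metis
      qed
    qed (use step.IH in blast)
  qed
  with assms(2) show ?thesis by blast
qed

section \<open>Connected sets and components\<close>

definition conn :: "'v set \<Rightarrow> 'v set set \<Rightarrow> bool" where
  "conn C E \<longleftrightarrow> (\<forall>x\<in>C. \<forall>y\<in>C. (x, y) \<in> joined C E)"

lemma conn_joined: "conn C E \<Longrightarrow> C \<subseteq> A \<Longrightarrow> x \<in> C \<Longrightarrow> y \<in> C \<Longrightarrow> (x, y) \<in> joined A E"
  unfolding conn_def by (rule joined_mono) auto

lemma component_eq:
  "C \<in> components_of_graph A E \<Longrightarrow> x \<in> C \<Longrightarrow> C = joined A E `` {x}"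
  unfolding components_of_graph_def
  using equiv_class_eq[OF equiv_joined] by (fastforce elim!: quotientE)

lemma component_subset: "C \<in> components_of_graph A E \<Longrightarrow> C \<subseteq> A"
  unfolding components_of_graph_def by (rule in_quotient_imp_subset[OF equiv_joined])

lemma component_nonempty: "C \<in> components_of_graph A E \<Longrightarrow> C \<noteq> {}"
  unfolding components_of_graph_def by (rule in_quotient_imp_non_empty[OF equiv_joined])

lemma component_disjoint:
  "C \<in> components_of_graph A E \<Longrightarrow> D \<in> components_of_graph A E \<Longrightarrow> C \<noteq> D \<Longrightarrow> C \<inter> D = {}"
  unfolding components_of_graph_def using quotient_disj[OF equiv_joined] by blast

lemma component_closed:
  "C \<in> components_of_graph A E \<Longrightarrow> x \<in> C \<Longrightarrow> (x, y) \<in> joined A E \<Longrightarrow> y \<in> C"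
  using component_eq[of C A E x] by blast

lemma component_of: "x \<in> A \<Longrightarrow> joined A E `` {x} \<in> components_of_graph A E"
  by (auto simp: components_of_graph_def quotient_def)

lemma component_joined: "C \<in> components_of_graph A E \<Longrightarrow> x \<in> C \<Longrightarrow> y \<in> C \<Longrightarrow> (x, y) \<in> joined A E"
  using component_eq[of C A E x] by blast

lemma component_conn: "C \<in> components_of_graph A E \<Longrightarrow> conn C E"
  unfolding conn_def using joined_component[of _ _ A E] component_joined[of C A E] component_eq[of C A E]
  by metis

section \<open>Rays and the components that contain their tails\<close>

lemma rays_mono: "\<rho> \<in> rays A E \<Longrightarrow> A \<subseteq> B \<Longrightarrow> \<rho> \<in> rays B E"
  by (auto simp: rays_def)

lemma ray_mem: "\<rho> \<in> rays A E \<Longrightarrow> \<rho> n \<in> A"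
  by (auto simp: rays_def)

lemma ray_shift:
  assumes "\<rho> \<in> rays A E" "\<And>n. n \<ge> m \<Longrightarrow> \<rho> n \<in> B"
  shows "(\<lambda>n. \<rho> (n + m)) \<in> rays B E"
proof -
  have "inj (\<rho> \<circ> (\<lambda>n. n + m))" using assms(1) by (intro inj_compose) (auto simp: rays_def)
  then show ?thesis using assms by (auto simp: rays_def comp_def)
qed

lemma ray_leaves_finite:
  assumes "\<rho> \<in> rays A E" "finite F"
  shows "\<forall>\<^sub>F n in sequentially. \<rho> n \<notin> F"
proof -
  have "finite (\<rho> -` F)" using assms by (intro finite_vimageI) (auto simp: rays_def)
  then obtain m where "\<And>i. \<rho> i \<in> F \<Longrightarrow> i < m"
    unfolding finite_nat_set_iff_bounded by auto
  then show ?thesis unfolding eventually_sequentially by (meson leD)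
qed

lemma ray_tail_joined:
  assumes "\<rho> \<in> rays A E" "\<And>n. n \<ge> m \<Longrightarrow> \<rho> n \<in> B" "i \<ge> m" "j \<ge> m"
  shows "(\<rho> i, \<rho> j) \<in> joined B E"
proof -
  have *: "(\<rho> m, \<rho> i) \<in> joined B E" if "i \<ge> m" for i
    using that
  proof (induction i rule: dec_induct)
    case base
    then show ?case using assms(2) by (simp add: joined_refl)
  next
    case (step i)
    have "(\<rho> i, \<rho> (Suc i)) \<in> joined B E"
      using assms step by (intro joined_edge) (auto simp: rays_def)
    with step.IH show ?case by (rule joined_trans)
  qed
  from *[OF assms(3)] *[OF assms(4)] show ?thesis using joined_sym joined_trans by metis
qed

text \<open>For a ray of \<open>A\<close> and finite \<open>F\<close> this is the component of
  \<open>A - F\<close> containing a tail of \<open>\<rho>\<close>. Phrased with "eventually", it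
  does not name the start of the tail, so shifting \<open>\<rho>\<close> changes nothing; and
  \<open>F\<close> may contain vertices outside \<open>A\<close>.\<close>

definition tail_component :: "'v set \<Rightarrow> 'v set set \<Rightarrow> 'v set \<Rightarrow> (nat \<Rightarrow> 'v) \<Rightarrow> 'v set" where
  "tail_component A E F \<rho> = {v. \<forall>\<^sub>F n in sequentially. (\<rho> n, v) \<in> joined (A - F) E}"

lemma tail_component_mem:
  assumes "\<rho> \<in> rays A E" "finite F"
  shows "\<forall>\<^sub>F n in sequentially. \<rho> n \<in> tail_component A E F \<rho>"
proof -
  obtain m where m: "\<And>n. n \<ge> m \<Longrightarrow> \<rho> n \<notin> F"
    using ray_leaves_finite[OF assms] unfolding eventually_sequentially by blast
  have "(\<rho> i, \<rho> j) \<in> joined (A - F) E" if "i \<ge> m" "j \<ge> m" for i j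
    using ray_tail_joined[OF assms(1), of m "A - F" i j] m that ray_mem[OF assms(1)] by auto
  then show ?thesis unfolding tail_component_def eventually_sequentially by blast
qed

lemma tail_component_joined:
  assumes "x \<in> tail_component A E F \<rho>" "y \<in> tail_component A E F \<rho>"
  shows "(x, y) \<in> joined (A - F) E"
proof -
  have "\<forall>\<^sub>F n in sequentially. (\<rho> n, x) \<in> joined (A - F) E \<and> (\<rho> n, y) \<in> joined (A - F) E"
    using assms by (simp add: tail_component_def eventually_conj)
  then obtain n where "(\<rho> n, x) \<in> joined (A - F) E" "(\<rho> n, y) \<in> joined (A - F) E"
    using eventually_happens'[OF sequentially_bot] by blast
  then show ?thesis using joined_sym joined_trans by metis
qed

lemma tail_component_closed:
  assumes "x \<in> tail_component A E F \<rho>" "(x, y) \<in> joined (A - F) E"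
  shows "y \<in> tail_component A E F \<rho>"
  using assms(1) joined_trans[OF _ assms(2)] unfolding tail_component_def
  by (auto elim!: eventually_mono)

lemma tail_component_subset: "tail_component A E F \<rho> \<subseteq> A - F"
proof
  fix x assume "x \<in> tail_component A E F \<rho>"
  from tail_component_joined[OF this this] show "x \<in> A - F" using joined_mem[of x x "A - F" E] by simp
qed

lemma tail_component_in_components:
  assumes "\<rho> \<in> rays A E" "finite F"
  shows "tail_component A E F \<rho> \<in> components_of_graph (A - F) E"
proof -
  obtain x where x: "x \<in> tail_component A E F \<rho>"
    using tail_component_mem[OF assms] eventually_happens by force
  then have "tail_component A E F \<rho> = joined (A - F) E `` {x}"
    using tail_component_joined[OF x] tail_component_closed[OF x] by blast
  with x show ?thesis using component_of tail_component_subset by (metis subsetD)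
qed

lemma tail_component_eqI:
  assumes "\<rho> \<in> rays A E" "finite F" "C \<in> components_of_graph (A - F) E"
    and "\<exists>\<^sub>F n in sequentially. \<rho> n \<in> C"
  shows "tail_component A E F \<rho> = C"
proof -
  have "\<exists>\<^sub>F n in sequentially. \<rho> n \<in> tail_component A E F \<rho> \<and> \<rho> n \<in> C"
    using frequently_eventually_frequently[OF assms(4) tail_component_mem[OF assms(1,2)]]
    by (simp add: conj_commute)
  then obtain n where "\<rho> n \<in> tail_component A E F \<rho> \<inter> C" by (auto dest: frequently_ex)
  then show ?thesis
    using component_disjoint[OF tail_component_in_components[OF assms(1,2)] assms(3)] by blast
qed

lemma tail_component_mono:
  assumes "A \<subseteq> B" "F' \<subseteq> F"
  shows "tail_component A E F \<rho> \<subseteq> tail_component B E F' \<rho>"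
proof -
  have "(u, v) \<in> joined (B - F') E" if "(u, v) \<in> joined (A - F) E" for u v
    using joined_mono[OF that, of "B - F'"] assms by blast
  then show ?thesis unfolding tail_component_def by (auto elim!: eventually_mono)
qed

lemma tail_component_shift: "tail_component A E F (\<lambda>n. \<rho> (n + m)) = tail_component A E F \<rho>"
  unfolding tail_component_def using eventually_sequentially_seg[of "\<lambda>n. (\<rho> n, _) \<in> joined (A - F) E" m]
  by auto

text \<open>Translates separation of rays into inequality of tail components, the form in which it
  is used below.\<close>

lemma not_separates_tail_component:
  assumes "\<rho> \<in> rays V E" "\<sigma> \<in> rays V E" "finite F"
  shows "\<not> separates V E F \<rho> \<sigma> \<longleftrightarrow> tail_component V E F \<sigma> = tail_component V E F \<rho>"
proof
  assume "\<not> separates V E F \<rho> \<sigma>"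
  then obtain m n where mn: "\<And>i j. i \<ge> m \<Longrightarrow> j \<ge> n \<Longrightarrow> (\<rho> i, \<sigma> j) \<in> joined (V - F) E"
    unfolding not_separates_iff by blast
  then have "\<sigma> j \<in> tail_component V E F \<rho>" if "j \<ge> n" for j
    unfolding tail_component_def eventually_sequentially using that by blast
  then have "\<forall>\<^sub>F j in sequentially. \<sigma> j \<in> tail_component V E F \<rho>"
    unfolding eventually_sequentially by blast
  then show "tail_component V E F \<sigma> = tail_component V E F \<rho>"
    by (intro tail_component_eqI tail_component_in_components assms eventually_frequently) auto
next
  assume eq: "tail_component V E F \<sigma> = tail_component V E F \<rho>"
  obtain m n where "\<And>i. i \<ge> m \<Longrightarrow> \<rho> i \<in> tail_component V E F \<rho>"
    "\<And>j. j \<ge> n \<Longrightarrow> \<sigma> j \<in> tail_component V E F \<rho>"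
    using tail_component_mem[OF assms(1,3)] tail_component_mem[OF assms(2,3)] eq
    unfolding eventually_sequentially by metis
  then show "\<not> separates V E F \<rho> \<sigma>"
    unfolding not_separates_iff using tail_component_joined by meson
qed

section \<open>Vertex neighbourhoods\<close>

definition nbs :: "'v set \<Rightarrow> 'v set set \<Rightarrow> 'v set \<Rightarrow> 'v set" where
  "nbs A E C = {v \<in> A - C. \<exists>c\<in>C. {c, v} \<in> E}"

lemma nbs_component:
  assumes "C \<in> components_of_graph (A - F) E"
  shows "nbs A E C \<subseteq> F"
proof
  fix v assume "v \<in> nbs A E C"
  then obtain c where c: "v \<in> A" "v \<notin> C" "c \<in> C" "{c, v} \<in> E" by (auto simp: nbs_def)
  show "v \<in> F"
  proof (rule ccontr)
    assume "v \<notin> F"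
    then have "(c, v) \<in> joined (A - F) E"
      using c component_subset[OF assms] by (intro joined_edge) auto
    then show False using component_closed[OF assms] c by blast
  qed
qed

text \<open>A walk can leave \<open>C\<close> only through \<open>nbs A E C\<close>, which has been
  deleted.\<close>

lemma joined_nbs:
  assumes "(x, y) \<in> joined (A - F) E" "x \<in> C" "nbs A E C \<subseteq> F"
  shows "(x, y) \<in> joined (C - F) E"
  using assms(1)
proof (induction rule: joined_induct)
  case base
  then show ?case using assms joined_mem by (fastforce intro: joined_refl)
next
  case (step y z)
  then have "y \<in> C - F" using joined_mem by metis
  moreover have "z \<in> C" using step.hyps \<open>y \<in> C - F\<close> assms(3) by (auto simp: nbs_def)
  ultimately have "(y, z) \<in> joined (C - F) E" using step.hyps by (intro joined_edge) auto
  with step.IH show ?case by (rule joined_trans)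
qed

lemma ray_tail_in_component:
  assumes "\<rho> \<in> rays A E" "\<forall>\<^sub>F n in sequentially. \<rho> n \<notin> T"
  shows "\<exists>C \<in> components_of_graph (A - T) E. \<forall>\<^sub>F n in sequentially. \<rho> n \<in> C"
proof -
  obtain m where m: "\<And>n. n \<ge> m \<Longrightarrow> \<rho> n \<in> A - T"
    using assms ray_mem unfolding eventually_sequentially by (metis DiffI)
  let ?C = "joined (A - T) E `` {\<rho> m}"
  have "\<rho> n \<in> ?C" if "n \<ge> m" for n
    using ray_tail_joined[OF assms(1) m order_refl that] by simp
  then show ?thesis using component_of[OF m[OF order_refl]] unfolding eventually_sequentially by blast
qed

section \<open>Rays from nested connected sets\<close>

text \<open>Concatenates the paths from \<open>a n\<close> to \<open>a (Suc n)\<close>. The level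
  \<open>lev i\<close> records which of them is being followed at time \<open>i\<close>. The walk
  may pause, so that turning to the next path can be a step of its own.\<close>

lemma walk_exists:
  assumes a: "\<And>n. (a n, a (Suc n)) \<in> joined (B n) E"
  obtains w :: "nat \<Rightarrow> 'v" and lev :: "nat \<Rightarrow> nat"
  where "\<And>i. w (Suc i) = w i \<or> {w i, w (Suc i)} \<in> E"
    and "\<And>i. (w i, a (Suc (lev i))) \<in> joined (B (lev i)) E"
    and "mono lev" and "\<And>n. \<exists>i. lev i = n"
proof -
  define R where "R n = {(x, y). x \<in> B n \<and> y \<in> B n \<and> {x, y} \<in> E}" for n
  \<comment> \<open>Distance to the current target inside \<open>B n\<close>. Each move lowers it
    strictly, so every target is reached.\<close>
  define d where "d n u = (LEAST k. (u, a (Suc n)) \<in> R n ^^ k)" for n u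
  have step: "\<exists>v. {u, v} \<in> E \<and> (v, a (Suc n)) \<in> joined (B n) E \<and> d n v < d n u"
    if u: "(u, a (Suc n)) \<in> joined (B n) E" "u \<noteq> a (Suc n)" for u n
  proof -
    have "(u, a (Suc n)) \<in> (R n)\<^sup>*" using u by (simp add: joined_def R_def)
    then have "\<exists>k. (u, a (Suc n)) \<in> R n ^^ k" by (rule rtrancl_imp_relpow)
    then have k: "(u, a (Suc n)) \<in> R n ^^ d n u" unfolding d_def by (rule LeastI_ex)
    with u obtain k where "d n u = Suc k" by (cases "d n u") auto
    with k obtain v where v: "(u, v) \<in> R n" "(v, a (Suc n)) \<in> R n ^^ k"
      using relpow_Suc_E2 by metis
    then have "d n v \<le> k" unfolding d_def by (intro Least_le)
    moreover have "(v, a (Suc n)) \<in> (R n)\<^sup>*" using v(2) by (rule relpow_imp_rtrancl)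
    then have "(v, a (Suc n)) \<in> joined (B n) E"
      using v(1) joined_mem[OF u(1)] by (simp add: joined_def R_def)
    ultimately show ?thesis using v(1) \<open>d n u = Suc k\<close> by (auto simp: R_def)
  qed
  \<comment> \<open>The state is a vertex with a level. At the target the walk pauses and the level
    goes up; otherwise it moves to a neighbour nearer to the target.\<close>
  define nx where "nx s = (if fst s = a (Suc (snd s)) then (fst s, Suc (snd s)) else
    (SOME v. {fst s, v} \<in> E \<and> (v, a (Suc (snd s))) \<in> joined (B (snd s)) E
      \<and> d (snd s) v < d (snd s) (fst s), snd s))" for s
  define st where "st i = (nx ^^ i) (a 0, 0)" for i
  have st_Suc: "st (Suc i) = nx (st i)" for i by (simp add: st_def)
  define w lev where "w i = fst (st i)" and "lev i = snd (st i)" for i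
  have stop: "w (Suc i) = w i \<and> lev (Suc i) = Suc (lev i)" if "w i = a (Suc (lev i))" for i
    using that by (simp add: w_def lev_def st_Suc nx_def)
  have go: "{w i, w (Suc i)} \<in> E \<and> (w (Suc i), a (Suc (lev i))) \<in> joined (B (lev i)) E
      \<and> d (lev i) (w (Suc i)) < d (lev i) (w i) \<and> lev (Suc i) = lev i"
    if "w i \<noteq> a (Suc (lev i))" "(w i, a (Suc (lev i))) \<in> joined (B (lev i)) E" for i
    using someI_ex[OF step[OF that(2,1)]] that(1) by (simp add: w_def lev_def st_Suc nx_def)
  have inv: "(w i, a (Suc (lev i))) \<in> joined (B (lev i)) E" for i
  proof (induction i)
    case 0
    then show ?case using a[of 0] by (simp add: w_def lev_def st_def)
  next
    case (Suc i)
    show ?case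
    proof (cases "w i = a (Suc (lev i))")
      case True
      then show ?thesis using a[of "Suc (lev i)"] stop[OF True] by simp
    next
      case False
      then show ?thesis using go[OF False Suc] by simp
    qed
  qed
  have lev_Suc: "lev i \<le> lev (Suc i)" for i
    using stop[of i] go[OF _ inv, of i] by force
  have up: "\<exists>j. lev j = Suc (lev i)" for i
  proof (induction "d (lev i) (w i)" arbitrary: i rule: less_induct)
    case less
    show ?case
    proof (cases "w i = a (Suc (lev i))")
      case True
      then show ?thesis using stop by blast
    next
      case False
      then show ?thesis using go[OF False inv] less[of "Suc i"] by simp
    qed
  qed
  show thesis
  proof
    show "w (Suc i) = w i \<or> {w i, w (Suc i)} \<in> E" for i
      using stop[of i] go[OF _ inv, of i] by blast
    show "mono lev" using lev_Suc by (simp add: mono_iff_le_Suc)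
    show "\<exists>i. lev i = n" for n
    proof (induction n)
      case 0
      then show ?case by (rule exI[of _ 0]) (simp add: lev_def st_def)
    next
      case (Suc n)
      then show ?case using up by metis
    qed
  qed (rule inv)
qed

text \<open>A walk that visits every vertex only finitely often contains a ray: jump to the last visit of
  the current vertex, then take one step.\<close>

lemma ray_exists:
  assumes dec: "\<And>n. B (Suc n) \<subseteq> B n" and emp: "(\<Inter>n. B n) = {}"
    and a: "\<And>n. (a n, a (Suc n)) \<in> joined (B n) E"
  obtains \<rho> where "\<rho> \<in> rays (B 0) E"
    and "\<And>n. \<forall>\<^sub>F j in sequentially. (a n, \<rho> j) \<in> joined (B n) E"
proof -
  obtain w lev where w: "\<And>i. w (Suc i) = w i \<or> {w i, w (Suc i)} \<in> E"
    and wa: "\<And>i. (w i, a (Suc (lev i))) \<in> joined (B (lev i)) E"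
    and lev: "mono lev" "\<And>n. \<exists>i. lev i = n"
    using walk_exists[of a B E, OF a] by blast
  have Bmono: "B n \<subseteq> B m" if "m \<le> n" for m n using dec that by (rule lift_Suc_antimono_le)
  have aa: "(a n, a m) \<in> joined (B n) E" if "n \<le> m" for n m
    using that
  proof (induction m rule: dec_induct)
    case base
    then show ?case using joined_mem[OF a[of n]] by (simp add: joined_refl)
  next
    case (step m)
    have "(a m, a (Suc m)) \<in> joined (B n) E" using joined_mono[OF a Bmono] step.hyps by simp
    with step.IH show ?case by (rule joined_trans)
  qed
  have aw: "(a n, w i) \<in> joined (B n) E" if "n \<le> lev i" for n i
  proof -
    have "(w i, a (Suc (lev i))) \<in> joined (B n) E" using joined_mono[OF wa Bmono[OF that]] .
    moreover have "(a n, a (Suc (lev i))) \<in> joined (B n) E" using aa that by simp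
    ultimately show ?thesis using joined_sym joined_trans by metis
  qed
  \<comment> \<open>Some \<open>B n\<close> omits \<open>v\<close>, and the walk stays in
    \<open>B n\<close> once level \<open>n\<close> is reached.\<close>
  have fin: "finite {i. w i = v}" for v
  proof -
    obtain n where n: "v \<notin> B n" using emp by blast
    obtain k where k: "lev k = n" using lev(2) by blast
    have "i < k" if "w i = v" for i
    proof (rule ccontr)
      assume "\<not> i < k"
      then have "n \<le> lev i" using monoD[OF lev(1), of k i] k by simp
      then show False using joined_mem[OF aw] n that by blast
    qed
    then show ?thesis by (intro bounded_nat_set_is_finite[of _ k]) auto
  qed
  define lv where "lv v = Max {i. w i = v}" for v
  have lv: "w (lv (w i)) = w i" "i \<le> lv (w i)" for i
    using Max_in[OF fin, of "w i"] Max_ge[OF fin, of i "w i"] unfolding lv_def by blast+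
  define t where "t = rec_nat (lv (w 0)) (\<lambda>_ k. lv (w (Suc k)))"
  have t_Suc: "t (Suc k) = lv (w (Suc (t k)))" for k by (simp add: t_def)
  have t_last: "i \<le> t k" if "w i = w (t k)" for i k
  proof -
    have "t k = lv (w (t k))" by (cases k) (simp_all add: t_def lv)
    then show ?thesis using lv(2)[of i] that by simp
  qed
  have t_less: "t k < t (Suc k)" for k using lv(2)[of "Suc (t k)"] by (simp add: t_Suc)
  then have smono: "strict_mono t" by (simp add: strict_mono_Suc_iff)
  define \<rho> where "\<rho> k = w (t k)" for k
  have "\<rho> k \<noteq> \<rho> l" if "k < l" for k l
    using t_last[of "t l" k] strict_monoD[OF smono that] by (auto simp: \<rho>_def)
  then have "inj \<rho>" by (metis injI linorder_neqE_nat)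
  moreover have "{\<rho> k, \<rho> (Suc k)} \<in> E" for k
  proof -
    have "w (Suc (t k)) \<noteq> w (t k)" using t_last[of "Suc (t k)" k] by auto
    then show ?thesis using w[of "t k"] lv(1)[of "Suc (t k)"] by (simp add: \<rho>_def t_Suc)
  qed
  moreover have "\<rho> k \<in> B 0" for k using joined_mem[OF aw[of 0]] by (simp add: \<rho>_def)
  ultimately have "\<rho> \<in> rays (B 0) E" by (auto simp: rays_def)
  moreover have "\<forall>\<^sub>F j in sequentially. (a n, \<rho> j) \<in> joined (B n) E" for n
  proof -
    obtain k where k: "lev k = n" using lev(2) by blast
    have "(a n, \<rho> j) \<in> joined (B n) E" if "j \<ge> k" for j
    proof -
      have "k \<le> t j" using that strict_mono_imp_increasing[OF smono, of j] by simp
      then show ?thesis using aw[of n "t j"] monoD[OF lev(1)] k by (auto simp: \<rho>_def)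
    qed
    then show ?thesis unfolding eventually_sequentially by blast
  qed
  ultimately show thesis using that by blast
qed

text \<open>The sets \<open>D n\<close> may have a nonempty intersection, so
  \<open>ray_exists\<close> is applied to \<open>D n\<close> minus that intersection. The linking
  paths survive: up to their last vertex they avoid \<open>D (Suc n)\<close>, and the last vertex
  avoids \<open>D (Suc (Suc n))\<close>.\<close>

lemma nested_ray:
  assumes dec: "\<And>n. D (Suc n) \<subseteq> D n" and aD: "\<And>n. a n \<in> D n - D (Suc n)"
    and a: "\<And>n. (a n, a (Suc n)) \<in> joined (insert (a (Suc n)) (D n - D (Suc n))) E"
  obtains \<rho> where "\<rho> \<in> rays (D 0) E"
    and "\<And>n. \<forall>\<^sub>F j in sequentially. (a n, \<rho> j) \<in> joined (D n - (\<Inter>m. D m)) E"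
proof -
  let ?B = "\<lambda>n. D n - (\<Inter>m. D m)"
  have "(a n, a (Suc n)) \<in> joined (?B n) E" for n
    using aD[of "Suc n"] dec[of n] by (intro joined_mono[OF a]) auto
  then obtain \<rho> where "\<rho> \<in> rays (?B 0) E"
    and "\<And>n. \<forall>\<^sub>F j in sequentially. (a n, \<rho> j) \<in> joined (?B n) E"
    using ray_exists[of ?B a E] dec by blast
  then show thesis using that rays_mono[of \<rho> "?B 0" E "D 0"] by blast
qed

section \<open>Perfect sets of ends\<close>

abbreviation end_of :: "'v set \<Rightarrow> 'v set set \<Rightarrow> (nat \<Rightarrow> 'v) \<Rightarrow> (nat \<Rightarrow> 'v) set" where
  "end_of V E \<rho> \<equiv> ray_equiv V E `` {\<rho>}"

lemma end_of_in_graph_ends: "\<rho> \<in> rays V E \<Longrightarrow> end_of V E \<rho> \<in> graph_ends V E"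
  by (auto simp: graph_ends_def intro: quotientI)

lemma graph_endsE:
  assumes "\<epsilon> \<in> graph_ends V E"
  obtains \<rho> where "\<rho> \<in> rays V E" "\<epsilon> = end_of V E \<rho>"
  using assms by (auto simp: graph_ends_def elim: quotientE)

lemma tail_component_Int: "tail_component V E (F \<inter> V) \<rho> = tail_component V E F \<rho>"
proof -
  have "V - F \<inter> V = V - F" by blast
  then show ?thesis by (simp add: tail_component_def)
qed

lemma tail_component_eq_antimono:
  assumes "\<rho> \<in> rays V E" "\<sigma> \<in> rays V E" "finite F'" "F \<subseteq> F'"
    and "tail_component V E F' \<sigma> = tail_component V E F' \<rho>"
  shows "tail_component V E F \<sigma> = tail_component V E F \<rho>"
proof (rule tail_component_eqI[OF assms(2)])
  show fin: "finite F" using assms(3,4) finite_subset by blast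
  show "tail_component V E F \<rho> \<in> components_of_graph (V - F) E"
    by (rule tail_component_in_components[OF assms(1) fin])
  have "\<forall>\<^sub>F n in sequentially. \<sigma> n \<in> tail_component V E F \<rho>"
    using tail_component_mem[OF assms(2,3)]
    by (rule eventually_mono) (use assms(5) tail_component_mono[OF order_refl assms(4), of V E \<rho>] in auto)
  then show "\<exists>\<^sub>F n in sequentially. \<sigma> n \<in> tail_component V E F \<rho>"
    by (rule eventually_frequently[OF sequentially_bot])
qed

lemma end_of_eq_iff:
  assumes "\<rho> \<in> rays V E" "\<sigma> \<in> rays V E"
  shows "end_of V E \<rho> = end_of V E \<sigma> \<longleftrightarrow>
    (\<forall>F. finite F \<longrightarrow> tail_component V E F \<sigma> = tail_component V E F \<rho>)"
proof -
  have "end_of V E \<rho> = end_of V E \<sigma> \<longleftrightarrow> (\<rho>, \<sigma>) \<in> ray_equiv V E"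
    by (rule eq_equiv_class_iff[OF equiv_ray_equiv assms])
  also have "\<dots> \<longleftrightarrow> (\<forall>F. finite F \<and> F \<subseteq> V \<longrightarrow> tail_component V E F \<sigma> = tail_component V E F \<rho>)"
    using assms not_separates_tail_component[OF assms] by (auto simp: ray_equiv_def)
  also have "\<dots> \<longleftrightarrow> (\<forall>F. finite F \<longrightarrow> tail_component V E F \<sigma> = tail_component V E F \<rho>)"
    using tail_component_Int[of V E] by (metis Int_lower2 finite_Int)
  finally show ?thesis .
qed

text \<open>The generating sets already behave like a base: two finite sets \<open>F\<close> and
  \<open>G\<close> are merged into \<open>F \<union> G\<close>, and equal tail components for a
  larger set imply equal ones for a smaller set. The description also replaces ends by representing
  rays.\<close>

lemma openin_end_topology_iff:
  "openin (end_topology V E) U \<longleftrightarrow> U \<subseteq> graph_ends V E \<and>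
     (\<forall>\<rho>\<in>rays V E. end_of V E \<rho> \<in> U \<longrightarrow> (\<exists>F. finite F \<and>
        (\<forall>\<sigma>\<in>rays V E. tail_component V E F \<sigma> = tail_component V E F \<rho> \<longrightarrow> end_of V E \<sigma> \<in> U)))"
    (is "_ \<longleftrightarrow> U \<subseteq> _ \<and> ?P U")
proof (intro iffI conjI)
  assume U: "openin (end_topology V E) U"
  then show "U \<subseteq> graph_ends V E" using openin_subset topspace_end_topology by metis
  from U[unfolded end_topology_def openin_topology_generated_by_iff]
  show "?P U"
  proof (induction rule: generate_topology_on.induct)
    case (Int a b)
    show ?case
    proof (intro ballI impI)
      fix \<rho> assume \<rho>: "\<rho> \<in> rays V E" "end_of V E \<rho> \<in> a \<inter> b"
      then obtain F G where F: "finite F" "\<And>\<sigma>. \<sigma> \<in> rays V E \<Longrightarrow>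
          tail_component V E F \<sigma> = tail_component V E F \<rho> \<Longrightarrow> end_of V E \<sigma> \<in> a"
        and G: "finite G" "\<And>\<sigma>. \<sigma> \<in> rays V E \<Longrightarrow>
          tail_component V E G \<sigma> = tail_component V E G \<rho> \<Longrightarrow> end_of V E \<sigma> \<in> b"
        using Int.IH by (metis IntD1 IntD2)
      have "end_of V E \<sigma> \<in> a \<inter> b"
        if "\<sigma> \<in> rays V E" "tail_component V E (F \<union> G) \<sigma> = tail_component V E (F \<union> G) \<rho>" for \<sigma>
        using F(2)[OF that(1)] G(2)[OF that(1)] F(1) G(1)
          tail_component_eq_antimono[OF \<rho>(1) that(1) _ _ that(2)] by simp
      with F(1) G(1) show "\<exists>F. finite F \<and> (\<forall>\<sigma>\<in>rays V E.
          tail_component V E F \<sigma> = tail_component V E F \<rho> \<longrightarrow> end_of V E \<sigma> \<in> a \<inter> b)"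
        by (intro exI[of _ "F \<union> G"]) auto
    qed
  next
    case (UN K)
    show ?case
    proof (intro ballI impI)
      fix \<rho> assume \<rho>: "\<rho> \<in> rays V E" "end_of V E \<rho> \<in> \<Union> K"
      then obtain k where "k \<in> K" "end_of V E \<rho> \<in> k" by blast
      with UN.IH[OF this(1)] \<rho>(1) obtain F where "finite F" "\<And>\<sigma>. \<sigma> \<in> rays V E \<Longrightarrow>
          tail_component V E F \<sigma> = tail_component V E F \<rho> \<Longrightarrow> end_of V E \<sigma> \<in> k" by metis
      with \<open>k \<in> K\<close> show "\<exists>F. finite F \<and> (\<forall>\<sigma>\<in>rays V E.
          tail_component V E F \<sigma> = tail_component V E F \<rho> \<longrightarrow> end_of V E \<sigma> \<in> \<Union> K)"
        by (intro exI[of _ F]) auto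
    qed
  next
    case (Basis s)
    then obtain r F where r: "r \<in> rays V E" and F: "finite F" "F \<subseteq> V"
      and s: "s = end_nbhd V E (end_of V E r) F" by (auto elim: graph_endsE)
    have mem: "end_of V E \<rho> \<in> s \<longleftrightarrow> tail_component V E F \<rho> = tail_component V E F r"
      if "\<rho> \<in> rays V E" for \<rho>
      using end_nbhd_class_iff[OF r that F] not_separates_tail_component[OF r that F(1)] s by simp
    show ?case
    proof (intro ballI impI exI[of _ F] conjI)
      fix \<rho> \<sigma> assume "\<rho> \<in> rays V E" "end_of V E \<rho> \<in> s" "\<sigma> \<in> rays V E"
        "tail_component V E F \<sigma> = tail_component V E F \<rho>"
      then show "end_of V E \<sigma> \<in> s" using mem by simp
    qed (rule F)
  qed simp
next
  assume "U \<subseteq> graph_ends V E \<and> ?P U"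
  then have U: "U \<subseteq> graph_ends V E" and P: "?P U" by auto
  show "openin (end_topology V E) U"
  proof (subst openin_subopen, intro ballI)
    fix \<epsilon> assume e: "\<epsilon> \<in> U"
    then obtain \<rho> where \<rho>: "\<rho> \<in> rays V E" "\<epsilon> = end_of V E \<rho>" using U by (auto elim: graph_endsE)
    then obtain F where F: "finite F" "\<And>\<sigma>. \<sigma> \<in> rays V E \<Longrightarrow>
        tail_component V E F \<sigma> = tail_component V E F \<rho> \<Longrightarrow> end_of V E \<sigma> \<in> U"
      using P e by metis
    let ?N = "end_nbhd V E \<epsilon> (F \<inter> V)"
    have mem: "end_of V E \<sigma> \<in> ?N \<longleftrightarrow> tail_component V E F \<sigma> = tail_component V E F \<rho>"
      if "\<sigma> \<in> rays V E" for \<sigma>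
      using end_nbhd_class_iff[OF \<rho>(1) that, of "F \<inter> V"] F(1)
        not_separates_tail_component[OF \<rho>(1) that, of "F \<inter> V"]
      by (simp add: \<rho>(2) tail_component_Int)
    have "openin (end_topology V E) ?N" using openin_end_nbhd U e F(1) by (metis finite_Int inf_le2 subsetD)
    moreover have "\<epsilon> \<in> ?N" using mem[OF \<rho>(1)] \<rho>(2) by simp
    moreover have "?N \<subseteq> U"
    proof
      fix \<eta> assume "\<eta> \<in> ?N"
      moreover from this obtain \<sigma> where "\<sigma> \<in> rays V E" "\<eta> = end_of V E \<sigma>"
        by (auto simp: end_nbhd_def elim: graph_endsE)
      ultimately show "\<eta> \<in> U" using mem F(2) by simp
    qed
    ultimately show "\<exists>T. openin (end_topology V E) T \<and> \<epsilon> \<in> T \<and> T \<subseteq> U" by blast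
  qed
qed

lemma openin_tail_component_nbhd:
  assumes "\<rho> \<in> rays V E" "finite F"
  shows "openin (end_topology V E)
    {end_of V E \<sigma> | \<sigma>. \<sigma> \<in> rays V E \<and> tail_component V E F \<sigma> = tail_component V E F \<rho>}" (is "openin _ ?U")
  unfolding openin_end_topology_iff
proof (intro conjI ballI impI exI[of _ F] assms)
  show "?U \<subseteq> graph_ends V E" by (auto intro: end_of_in_graph_ends)
  fix \<sigma> \<tau> assume \<sigma>: "\<sigma> \<in> rays V E" "end_of V E \<sigma> \<in> ?U"
    and \<tau>: "\<tau> \<in> rays V E" "tail_component V E F \<tau> = tail_component V E F \<sigma>"
  from \<sigma> obtain \<sigma>' where \<sigma>': "\<sigma>' \<in> rays V E" "end_of V E \<sigma> = end_of V E \<sigma>'"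
    "tail_component V E F \<sigma>' = tail_component V E F \<rho>" by blast
  then have "tail_component V E F \<sigma>' = tail_component V E F \<sigma>"
    using end_of_eq_iff[OF \<sigma>(1) \<sigma>'(1)] assms(2) by blast
  with \<sigma>'(3) \<tau> show "end_of V E \<tau> \<in> ?U" by auto
qed

text \<open>The branches of the tree are indexed by \<open>nat set\<close>. Each component in it
  carries a marked vertex, and the ray of a branch is obtained by linking these marked
  vertices.\<close>

lemma dense_in_itself_ends:
  assumes Y: "Y \<subseteq> graph_ends V E" "Y \<noteq> {}"
    and perfect: "\<And>y. y \<in> Y \<Longrightarrow> \<not> openin (subtopology (end_topology V E) Y) {y}"
  shows "(UNIV :: nat set set) \<lesssim> graph_ends V E"
proof -
  define N where "N C \<longleftrightarrow> (\<exists>F \<rho>. finite F \<and> \<rho> \<in> rays V E \<and> end_of V E \<rho> \<in> Y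
    \<and> C = tail_component V E F \<rho>)" for C
  define P where "P s \<longleftrightarrow> N (fst s) \<and> snd s \<in> fst s" for s
  \<comment> \<open>The conditions of \<open>nested_ray\<close>: a child omits the marked vertex of
    its parent and is reached from there by a path that meets the child only in its own marked
    vertex.\<close>
  define Q where "Q s t \<longleftrightarrow> P t \<and> fst t \<subseteq> fst s - {snd s}
    \<and> (snd s, snd t) \<in> joined (insert (snd t) (fst s - fst t)) E" for s t
  have split: "\<exists>t u. Q s t \<and> Q s u \<and> fst t \<inter> fst u = {}" if s: "P s" for s
  proof -
    define C v where "C = fst s" and "v = snd s"
    obtain F \<rho> where F: "finite F" and \<rho>: "\<rho> \<in> rays V E" "end_of V E \<rho> \<in> Y" "C = tail_component V E F \<rho>"
      using s by (auto simp: P_def N_def C_def)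
    \<comment> \<open>Deleting the marked vertex as well keeps it out of both children. The
      neighbourhood given by \<open>F'\<close> contains a second end of \<open>Y\<close>, because
      the first is not isolated.\<close>
    define F' where "F' = insert v F"
    have F': "finite F'" by (simp add: F'_def F)
    define U where "U = {end_of V E \<sigma> | \<sigma>. \<sigma> \<in> rays V E \<and> tail_component V E F' \<sigma> = tail_component V E F' \<rho>}"
    have "openin (subtopology (end_topology V E) Y) (U \<inter> Y)"
      unfolding U_def using openin_tail_component_nbhd[OF \<rho>(1) F'] openin_subtopology by blast
    with perfect[OF \<rho>(2)] have "U \<inter> Y \<noteq> {end_of V E \<rho>}" by metis
    moreover have "end_of V E \<rho> \<in> U \<inter> Y" using \<rho> by (auto simp: U_def)
    ultimately obtain \<sigma> where \<sigma>: "\<sigma> \<in> rays V E" "end_of V E \<sigma> \<in> Y" "end_of V E \<rho> \<noteq> end_of V E \<sigma>"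
      "tail_component V E F' \<sigma> = tail_component V E F' \<rho>" unfolding U_def by blast
    then obtain F1 where F1: "finite F1" "tail_component V E F1 \<sigma> \<noteq> tail_component V E F1 \<rho>"
      using end_of_eq_iff[OF \<rho>(1) \<sigma>(1)] by blast
    define G where "G = F' \<union> F1"
    have G: "finite G" using F' F1 by (simp add: G_def)
    define C0 C1 where "C0 = tail_component V E G \<rho>" and "C1 = tail_component V E G \<sigma>"
    have "C0 \<noteq> C1"
      using tail_component_eq_antimono[OF \<rho>(1) \<sigma>(1) G, of F1] F1(2) by (auto simp: C0_def C1_def G_def)
    then have disj: "C0 \<inter> C1 = {}"
      using component_disjoint tail_component_in_components[OF \<rho>(1) G]
        tail_component_in_components[OF \<sigma>(1) G] by (metis C0_def C1_def)
    have sub: "F \<subseteq> G" "F' \<subseteq> G" "F \<subseteq> F'" by (auto simp: G_def F'_def)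
    have "C = tail_component V E F \<sigma>"
      using tail_component_eq_antimono[OF \<rho>(1) \<sigma>(1) F' sub(3) \<sigma>(4)] \<rho>(3) by simp
    then have "C0 \<subseteq> C" "C1 \<subseteq> C"
      using tail_component_mono[OF order_refl sub(1)] \<rho>(3) by (metis C0_def, metis C1_def)
    have v: "v \<notin> C0" "v \<notin> C1"
      using tail_component_subset[of V E G] by (auto simp: C0_def C1_def G_def F'_def)
    have N: "N C0" "N C1" using \<rho> \<sigma> G by (auto simp: N_def C0_def C1_def)
    have entry: "\<exists>u. Q s (C', u)" if C': "N C'" "C' \<subseteq> C" "v \<notin> C'" for C'
    proof -
      obtain F'' \<tau> where "finite F''" "\<tau> \<in> rays V E" "C' = tail_component V E F'' \<tau>"
        using C'(1) by (auto simp: N_def)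
      then obtain y where y: "y \<in> C'"
        using component_nonempty tail_component_in_components by (metis all_not_in_conv)
      have "conn C E" using component_conn[OF tail_component_in_components[OF \<rho>(1) F]] \<rho>(3) by simp
      moreover have "v \<in> C" using s by (simp add: P_def C_def v_def)
      moreover have "y \<in> C" using y C'(2) by auto
      ultimately have "(v, y) \<in> joined C E" by (simp add: conn_def)
      from joined_enter[OF this C'(3) y] obtain u where "u \<in> C'" "(v, u) \<in> joined (insert u (C - C')) E"
        by blast
      then show ?thesis using C' by (intro exI[of _ u]) (auto simp: Q_def P_def C_def v_def)
    qed
    from entry[OF N(1) \<open>C0 \<subseteq> C\<close> v(1)] entry[OF N(2) \<open>C1 \<subseteq> C\<close> v(2)] disj
    show ?thesis by (metis fst_conv)
  qed
  then have "\<forall>s. \<exists>t u. P s \<longrightarrow> Q s t \<and> Q s u \<and> fst t \<inter> fst u = {}" by blast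
  then obtain f g where fg: "\<And>s. P s \<Longrightarrow> Q s (f s) \<and> Q s (g s) \<and> fst (f s) \<inter> fst (g s) = {}"
    unfolding choice_iff by blast
  obtain \<rho>\<^sub>0 where \<rho>\<^sub>0: "\<rho>\<^sub>0 \<in> rays V E" "end_of V E \<rho>\<^sub>0 \<in> Y" using Y by (auto elim: graph_endsE)
  obtain v\<^sub>0 where "v\<^sub>0 \<in> tail_component V E {} \<rho>\<^sub>0"
    using component_nonempty tail_component_in_components[OF \<rho>\<^sub>0(1)] by (metis all_not_in_conv finite.emptyI)
  then have s0: "P (tail_component V E {} \<rho>\<^sub>0, v\<^sub>0)" using \<rho>\<^sub>0 by (auto simp: P_def N_def)
  define st where "st \<beta> = rec_nat (tail_component V E {} \<rho>\<^sub>0, v\<^sub>0)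
    (\<lambda>n s. if n \<in> \<beta> then f s else g s)" for \<beta> :: "nat set"
  have st0: "st \<beta> 0 = (tail_component V E {} \<rho>\<^sub>0, v\<^sub>0)"
    and st_Suc: "st \<beta> (Suc n) = (if n \<in> \<beta> then f (st \<beta> n) else g (st \<beta> n))" for \<beta> n
    by (simp_all add: st_def)
  have P: "P (st \<beta> n)" for \<beta> n
  proof (induction n)
    case (Suc n)
    then show ?case using fg[OF Suc] by (simp add: st_Suc Q_def)
  qed (simp add: st0 s0)
  have Q: "Q (st \<beta> n) (st \<beta> (Suc n))" for \<beta> n using fg[OF P] by (simp add: st_Suc)
  have "\<exists>\<rho>. \<rho> \<in> rays V E \<and> (\<forall>n. \<forall>\<^sub>F j in sequentially. \<rho> j \<in> fst (st \<beta> n))" for \<beta>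
  proof -
    have "fst (st \<beta> (Suc n)) \<subseteq> fst (st \<beta> n)" "snd (st \<beta> n) \<in> fst (st \<beta> n) - fst (st \<beta> (Suc n))"
      "(snd (st \<beta> n), snd (st \<beta> (Suc n)))
        \<in> joined (insert (snd (st \<beta> (Suc n))) (fst (st \<beta> n) - fst (st \<beta> (Suc n)))) E" for n
      using Q[of \<beta> n] P[of \<beta> n] unfolding Q_def P_def by auto
    from nested_ray[of "\<lambda>n. fst (st \<beta> n)" "\<lambda>n. snd (st \<beta> n)" E, OF this]
    obtain \<rho> where \<rho>: "\<rho> \<in> rays (fst (st \<beta> 0)) E"
      "\<And>n. \<forall>\<^sub>F j in sequentially. (snd (st \<beta> n), \<rho> j) \<in> joined (fst (st \<beta> n) - (\<Inter>m. fst (st \<beta> m))) E"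
      by blast
    have "\<forall>\<^sub>F j in sequentially. \<rho> j \<in> fst (st \<beta> n)" for n
      using \<rho>(2)[of n] by (rule eventually_mono) (auto dest: joined_mem)
    moreover have "\<rho> \<in> rays V E"
      using rays_mono[OF \<rho>(1)] tail_component_subset[of V E "{}" \<rho>\<^sub>0] by (simp add: st0)
    ultimately show ?thesis by blast
  qed
  then obtain R where R: "\<And>\<beta>. R \<beta> \<in> rays V E"
    "\<And>\<beta> n. \<forall>\<^sub>F j in sequentially. R \<beta> j \<in> fst (st \<beta> n)" by metis
  have "end_of V E (R \<beta>) \<noteq> end_of V E (R \<gamma>)" if "\<beta> \<noteq> \<gamma>" for \<beta> \<gamma>
  proof
    assume eq: "end_of V E (R \<beta>) = end_of V E (R \<gamma>)"
    \<comment> \<open>Up to the first difference \<open>n\<close> both branches have the same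
      states; then they turn to disjoint children.\<close>
    define n where "n = (LEAST n. (n \<in> \<beta>) \<noteq> (n \<in> \<gamma>))"
    have n: "(n \<in> \<beta>) \<noteq> (n \<in> \<gamma>)" unfolding n_def by (rule LeastI_ex) (use that in blast)
    have min: "(m \<in> \<beta>) = (m \<in> \<gamma>)" if "m < n" for m using not_less_Least that unfolding n_def by blast
    have "st \<beta> m = st \<gamma> m" if "m \<le> n" for m
      using that by (induction m) (auto simp: st0 st_Suc min)
    then have disj: "fst (st \<beta> (Suc n)) \<inter> fst (st \<gamma> (Suc n)) = {}"
      using fg[OF P, of \<beta> n] n by (auto simp: st_Suc)
    obtain F \<sigma> where F: "finite F" and \<sigma>: "\<sigma> \<in> rays V E" and C: "fst (st \<beta> (Suc n)) = tail_component V E F \<sigma>"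
      using P[of \<beta> "Suc n"] by (auto simp: P_def N_def)
    have "tail_component V E F (R \<beta>) = fst (st \<beta> (Suc n))"
      using tail_component_in_components[OF \<sigma> F] R(2)[of \<beta> "Suc n"] C
      by (intro tail_component_eqI[OF R(1) F] eventually_frequently[OF sequentially_bot]) auto
    then have "tail_component V E F (R \<gamma>) = fst (st \<beta> (Suc n))"
      using eq end_of_eq_iff[OF R(1) R(1)] F by metis
    then have "\<forall>\<^sub>F j in sequentially. R \<gamma> j \<in> fst (st \<beta> (Suc n))"
      using tail_component_mem[OF R(1) F] by metis
    then have "\<forall>\<^sub>F j in sequentially. R \<gamma> j \<in> fst (st \<beta> (Suc n)) \<inter> fst (st \<gamma> (Suc n))"
      using R(2)[of \<gamma> "Suc n"] by (simp add: eventually_conj)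
    with disj show False by simp
  qed
  then have "inj (\<lambda>\<beta>. end_of V E (R \<beta>))" unfolding inj_def by blast
  moreover have "range (\<lambda>\<beta>. end_of V E (R \<beta>)) \<subseteq> graph_ends V E"
    using end_of_in_graph_ends[OF R(1)] by (simp add: image_subset_iff)
  ultimately show ?thesis unfolding lepoll_def by (intro exI conjI)
qed

text \<open>The homeomorphism carries a subset without isolated points to a set of ends without
  isolated points. The resulting \<open>2\<^sup>\<aleph>\<^sup>0\<close> ends contradict
  \<open>small\<close>.\<close>

lemma end_space_imp_scattered:
  assumes "end_space S" and small: "topspace S \<prec> (UNIV :: nat set set)"
  shows "scattered_space S"
  unfolding scattered_space_def
proof (intro allI impI)
  fix Y assume Y: "Y \<subseteq> topspace S" "Y \<noteq> {}"
  obtain W D where "S homeomorphic_space end_topology (W :: (nat + 'a) set) D"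
    using assms(1) by (auto simp: end_space_def)
  then obtain k where k: "homeomorphic_map S (end_topology W D) k"
    unfolding homeomorphic_space by blast
  then have cont: "continuous_map S (end_topology W D) k" and inj: "inj_on k (topspace S)"
    and surj: "k ` topspace S = graph_ends W D"
    using homeomorphic_imp_continuous_map homeomorphic_imp_injective_map
      homeomorphic_imp_surjective_map topspace_end_topology by metis+
  show "\<exists>y\<in>Y. openin (subtopology S Y) {y}"
  proof (rule ccontr)
    assume no: "\<not> (\<exists>y\<in>Y. openin (subtopology S Y) {y})"
    have "\<not> openin (subtopology (end_topology W D) (k ` Y)) {z}" if z: "z \<in> k ` Y" for z
    proof
      assume "openin (subtopology (end_topology W D) (k ` Y)) {z}"
      then obtain U where U: "openin (end_topology W D) U" "{z} = U \<inter> k ` Y"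
        by (auto simp: openin_subtopology)
      obtain y where y: "y \<in> Y" "z = k y" using z by blast
      have "{y} = {x \<in> topspace S. k x \<in> U} \<inter> Y"
      proof (intro equalityI subsetI)
        fix x assume "x \<in> {x \<in> topspace S. k x \<in> U} \<inter> Y"
        then have "x \<in> Y" "k x = k y" using U(2) y(2) by auto
        then show "x \<in> {y}" using inj_onD[OF inj] y(1) Y(1) by blast
      qed (use U(2) y Y(1) in auto)
      then have "openin (subtopology S Y) {y}"
        unfolding openin_subtopology using openin_continuous_map_preimage[OF cont U(1)]
        by (intro exI[of _ "{x \<in> topspace S. k x \<in> U}"] conjI)
      with no y show False by blast
    qed
    then have "(UNIV :: nat set set) \<lesssim> graph_ends W D"
      by (intro dense_in_itself_ends[of "k ` Y"]) (use Y surj in auto)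
    also have "graph_ends W D \<lesssim> topspace S" using surj subset_image_lepoll by (metis order_refl)
    finally show False using small lepoll_antisym unfolding lesspoll_def by blast
  qed
qed

section \<open>Envelopes and separators\<close>

text \<open>This is the star-comb lemma in disguise. If infinitely many vertices of \<open>T\<close> were attached to
  \<open>C\<close>, then in a breadth-first search tree of \<open>C\<close> some vertex with infinitely many attachments above
  it would have no such child, contradicting \<open>closed\<close>, or there would be a branch of such vertices,
  contradicting \<open>dispersed\<close>.\<close>

lemma finite_nbs_component:
  assumes closed: "\<And>c. c \<in> A - T \<Longrightarrow> \<exists>F. finite F \<and> c \<notin> F \<and> (\<forall>t\<in>T. (c, t) \<notin> joined (A - F) E)"
    and dispersed: "\<And>\<rho>. \<rho> \<in> rays (A - T) E \<Longrightarrow> \<exists>F. finite F \<and> tail_component A E F \<rho> \<inter> T = {}"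
    and C: "C \<in> components_of_graph (A - T) E"
  shows "finite (nbs A E C)"
proof (rule ccontr)
  assume inf: "infinite (nbs A E C)"
  have NT: "nbs A E C \<subseteq> T" by (rule nbs_component[OF C])
  have CA: "C \<subseteq> A - T" by (rule component_subset[OF C])
  obtain c0 where c0: "c0 \<in> C" using component_nonempty[OF C] by blast
  define R where "R = {(x, y). x \<in> C \<and> y \<in> C \<and> {x, y} \<in> E}"
  define d where "d v = (LEAST k. (c0, v) \<in> R ^^ k)" for v
  have d: "(c0, v) \<in> R ^^ d v" if "v \<in> C" for v
  proof -
    have "(c0, v) \<in> R\<^sup>*" using component_conn[OF C] c0 that by (simp add: conn_def joined_def R_def)
    then have "\<exists>k. (c0, v) \<in> R ^^ k" by (rule rtrancl_imp_relpow)
    then show ?thesis unfolding d_def by (rule LeastI_ex)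
  qed
  have d_le: "d v \<le> k" if "(c0, v) \<in> R ^^ k" for v k
    unfolding d_def using that by (rule Least_le)
  have "\<exists>u. u \<in> C \<and> {u, v} \<in> E \<and> d v = Suc (d u)" if v: "v \<in> C" "v \<noteq> c0" for v
  proof -
    obtain k where k: "d v = Suc k" using d[OF v(1)] v(2) by (cases "d v") auto
    then obtain u where u: "(c0, u) \<in> R ^^ k" "(u, v) \<in> R" using d[OF v(1)] by auto
    then have "u \<in> C" by (auto simp: R_def)
    then have "(c0, v) \<in> R ^^ Suc (d u)" using d[of u] u(2) by (auto intro: relpow_Suc_I)
    then have "d v \<le> Suc (d u)" by (rule d_le)
    then show ?thesis using d_le[OF u(1)] k u(2) \<open>u \<in> C\<close> by (intro exI[of _ u]) (auto simp: R_def)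
  qed
  then obtain par where par: "\<And>v. v \<in> C \<Longrightarrow> v \<noteq> c0 \<Longrightarrow> par v \<in> C \<and> {par v, v} \<in> E \<and> d v = Suc (d (par v))"
    by metis
  have d0: "d c0 = 0" using d_le[of c0 0] by simp
  \<comment> \<open>The breadth-first tree: every vertex of \<open>C\<close> other than
    \<open>c0\<close> is joined to a chosen neighbour one step nearer to \<open>c0\<close>.\<close>
  define Q where "Q = {(par v, v) | v. v \<in> C \<and> v \<noteq> c0}"
  have Q: "u \<in> C \<and> v \<in> C \<and> {u, v} \<in> E \<and> d v = Suc (d u)" if "(u, v) \<in> Q" for u v
    using that par by (auto simp: Q_def)
  have root: "(c0, v) \<in> Q\<^sup>*" if "v \<in> C" for v
    using that
  proof (induction "d v" arbitrary: v rule: less_induct)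
    case less
    show ?case
    proof (cases "v = c0")
      case False
      then have "(c0, par v) \<in> Q\<^sup>*" using less par by simp
      moreover have "(par v, v) \<in> Q" using less.prems False by (auto simp: Q_def)
      ultimately show ?thesis by (rule rtrancl.rtrancl_into_rtrancl)
    qed simp
  qed
  have up: "v \<in> C \<and> d t \<le> d v" if "(t, v) \<in> Q\<^sup>*" "t \<in> C" for t v
    using that(1)
  proof (induction rule: rtrancl_induct)
    case (step y z)
    then show ?case using Q[OF step.hyps(2)] by simp
  qed (simp add: that)
  have anc: "finite {t. (t, v) \<in> Q\<^sup>*}" for v
  proof (induction "d v" arbitrary: v rule: less_induct)
    case less
    have "{t. (t, v) \<in> Q\<^sup>*} \<subseteq> insert v {t. v \<in> C \<and> v \<noteq> c0 \<and> (t, par v) \<in> Q\<^sup>*}"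
      by (auto simp: Q_def elim: rtranclE)
    moreover have "finite {t. v \<in> C \<and> v \<noteq> c0 \<and> (t, par v) \<in> Q\<^sup>*}"
      using less par[of v] by (cases "v \<in> C \<and> v \<noteq> c0") auto
    ultimately show ?case using finite_subset by blast
  qed
  have path: "(t, v) \<in> joined (A - F) E"
    if "(t, v) \<in> Q\<^sup>*" "t \<in> C" "\<And>w. (t, w) \<in> Q\<^sup>* \<Longrightarrow> w \<notin> F" for t v F
    using that(1)
  proof (induction rule: rtrancl_induct)
    case base
    then show ?case using that CA by (auto intro: joined_refl)
  next
    case (step y z)
    have "y \<in> A - F" "z \<in> A - F"
      using up[OF step.hyps(1) that(2)] Q[OF step.hyps(2)] that(3)[OF step.hyps(1)]
        that(3)[OF rtrancl.rtrancl_into_rtrancl[OF step.hyps]] CA by auto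
    then have "(y, z) \<in> joined (A - F) E" using Q[OF step.hyps(2)] by (intro joined_edge) auto
    with step.IH show ?case by (rule joined_trans)
  qed
  have "\<exists>c. c \<in> C \<and> {c, u} \<in> E" if "u \<in> nbs A E C" for u using that by (auto simp: nbs_def)
  then obtain att where att: "\<And>u. u \<in> nbs A E C \<Longrightarrow> att u \<in> C \<and> {att u, u} \<in> E" by metis
  have NA: "u \<in> A" if "u \<in> nbs A E C" for u using that by (simp add: nbs_def)
  \<comment> \<open>The vertices with infinitely many attachments in the subtree above them, where
    \<open>att u\<close> is a chosen neighbour of \<open>u\<close> in \<open>C\<close>.\<close>
  define I where "I t \<longleftrightarrow> t \<in> C \<and> infinite {u \<in> nbs A E C. (t, att u) \<in> Q\<^sup>*}" for t
  have "{u \<in> nbs A E C. (c0, att u) \<in> Q\<^sup>*} = nbs A E C" using att root by blast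
  then have I0: "I c0" using inf c0 by (simp add: I_def)
  have child: "\<exists>t'. (t, t') \<in> Q \<and> I t'" if "I t" for t
  proof (rule ccontr)
    assume no: "\<not> (\<exists>t'. (t, t') \<in> Q \<and> I t')"
    have tC: "t \<in> C" using that by (simp add: I_def)
    then obtain F where F: "finite F" "t \<notin> F" "\<And>s. s \<in> T \<Longrightarrow> (t, s) \<notin> joined (A - F) E"
      using closed[of t] CA by blast
    \<comment> \<open>These children are finitely many, since each vertex of \<open>F\<close> has
      finitely many ancestors. The subtree above any other child avoids \<open>F\<close>, so an
      attachment there outside \<open>F\<close> would be joined to \<open>t\<close> in
      \<open>A - F\<close>.\<close>
    define Ch where "Ch = {t'. (t, t') \<in> Q \<and> (\<exists>f\<in>F. (t', f) \<in> Q\<^sup>*)}"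
    have "Ch \<subseteq> (\<Union>f\<in>F. {t'. (t', f) \<in> Q\<^sup>*})" by (auto simp: Ch_def)
    then have "finite Ch" using F(1) anc finite_subset by blast
    moreover have "finite {u \<in> nbs A E C. (t', att u) \<in> Q\<^sup>*}" if "t' \<in> Ch" for t'
      using no that Q by (auto simp: Ch_def I_def)
    ultimately have "finite (F \<union> (\<Union>t'\<in>Ch. {u \<in> nbs A E C. (t', att u) \<in> Q\<^sup>*}))" using F(1) by blast
    moreover have "{u \<in> nbs A E C. (t, att u) \<in> Q\<^sup>*} \<subseteq> F \<union> (\<Union>t'\<in>Ch. {u \<in> nbs A E C. (t', att u) \<in> Q\<^sup>*})"
    proof
      fix u assume "u \<in> {u \<in> nbs A E C. (t, att u) \<in> Q\<^sup>*}"
      then have u: "u \<in> nbs A E C" "(t, att u) \<in> Q\<^sup>*" by auto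
      show "u \<in> F \<union> (\<Union>t'\<in>Ch. {u \<in> nbs A E C. (t', att u) \<in> Q\<^sup>*})"
      proof (rule ccontr)
        assume n: "u \<notin> F \<union> (\<Union>t'\<in>Ch. {u \<in> nbs A E C. (t', att u) \<in> Q\<^sup>*})"
        have *: "(t, att u) \<in> joined (A - F) E"
          using u(2)
        proof (cases rule: converse_rtranclE)
          case base
          then show ?thesis using tC CA F(2) by (auto intro: joined_refl)
        next
          case (step t')
          then have "t' \<notin> Ch" using n u by blast
          then have "\<And>w. (t', w) \<in> Q\<^sup>* \<Longrightarrow> w \<notin> F" using step by (auto simp: Ch_def)
          then have "(t', att u) \<in> joined (A - F) E" using path step Q by blast
          moreover from joined_mem[OF this] have "(t, t') \<in> joined (A - F) E"
            using Q[OF step(1)] tC CA F(2) by (intro joined_edge) auto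
          ultimately show ?thesis using joined_trans by metis
        qed
        moreover have "(att u, u) \<in> joined (A - F) E"
          using joined_mem[OF *] att[OF u(1)] NA[OF u(1)] n by (intro joined_edge) auto
        ultimately have "(t, u) \<in> joined (A - F) E" by (rule joined_trans)
        then show False using F(3) NT u(1) by blast
      qed
    qed
    ultimately show False using that finite_subset unfolding I_def by blast
  qed
  define \<tau> where "\<tau> = rec_nat c0 (\<lambda>_ t. SOME t'. (t, t') \<in> Q \<and> I t')"
  have \<tau>0: "\<tau> 0 = c0" and \<tau>_Suc: "\<tau> (Suc n) = (SOME t'. (\<tau> n, t') \<in> Q \<and> I t')" for n
    by (simp_all add: \<tau>_def)
  have I: "I (\<tau> n)" for n
  proof (induction n)
    case (Suc n)
    then show ?case using someI_ex[OF child[OF Suc]] by (simp add: \<tau>_Suc)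
  qed (simp add: \<tau>0 I0)
  have Q\<tau>: "(\<tau> n, \<tau> (Suc n)) \<in> Q" for n using someI_ex[OF child[OF I]] by (simp add: \<tau>_Suc)
  have d\<tau>: "d (\<tau> n) = n" for n by (induction n) (use Q[OF Q\<tau>] in \<open>auto simp: \<tau>0 d0\<close>)
  then have "inj \<tau>" by (metis injI)
  moreover have "\<tau> n \<in> A - T" for n using I CA by (auto simp: I_def)
  ultimately have ray: "\<tau> \<in> rays (A - T) E" using Q[OF Q\<tau>] by (auto simp: rays_def)
  obtain F where F: "finite F" "tail_component A E F \<tau> \<inter> T = {}" using dispersed[OF ray] by blast
  have "\<tau> \<in> rays A E" by (rule rays_mono[OF ray]) blast
  from tail_component_mem[OF this F(1)] obtain m
    where m: "\<And>n. n \<ge> m \<Longrightarrow> \<tau> n \<in> tail_component A E F \<tau>" unfolding eventually_sequentially by blast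
  \<comment> \<open>The subtree above \<open>\<tau> n\<close> has depth at least \<open>n\<close>,
    so exceeding the depths of all vertices of \<open>F\<close> keeps it clear of \<open>F\<close>.
    Inserting \<open>0\<close> covers the case of empty \<open>F\<close>.\<close>
  define n where "n = max m (Suc (Max (insert 0 (d ` F))))"
  have dF: "d f < n" if "f \<in> F" for f
    using Max_ge[of "insert 0 (d ` F)" "d f"] F(1) that by (simp add: n_def less_max_iff_disj less_Suc_eq_le)
  have avoid: "w \<notin> F" if "(\<tau> n, w) \<in> Q\<^sup>*" for w
  proof
    assume "w \<in> F"
    then have "d w < n" by (rule dF)
    then show False using up[OF that] I[of n] d\<tau>[of n] by (simp add: I_def)
  qed
  have "\<not> {u \<in> nbs A E C. (\<tau> n, att u) \<in> Q\<^sup>*} \<subseteq> F" using I F(1) finite_subset by (auto simp: I_def)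
  then obtain u where u: "u \<in> nbs A E C" "(\<tau> n, att u) \<in> Q\<^sup>*" "u \<notin> F" by blast
  have *: "(\<tau> n, att u) \<in> joined (A - F) E" using path[OF u(2) _ avoid] I[of n] by (simp add: I_def)
  moreover have "(att u, u) \<in> joined (A - F) E"
    using joined_mem[OF *] att[OF u(1)] NA[OF u(1)] u(3) by (intro joined_edge) auto
  ultimately have "(\<tau> n, u) \<in> joined (A - F) E" by (rule joined_trans)
  then have "u \<in> tail_component A E F \<tau>" using tail_component_closed[OF m[of n]] by (simp add: n_def)
  then show False using F(2) NT u(1) by blast
qed

text \<open>Adjoins to \<open>S\<close> the vertices that no finite set separates from it. This
  makes the hypothesis \<open>closed\<close> of \<open>finite_nbs_component\<close> hold for the
  enlarged set.\<close>

definition vertex_closure :: "'v set \<Rightarrow> 'v set set \<Rightarrow> 'v set \<Rightarrow> 'v set" where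
  "vertex_closure A E S =
    {v \<in> A. \<forall>F. finite F \<longrightarrow> v \<notin> F \<longrightarrow> (\<exists>s\<in>S. (v, s) \<in> joined (A - F) E)}"

lemma subset_vertex_closure: "S \<subseteq> A \<Longrightarrow> S \<subseteq> vertex_closure A E S"
  unfolding vertex_closure_def by (auto intro!: joined_refl bexI)

lemma tail_component_vertex_closure:
  assumes "tail_component A E F \<rho> \<inter> S = {}" "finite F"
  shows "tail_component A E F \<rho> \<inter> vertex_closure A E S = {}"
proof (rule ccontr)
  assume "\<not> ?thesis"
  then obtain v where v: "v \<in> tail_component A E F \<rho>" "v \<in> vertex_closure A E S" by blast
  then have "v \<notin> F" using tail_component_subset[of A E F \<rho>] by blast
  then obtain s where "s \<in> S" "(v, s) \<in> joined (A - F) E"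
    using v(2) assms(2) by (auto simp: vertex_closure_def)
  then show False using tail_component_closed[OF v(1)] assms(1) by blast
qed

text \<open>A finite set separating \<open>c\<close> from \<open>S\<close> separates it from the
  closure too: a path from \<open>c\<close> to a vertex of the closure could be prolonged to
  \<open>S\<close> within \<open>A - F\<close>. So only a condition on rays is left, and only for
  \<open>S\<close> itself.\<close>

lemma finite_nbs_vertex_closure:
  assumes "\<And>\<rho>. \<rho> \<in> rays (A - vertex_closure A E S) E \<Longrightarrow> \<exists>F. finite F \<and> tail_component A E F \<rho> \<inter> S = {}"
    and "C \<in> components_of_graph (A - vertex_closure A E S) E"
  shows "finite (nbs A E C)"
proof (rule finite_nbs_component[OF _ _ assms(2)])
  fix c assume "c \<in> A - vertex_closure A E S"
  then obtain F where F: "finite F" "c \<notin> F" "\<And>s. s \<in> S \<Longrightarrow> (c, s) \<notin> joined (A - F) E"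
    by (auto simp: vertex_closure_def)
  have "(c, t) \<notin> joined (A - F) E" if t: "t \<in> vertex_closure A E S" for t
  proof
    assume ct: "(c, t) \<in> joined (A - F) E"
    then have "t \<notin> F" using joined_mem[OF ct] by blast
    then obtain s where "s \<in> S" "(t, s) \<in> joined (A - F) E"
      using t F(1) by (auto simp: vertex_closure_def)
    then show False using joined_trans[OF ct] F(3) by blast
  qed
  with F show "\<exists>F. finite F \<and> c \<notin> F \<and> (\<forall>t\<in>vertex_closure A E S. (c, t) \<notin> joined (A - F) E)" by blast
next
  fix \<rho> assume "\<rho> \<in> rays (A - vertex_closure A E S) E"
  with assms(1) obtain F where F: "finite F" "tail_component A E F \<rho> \<inter> S = {}" by blast
  then show "\<exists>F. finite F \<and> tail_component A E F \<rho> \<inter> vertex_closure A E S = {}"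
    using tail_component_vertex_closure[OF F(2,1)] by blast
qed

text \<open>The hypothesis says that failing \<open>Z\<close> is an open property. Take a maximal
  family of disjoint rays with \<open>Z\<close>, and as \<open>T\<close> the vertex closure of their
  union. Maximality leaves no ray with \<open>Z\<close> outside \<open>T\<close>. A ray without
  \<open>Z\<close> escapes from \<open>T\<close>, because a suitable tail component of it meets only
  finitely many members of the family, each in finitely many vertices.\<close>

lemma envelope:
  assumes opn: "\<And>\<rho>. \<rho> \<in> rays A E \<Longrightarrow> \<not> Z \<rho> \<Longrightarrow> \<exists>F. finite F \<and>
      (\<forall>\<sigma>\<in>rays A E. (\<forall>\<^sub>F n in sequentially. \<sigma> n \<in> tail_component A E F \<rho>) \<longrightarrow> \<not> Z \<sigma>)"
  obtains T where "T \<subseteq> A" "\<And>C. C \<in> components_of_graph (A - T) E \<Longrightarrow> finite (nbs A E C)"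
    and "\<And>\<rho>. \<rho> \<in> rays A E \<Longrightarrow> \<not> Z \<rho> \<Longrightarrow> \<forall>\<^sub>F n in sequentially. \<rho> n \<notin> T"
    and "\<And>\<rho>. \<rho> \<in> rays (A - T) E \<Longrightarrow> \<not> Z \<rho>"
proof -
  define \<S> where "\<S> = {M. M \<subseteq> {\<sigma> \<in> rays A E. Z \<sigma>}
    \<and> (\<forall>\<sigma>\<in>M. \<forall>\<tau>\<in>M. \<sigma> \<noteq> \<tau> \<longrightarrow> range \<sigma> \<inter> range \<tau> = {})}"
  have "\<exists>M\<in>\<S>. \<forall>X\<in>\<S>. M \<subseteq> X \<longrightarrow> X = M"
  proof (rule subset_Zorn')
    fix \<C> assume chain: "subset.chain \<S> \<C>"
    then have sub: "\<C> \<subseteq> \<S>" and tot: "\<And>X Y. X \<in> \<C> \<Longrightarrow> Y \<in> \<C> \<Longrightarrow> X \<subseteq> Y \<or> Y \<subseteq> X"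
      by (auto simp: subset.chain_def)
    have "range \<sigma> \<inter> range \<tau> = {}" if st: "\<sigma> \<in> \<Union>\<C>" "\<tau> \<in> \<Union>\<C>" "\<sigma> \<noteq> \<tau>" for \<sigma> \<tau>
    proof -
      obtain X where "X \<in> \<C>" "\<sigma> \<in> X" "\<tau> \<in> X" using st(1,2) tot by blast
      then show ?thesis using sub st(3) unfolding \<S>_def by fast
    qed
    moreover have "\<Union>\<C> \<subseteq> {\<sigma> \<in> rays A E. Z \<sigma>}" using sub unfolding \<S>_def by blast
    ultimately show "\<Union>\<C> \<in> \<S>" unfolding \<S>_def by blast
  qed
  then obtain M where "M \<in> \<S>" and max: "\<And>X. X \<in> \<S> \<Longrightarrow> M \<subseteq> X \<Longrightarrow> X = M" by blast
  then have M: "\<And>\<sigma>. \<sigma> \<in> M \<Longrightarrow> \<sigma> \<in> rays A E \<and> Z \<sigma>"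
    and disj: "\<And>\<sigma> \<tau>. \<sigma> \<in> M \<Longrightarrow> \<tau> \<in> M \<Longrightarrow> \<sigma> \<noteq> \<tau> \<Longrightarrow> range \<sigma> \<inter> range \<tau> = {}"
    by (auto simp: \<S>_def)
  define S where "S = (\<Union>\<sigma>\<in>M. range \<sigma>)"
  have SA: "S \<subseteq> A" using M by (auto simp: S_def rays_def)
  have away: "\<exists>F. finite F \<and> tail_component A E F \<rho> \<inter> S = {}" if \<rho>: "\<rho> \<in> rays A E" "\<not> Z \<rho>" for \<rho>
  proof -
    obtain F where F: "finite F"
      "\<And>\<sigma>. \<sigma> \<in> rays A E \<Longrightarrow> \<forall>\<^sub>F n in sequentially. \<sigma> n \<in> tail_component A E F \<rho> \<Longrightarrow> \<not> Z \<sigma>"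
      using opn[OF \<rho>] by blast
    let ?C = "tail_component A E F \<rho>"
    have closedC: "y \<in> ?C" if "x \<in> ?C" "(x, y) \<in> joined (A - F) E" for x y
      using tail_component_closed that by metis
    define M' where "M' = {\<sigma> \<in> M. range \<sigma> \<inter> ?C \<noteq> {}}"
    \<comment> \<open>A member that visits \<open>?C\<close> after its last visit to
      \<open>F\<close> would have a tail there, contrary to the choice of \<open>F\<close>.\<close>
    have tail: "\<not> (\<exists>m k. k \<ge> m \<and> \<sigma> k \<in> ?C \<and> (\<forall>n\<ge>m. \<sigma> n \<notin> F))" if "\<sigma> \<in> M" for \<sigma>
    proof
      assume "\<exists>m k. k \<ge> m \<and> \<sigma> k \<in> ?C \<and> (\<forall>n\<ge>m. \<sigma> n \<notin> F)"
      then obtain m k where k: "k \<ge> m" "\<sigma> k \<in> ?C" "\<And>n. n \<ge> m \<Longrightarrow> \<sigma> n \<notin> F" by blast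
      have \<sigma>: "\<sigma> \<in> rays A E" "Z \<sigma>" using M that by auto
      have "(\<sigma> k, \<sigma> n) \<in> joined (A - F) E" if "n \<ge> m" for n
        using ray_tail_joined[OF \<sigma>(1), of m "A - F" k n] k ray_mem[OF \<sigma>(1)] that by auto
      then have "\<sigma> n \<in> ?C" if "n \<ge> m" for n using closedC k(2) that by blast
      then have "\<forall>\<^sub>F n in sequentially. \<sigma> n \<in> ?C" unfolding eventually_sequentially by blast
      then show False using F(2)[OF \<sigma>(1)] \<sigma>(2) by blast
    qed
    have fin: "finite (range \<sigma> \<inter> ?C)" if "\<sigma> \<in> M" for \<sigma>
    proof -
      have "\<sigma> \<in> rays A E" using M that by blast
      from ray_leaves_finite[OF this F(1)] obtain m where m: "\<And>n. n \<ge> m \<Longrightarrow> \<sigma> n \<notin> F"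
        unfolding eventually_sequentially by blast
      then have "\<sigma> k \<notin> ?C" if "k \<ge> m" for k using tail[OF \<open>\<sigma> \<in> M\<close>] that by blast
      then have "range \<sigma> \<inter> ?C \<subseteq> \<sigma> ` {..<m}" by (force simp: not_le[symmetric])
      then show ?thesis by (rule finite_subset) simp
    qed
    \<comment> \<open>Members meeting \<open>?C\<close> must use a vertex of \<open>F\<close>, and
      disjoint members use different ones.\<close>
    have "\<exists>f. f \<in> F \<inter> range \<sigma>" if \<sigma>: "\<sigma> \<in> M'" for \<sigma>
    proof (rule ccontr)
      assume no: "\<nexists>f. f \<in> F \<inter> range \<sigma>"
      obtain k where "\<sigma> k \<in> ?C" "\<sigma> \<in> M" using \<sigma> by (auto simp: M'_def)
      then show False using tail[of \<sigma>] no by blast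
    qed
    then obtain f where f: "\<And>\<sigma>. \<sigma> \<in> M' \<Longrightarrow> f \<sigma> \<in> F \<inter> range \<sigma>" by metis
    have "inj_on f M'"
    proof (rule inj_onI)
      fix \<sigma> \<tau> assume "\<sigma> \<in> M'" "\<tau> \<in> M'" "f \<sigma> = f \<tau>"
      then have "range \<sigma> \<inter> range \<tau> \<noteq> {}" using f[of \<sigma>] f[of \<tau>] by auto
      then show "\<sigma> = \<tau>" using disj[of \<sigma> \<tau>] \<open>\<sigma> \<in> M'\<close> \<open>\<tau> \<in> M'\<close> by (auto simp: M'_def)
    qed
    moreover have "f ` M' \<subseteq> F" using f by blast
    ultimately have "finite M'" using F(1) finite_subset finite_imageD by metis
    define F' where "F' = F \<union> (\<Union>\<sigma>\<in>M'. range \<sigma> \<inter> ?C)"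
    have "finite F'" using F(1) \<open>finite M'\<close> fin unfolding F'_def
      by (intro finite_UnI finite_UN_I) (auto simp: M'_def)
    moreover have "tail_component A E F' \<rho> \<inter> S = {}"
    proof (rule ccontr)
      assume "tail_component A E F' \<rho> \<inter> S \<noteq> {}"
      then obtain v \<sigma> where v: "v \<in> tail_component A E F' \<rho>" "\<sigma> \<in> M" "v \<in> range \<sigma>"
        by (auto simp: S_def)
      have "v \<in> ?C" using tail_component_mono[of A A F F' E \<rho>] v(1) by (auto simp: F'_def)
      then have "v \<in> F'" using v by (auto simp: F'_def M'_def)
      then show False using tail_component_subset[of A E F' \<rho>] v(1) by blast
    qed
    ultimately show ?thesis by blast
  qed
  let ?T = "vertex_closure A E S"
  have nonZ: "\<not> Z \<rho>" if \<rho>: "\<rho> \<in> rays (A - ?T) E" for \<rho>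
  proof
    assume Z: "Z \<rho>"
    have r: "range \<rho> \<inter> S = {}" using \<rho> subset_vertex_closure[OF SA, of E] by (auto simp: rays_def)
    have *: "range \<rho> \<inter> range \<sigma> = {}" if "\<sigma> \<in> M" for \<sigma> using r that by (auto simp: S_def)
    have "\<rho> \<in> rays A E" by (rule rays_mono[OF \<rho>]) blast
    then have "insert \<rho> M \<subseteq> {\<sigma> \<in> rays A E. Z \<sigma>}" using Z M by blast
    moreover have "range \<sigma> \<inter> range \<tau> = {}"
      if "\<sigma> \<in> insert \<rho> M" "\<tau> \<in> insert \<rho> M" "\<sigma> \<noteq> \<tau>" for \<sigma> \<tau>
      using that *[of \<sigma>] *[of \<tau>] disj[of \<sigma> \<tau>] by (metis Int_commute insertE)
    ultimately have "insert \<rho> M \<in> \<S>" unfolding \<S>_def by blast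
    then have "insert \<rho> M = M" by (rule max) blast
    then have "\<rho> \<in> M" by blast
    with r show False by (auto simp: S_def)
  qed
  show thesis
  proof
    show "?T \<subseteq> A" by (auto simp: vertex_closure_def)
    show "finite (nbs A E C)" if "C \<in> components_of_graph (A - ?T) E" for C
    proof (rule finite_nbs_vertex_closure[OF _ that])
      fix \<rho> assume \<rho>: "\<rho> \<in> rays (A - ?T) E"
      then have "\<rho> \<in> rays A E" by (rule rays_mono) blast
      then show "\<exists>F. finite F \<and> tail_component A E F \<rho> \<inter> S = {}"
        by (rule away) (rule nonZ[OF \<rho>])
    qed
    show "\<forall>\<^sub>F n in sequentially. \<rho> n \<notin> ?T" if \<rho>: "\<rho> \<in> rays A E" "\<not> Z \<rho>" for \<rho>
    proof -
      obtain F where F: "finite F" "tail_component A E F \<rho> \<inter> S = {}" using away[OF \<rho>] by blast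
      show ?thesis
        using tail_component_mem[OF \<rho>(1) F(1)]
        by (rule eventually_mono) (use tail_component_vertex_closure[OF F(2,1)] in blast)
    qed
  qed (rule nonZ)
qed

section \<open>Inclusion-minimal separators of two vertices\<close>

definition min_separator :: "'v set \<Rightarrow> 'v set set \<Rightarrow> 'v \<Rightarrow> 'v \<Rightarrow> 'v set \<Rightarrow> bool" where
  "min_separator A E x y T \<longleftrightarrow> finite T \<and> T \<subseteq> A \<and> x \<notin> T \<and> y \<notin> T \<and> (x, y) \<notin> joined (A - T) E
    \<and> (\<forall>t\<in>T. (x, y) \<in> joined (A - (T - {t})) E)"

lemma min_separator_exists:
  assumes "finite Q" "Q \<subseteq> A" "x \<notin> Q" "y \<notin> Q" "(x, y) \<notin> joined (A - Q) E"
  shows "\<exists>T\<subseteq>Q. min_separator A E x y T"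
  using assms
proof (induction "card Q" arbitrary: Q rule: less_induct)
  case less
  show ?case
  proof (cases "\<exists>t\<in>Q. (x, y) \<notin> joined (A - (Q - {t})) E")
    case True
    then obtain t where t: "t \<in> Q" "(x, y) \<notin> joined (A - (Q - {t})) E" by blast
    then have "card (Q - {t}) < card Q" using less.prems(1) by (intro psubset_card_mono) auto
    then have "\<exists>T\<subseteq>Q - {t}. min_separator A E x y T"
      by (rule less.hyps) (use t less.prems in auto)
    then show ?thesis by blast
  next
    case False
    then have "min_separator A E x y Q" using less.prems by (auto simp: min_separator_def)
    then show ?thesis by blast
  qed
qed

text \<open>If \<open>x\<close> and \<open>y\<close> are joined, every separator meets a fixed
  finite set \<open>P\<close> connecting them. Removing a common vertex \<open>p\<close> from both
  the graph and the separator leaves a smaller minimal separator, hence the induction over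
  \<open>k\<close> with \<open>A\<close> arbitrary.\<close>

lemma finite_min_separators: "finite {T. min_separator A E x y T \<and> card T \<le> k}"
proof (induction k arbitrary: A)
  case 0
  have "{T. min_separator A E x y T \<and> card T \<le> 0} \<subseteq> {{}}" by (auto simp: min_separator_def)
  then show ?case by (rule finite_subset) simp
next
  case (Suc k)
  show ?case
  proof (cases "(x, y) \<in> joined A E")
    case False
    have "T = {}" if "min_separator A E x y T" for T
    proof (rule ccontr)
      assume "T \<noteq> {}"
      then obtain t where "t \<in> T" by blast
      then have "(x, y) \<in> joined (A - (T - {t})) E" using that by (simp add: min_separator_def)
      then show False using joined_mono[of x y _ E A] False by blast
    qed
    then have "{T. min_separator A E x y T \<and> card T \<le> Suc k} \<subseteq> {{}}" by blast
    then show ?thesis by (rule finite_subset) simp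
  next
    case True
    from joined_finite[OF this] obtain P where P: "finite P" "P \<subseteq> A" "(x, y) \<in> joined P E" by blast
    have "{T. min_separator A E x y T \<and> card T \<le> Suc k}
      \<subseteq> (\<Union>p\<in>P. insert p ` {T. min_separator (A - {p}) E x y T \<and> card T \<le> k})"
    proof
      fix T assume "T \<in> {T. min_separator A E x y T \<and> card T \<le> Suc k}"
      then have T: "min_separator A E x y T" "card T \<le> Suc k" by auto
      have "\<not> P \<subseteq> A - T"
      proof
        assume "P \<subseteq> A - T"
        from joined_mono[OF P(3) this] T(1) show False by (simp add: min_separator_def)
      qed
      with P(2) obtain p where p: "p \<in> P" "p \<in> T" by blast
      have "A - {p} - (T - {p}) = A - T" using p by blast
      moreover have "A - {p} - (T - {p} - {t}) = A - (T - {t})" if "t \<in> T - {p}" for t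
        using p that by blast
      ultimately have "min_separator (A - {p}) E x y (T - {p})"
        using T(1) unfolding min_separator_def by auto
      moreover have "card (T - {p}) \<le> k" using T p(2) by (simp add: min_separator_def)
      moreover have "T = insert p (T - {p})" using p(2) by blast
      ultimately show "T \<in> (\<Union>p\<in>P. insert p ` {T. min_separator (A - {p}) E x y T \<and> card T \<le> k})"
        using p(1) by blast
    qed
    then show ?thesis by (rule finite_subset) (use P(1) Suc.IH in blast)
  qed
qed

section \<open>Partitions into good regions\<close>

text \<open>The finite boundary makes having a tail in \<open>C\<close> a property of the end and
  not of the ray, and an open one; see \<open>end_of_in_ends_in_iff\<close> and
  \<open>openin_ends_in\<close>.\<close>

definition region :: "'v set \<Rightarrow> 'v set set \<Rightarrow> 'v set \<Rightarrow> bool" where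
  "region V E C \<longleftrightarrow> C \<subseteq> V \<and> finite (nbs V E C)"

lemma region_Int:
  assumes "region V E B" "region V E C"
  shows "region V E (B \<inter> C)"
proof -
  have "nbs V E (B \<inter> C) \<subseteq> nbs V E B \<union> nbs V E C" by (auto simp: nbs_def)
  then show ?thesis using assms finite_subset by (auto simp: region_def)
qed

lemma region_component:
  assumes "region V E A" "C \<in> components_of_graph (A - T) E" "finite (nbs A E C)"
  shows "region V E C"
proof -
  have "C \<subseteq> A" using component_subset[OF assms(2)] by blast
  then have "nbs V E C \<subseteq> nbs A E C \<union> nbs V E A" by (auto simp: nbs_def)
  then show ?thesis using assms \<open>C \<subseteq> A\<close> finite_subset by (auto simp: region_def)
qed

lemma region_component_finite:
  assumes "region V E A" "C \<in> components_of_graph (A - T) E" "finite T"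
  shows "region V E C"
  using region_component[OF assms(1,2)] nbs_component[OF assms(2)] assms(3) finite_subset by blast

lemma region_whole: "region V E V"
  by (simp add: region_def nbs_def)

lemma region_tail_component:
  assumes "\<rho> \<in> rays V E" "finite F"
  shows "region V E (tail_component V E F \<rho>)"
  by (rule region_component_finite[OF region_whole tail_component_in_components[OF assms] assms(2)])

text \<open>The partition argument rests on heredity alone. The meaning of goodness is supplied by
  \<open>end_subspace\<close>.\<close>

locale good_regions =
  fixes V :: "'v set" and E :: "'v set set" and good :: "'v set \<Rightarrow> bool"
  assumes good_mono: "good C \<Longrightarrow> B \<subseteq> C \<Longrightarrow> region V E B \<Longrightarrow> good B"
begin

definition locally_good :: "(nat \<Rightarrow> 'v) \<Rightarrow> bool" where
  "locally_good \<rho> \<longleftrightarrow> (\<exists>F. finite F \<and> good (tail_component V E F \<rho>))"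

text \<open>Vertices may stay uncovered; only tails have to be caught. Hence deleting a set that all
  locally good rays leave does no harm.\<close>

definition refinable :: "'v set \<Rightarrow> bool" where
  "refinable A \<longleftrightarrow> (\<exists>\<D>. (\<forall>C\<in>\<D>. C \<subseteq> A \<and> region V E C \<and> good C) \<and> disjoint \<D> \<and>
    (\<forall>\<rho>\<in>rays A E. locally_good \<rho> \<longrightarrow> (\<exists>C\<in>\<D>. \<forall>\<^sub>F n in sequentially. \<rho> n \<in> C)))"

lemma refinable_good: "region V E C \<Longrightarrow> good C \<Longrightarrow> refinable C"
  unfolding refinable_def by (intro exI[of _ "{C}"]) (auto simp: disjoint_def ray_mem)

text \<open>The families of the components are united. As these families concern rays inside a
  component, the initial part of a ray is cut off, which does not affect local goodness.\<close>

lemma refinable_split: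
  assumes refinable: "\<And>C. C \<in> components_of_graph (A - T) E \<Longrightarrow> refinable C"
    and leave: "\<And>\<rho>. \<rho> \<in> rays A E \<Longrightarrow> locally_good \<rho> \<Longrightarrow> \<forall>\<^sub>F n in sequentially. \<rho> n \<notin> T"
  shows "refinable A"
proof -
  let ?K = "components_of_graph (A - T) E"
  have "\<forall>C\<in>?K. \<exists>\<D>. (\<forall>B\<in>\<D>. B \<subseteq> C \<and> region V E B \<and> good B) \<and> disjoint \<D> \<and>
    (\<forall>\<rho>\<in>rays C E. locally_good \<rho> \<longrightarrow> (\<exists>B\<in>\<D>. \<forall>\<^sub>F n in sequentially. \<rho> n \<in> B))"
    using refinable unfolding refinable_def by blast
  from bchoice[OF this] obtain \<D> where \<D>: "\<forall>C\<in>?K. (\<forall>B\<in>\<D> C. B \<subseteq> C \<and> region V E B \<and> good B)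
    \<and> disjoint (\<D> C) \<and> (\<forall>\<rho>\<in>rays C E. locally_good \<rho> \<longrightarrow> (\<exists>B\<in>\<D> C. \<forall>\<^sub>F n in sequentially. \<rho> n \<in> B))" ..
  then have D: "\<And>C B. C \<in> ?K \<Longrightarrow> B \<in> \<D> C \<Longrightarrow> B \<subseteq> C \<and> region V E B \<and> good B"
    and dis: "\<And>C. C \<in> ?K \<Longrightarrow> disjoint (\<D> C)"
    and hit: "\<And>C \<rho>. C \<in> ?K \<Longrightarrow> \<rho> \<in> rays C E \<Longrightarrow> locally_good \<rho> \<Longrightarrow>
      \<exists>B\<in>\<D> C. \<forall>\<^sub>F n in sequentially. \<rho> n \<in> B" by simp_all
  let ?D = "\<Union>C\<in>?K. \<D> C"
  have "B \<inter> B' = {}" if B: "B \<in> \<D> C" "C \<in> ?K" "B' \<in> \<D> C'" "C' \<in> ?K" "B \<noteq> B'" for B B' C C'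
  proof (cases "C = C'")
    case True
    then show ?thesis using dis[OF B(2)] B unfolding disjoint_def by blast
  next
    case False
    then have "C \<inter> C' = {}" by (rule component_disjoint[OF B(2,4)])
    then show ?thesis using D[OF B(2,1)] D[OF B(4,3)] by blast
  qed
  then have dis': "disjoint ?D" unfolding disjoint_def by blast
  have sub: "B \<subseteq> A \<and> region V E B \<and> good B" if "B \<in> ?D" for B
    using that D component_subset by blast
  have hit': "\<exists>B\<in>?D. \<forall>\<^sub>F n in sequentially. \<rho> n \<in> B" if \<rho>: "\<rho> \<in> rays A E" "locally_good \<rho>" for \<rho>
  proof -
    obtain C m where C: "C \<in> ?K" and m: "\<And>n. n \<ge> m \<Longrightarrow> \<rho> n \<in> C"
      using ray_tail_in_component[OF \<rho>(1) leave[OF \<rho>]] unfolding eventually_sequentially by blast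
    have "locally_good (\<lambda>n. \<rho> (n + m))" using \<rho>(2) by (simp add: locally_good_def tail_component_shift)
    from hit[OF C ray_shift[OF \<rho>(1) m] this]
    obtain B where B: "B \<in> \<D> C" "\<forall>\<^sub>F n in sequentially. \<rho> (n + m) \<in> B" by blast
    from B(2) have "\<forall>\<^sub>F n in sequentially. \<rho> n \<in> B"
      using eventually_sequentially_seg[of "\<lambda>n. \<rho> n \<in> B" m] by simp
    with B(1) C show ?thesis by blast
  qed
  show ?thesis unfolding refinable_def
    by (intro exI[of _ ?D] conjI[OF _ conjI[OF dis']] ballI impI) (erule sub, erule (1) hit')
qed

lemma refinable_mono:
  assumes "refinable A" "B \<subseteq> A" "region V E B"
  shows "refinable B"
proof -
  from assms(1) obtain \<D> where "(\<forall>C\<in>\<D>. C \<subseteq> A \<and> region V E C \<and> good C) \<and> disjoint \<D> \<and>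
    (\<forall>\<rho>\<in>rays A E. locally_good \<rho> \<longrightarrow> (\<exists>C\<in>\<D>. \<forall>\<^sub>F n in sequentially. \<rho> n \<in> C))"
    unfolding refinable_def ..
  then have D: "\<And>C. C \<in> \<D> \<Longrightarrow> C \<subseteq> A \<and> region V E C \<and> good C" "disjoint \<D>"
    and hit: "\<And>\<rho>. \<rho> \<in> rays A E \<Longrightarrow> locally_good \<rho> \<Longrightarrow> \<exists>C\<in>\<D>. \<forall>\<^sub>F n in sequentially. \<rho> n \<in> C"
    by simp_all
  let ?D = "(\<inter>) B ` \<D>"
  have dis: "disjoint ?D" using D(2) unfolding disjoint_def by blast
  have reg: "region V E (B \<inter> C) \<and> good (B \<inter> C)" if "C \<in> \<D>" for C
    using D(1)[OF that] region_Int[OF assms(3)] good_mono[of C "B \<inter> C"] by blast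
  have sub: "C \<subseteq> B \<and> region V E C \<and> good C" if "C \<in> ?D" for C using that reg by auto
  have hit': "\<exists>C\<in>?D. \<forall>\<^sub>F n in sequentially. \<rho> n \<in> C" if \<rho>: "\<rho> \<in> rays B E" "locally_good \<rho>" for \<rho>
  proof -
    obtain C where "C \<in> \<D>" "\<forall>\<^sub>F n in sequentially. \<rho> n \<in> C"
      using hit[OF rays_mono[OF \<rho>(1) assms(2)] \<rho>(2)] by blast
    then show ?thesis using ray_mem[OF \<rho>(1)] by (intro bexI[of _ "B \<inter> C"]) auto
  qed
  show ?thesis unfolding refinable_def
    by (intro exI[of _ ?D] conjI[OF _ conjI[OF dis]] ballI impI) (erule sub, erule (1) hit')
qed

text \<open>The ways in which at most \<open>k\<close> vertices split a non-refinable piece off from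
  \<open>r\<close>. By \<open>finite_min_separators\<close> the bound leaves finitely many of them
  for each \<open>v\<close>.\<close>

definition bad_separators :: "'v set \<Rightarrow> 'v \<Rightarrow> nat \<Rightarrow> 'v set set" where
  "bad_separators D r k =
    {T. \<exists>v. min_separator D E r v T \<and> card T \<le> k \<and> \<not> refinable (joined (D - T) E `` {v})}"

text \<open>A bad separator \<open>T\<close> meeting a good component \<open>C\<close> of \<open>G - F\<close> cuts off a non-refinable set, which cannot lie
  in \<open>C\<close> and therefore meets \<open>F\<close>. So \<open>T\<close> separates \<open>r\<close> from one of the finitely many vertices of \<open>F\<close>.\<close>

lemma bad_separators_dispersed:
  assumes D: "region V E D" and r: "r \<in> D" and \<rho>: "\<rho> \<in> rays D E" "locally_good \<rho>"
  shows "\<exists>F. finite F \<and> tail_component D E F \<rho> \<inter> insert r (\<Union>(bad_separators D r k)) = {}"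
proof -
  have DV: "D \<subseteq> V" using D by (simp add: region_def)
  have \<rho>V: "\<rho> \<in> rays V E" by (rule rays_mono[OF \<rho>(1) DV])
  obtain F0 where F0: "finite F0" "good (tail_component V E F0 \<rho>)" using \<rho>(2) by (auto simp: locally_good_def)
  \<comment> \<open>With \<open>r\<close> in \<open>F\<close>, the component \<open>?C\<close> does
    not contain \<open>r\<close>, and only the separators remain to be dealt with.\<close>
  define F where "F = insert r F0"
  have F: "finite F" "r \<in> F" using F0(1) by (auto simp: F_def)
  let ?C = "tail_component V E F \<rho>"
  have "?C \<subseteq> tail_component V E F0 \<rho>" by (rule tail_component_mono) (auto simp: F_def)
  then have goodC: "good ?C" using good_mono[OF F0(2)] region_tail_component[OF \<rho>V F(1)] by blast
  define \<T> where "\<T> = {T \<in> bad_separators D r k. T \<inter> ?C \<noteq> {}}"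
  have "\<exists>v\<in>F. min_separator D E r v T" if "T \<in> \<T>" for T
  proof -
    obtain v t where v: "min_separator D E r v T" "\<not> refinable (joined (D - T) E `` {v})"
      and t: "t \<in> T" "t \<in> ?C" using \<open>T \<in> \<T>\<close> by (auto simp: \<T>_def bad_separators_def)
    let ?K = "joined (D - T) E `` {v}"
    have v': "finite T" "r \<notin> T" "v \<notin> T" "(r, v) \<notin> joined (D - T) E"
      and minT: "\<And>t. t \<in> T \<Longrightarrow> (r, v) \<in> joined (D - (T - {t})) E" using v(1) by (auto simp: min_separator_def)
    have vD: "v \<in> D - T" using joined_mem[OF minT[OF t(1)]] v'(3) by blast
    have K: "?K \<in> components_of_graph (D - T) E" by (rule component_of[OF vD])
    have KD: "?K \<subseteq> D" using component_subset[OF K] by blast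
    have "?K \<inter> F \<noteq> {}"
    proof
      assume KF: "?K \<inter> F = {}"
      have "t \<notin> F" using t(2) tail_component_subset[of V E F \<rho>] by blast
      moreover have "t \<in> V" using t(2) tail_component_subset[of V E F \<rho>] by blast
      ultimately have sub: "insert t ?K \<subseteq> V - F" using KF KD DV by blast
      have eq: "D - (T - {t}) - {t} = D - T" using t(1) by blast
      \<comment> \<open>By minimality \<open>t\<close> is attached to \<open>?K\<close>. As
        \<open>?K\<close> avoids \<open>F\<close>, this puts \<open>?K\<close> into
        \<open>?C\<close>, the component of \<open>t\<close>.\<close>
      have "(v, t) \<in> joined (insert t (joined (D - (T - {t}) - {t}) E `` {v})) E"
      proof (rule joined_through[of v r])
        show "(v, r) \<in> joined (D - (T - {t})) E" by (rule joined_sym[OF minT[OF t(1)]])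
        show "(v, r) \<notin> joined (D - (T - {t}) - {t}) E" unfolding eq using v'(4) joined_sym[of v r] by blast
        show "v \<noteq> t" using v'(3) t(1) by blast
      qed
      then have "(v, t) \<in> joined (V - F) E" unfolding eq by (rule joined_mono[OF _ sub])
      then have vC: "v \<in> ?C" using tail_component_closed[OF t(2)] joined_sym[of v t] by blast
      have "x \<in> ?C" if "x \<in> ?K" for x
      proof (rule tail_component_closed[OF vC])
        have "(v, x) \<in> joined ?K E" using that joined_component by simp
        then show "(v, x) \<in> joined (V - F) E" by (rule joined_mono) (use sub in blast)
      qed
      then have "?K \<subseteq> ?C" by blast
      moreover have "region V E ?K" by (rule region_component_finite[OF D K v'(1)])
      ultimately have "refinable ?K" using refinable_good good_mono[OF goodC] by blast
      with v(2) show False ..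
    qed
    \<comment> \<open>\<open>v1\<close> lies in the same component of \<open>D - T\<close> as
      \<open>v\<close>, so \<open>T\<close> is a minimal separator of \<open>r\<close> and
      \<open>v1\<close> as well.\<close>
    then obtain v1 where v1: "v1 \<in> F" "(v, v1) \<in> joined (D - T) E" by blast
    have "(r, v1) \<notin> joined (D - T) E"
      using v'(4) joined_trans[of r v1 "D - T" E v] joined_sym[OF v1(2)] by blast
    moreover have "(r, v1) \<in> joined (D - (T - {t})) E" if "t \<in> T" for t
      using joined_trans[OF minT[OF that] joined_mono[OF v1(2)]] by blast
    moreover have "v1 \<notin> T" using joined_mem[OF v1(2)] by blast
    ultimately have "min_separator D E r v1 T" using v(1) by (auto simp: min_separator_def)
    with v1(1) show ?thesis by blast
  qed
  then have "\<T> \<subseteq> (\<Union>v\<in>F. {T. min_separator D E r v T \<and> card T \<le> k})"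
    by (auto simp: \<T>_def bad_separators_def)
  then have "finite \<T>" by (rule finite_subset) (intro finite_UN_I F(1) finite_min_separators)
  moreover have "finite T" if "T \<in> \<T>" for T
    using that by (auto simp: \<T>_def bad_separators_def min_separator_def)
  ultimately have fin: "finite (F \<union> \<Union>\<T>)" using F(1) by blast
  have "tail_component D E (F \<union> \<Union>\<T>) \<rho> \<inter> insert r (\<Union>(bad_separators D r k)) = {}"
  proof (rule ccontr)
    assume "\<not> ?thesis"
    then obtain s where s: "s \<in> tail_component D E (F \<union> \<Union>\<T>) \<rho>"
      "s \<in> insert r (\<Union>(bad_separators D r k))" by blast
    have "s \<in> ?C" using tail_component_mono[OF DV, of F "F \<union> \<Union>\<T>" E \<rho>] s(1) by blast
    then have "s \<in> F \<union> \<Union>\<T>" using s(2) F(2) by (auto simp: \<T>_def)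
    then show False using s(1) tail_component_subset[of D E "F \<union> \<Union>\<T>" \<rho>] by blast
  qed
  with fin show ?thesis by blast
qed

text \<open>Let \<open>F\<close> cut out a good tail component of the ray through the roots. Far
  along the sequence, only the part \<open>X\<close> of \<open>F\<close> lying in all
  \<open>D m\<close> matters. A non-refinable component of \<open>D n - X\<close> must be separated
  from \<open>r n\<close> by a bad separator inside \<open>X\<close>. But step \<open>n\<close>
  deleted all bad separators of size at most \<open>n\<close>, while \<open>X\<close> survives every
  step.\<close>

lemma refinable_if_all_locally_good:
  assumes A: "region V E A" and locally_good: "\<And>\<rho>. \<rho> \<in> rays A E \<Longrightarrow> locally_good \<rho>"
  shows "refinable A"
proof (rule ccontr)
  assume nonref: "\<not> refinable A"
  define B where "B D \<longleftrightarrow> D \<subseteq> A \<and> region V E D \<and> conn D E \<and> \<not> refinable D" for D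
  define S where "S D r k = insert r (\<Union>(bad_separators D r k))" for D r k
  define P where "P s \<longleftrightarrow> B (fst s) \<and> snd s \<in> fst s" for s
  define Q where "Q n s t \<longleftrightarrow> fst t \<subseteq> fst s \<and> fst t \<inter> S (fst s) (snd s) n = {}
    \<and> (snd s, snd t) \<in> joined (insert (snd t) (fst s - fst t)) E" for n s t
  have step: "\<exists>t. P t \<and> Q n s t" if s: "P s" for s n
  proof -
    define D r where "D = fst s" and "r = snd s"
    have D: "D \<subseteq> A" "region V E D" "conn D E" "\<not> refinable D" and r: "r \<in> D"
      using s by (auto simp: P_def B_def D_def r_def)
    \<comment> \<open>Deleting the closure instead of \<open>S D r n\<close> itself gives the next
      piece a finite neighbourhood. Every ray of \<open>D\<close> leaves \<open>T\<close>, so some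
      component stays non-refinable.\<close>
    define T where "T = vertex_closure D E (S D r n)"
    have SD: "S D r n \<subseteq> D"
      using r by (auto simp: S_def bad_separators_def min_separator_def)
    then have ST: "S D r n \<subseteq> T" unfolding T_def by (rule subset_vertex_closure)
    have away: "\<exists>F. finite F \<and> tail_component D E F \<rho> \<inter> S D r n = {}" if "\<rho> \<in> rays D E" for \<rho>
      unfolding S_def by (rule bad_separators_dispersed[OF D(2) r that locally_good[OF rays_mono[OF that D(1)]]])
    have "\<exists>C \<in> components_of_graph (D - T) E. \<not> refinable C"
    proof (rule ccontr)
      assume "\<not> ?thesis"
      then have "refinable D"
      proof (intro refinable_split[of D T])
        fix \<rho> assume \<rho>: "\<rho> \<in> rays D E"
        obtain F where F: "finite F" "tail_component D E F \<rho> \<inter> S D r n = {}" using away[OF \<rho>] by blast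
        show "\<forall>\<^sub>F n in sequentially. \<rho> n \<notin> T"
          using tail_component_mem[OF \<rho> F(1)]
          by (rule eventually_mono) (use tail_component_vertex_closure[OF F(2,1)] in \<open>auto simp: T_def\<close>)
      qed blast
      with D(4) show False ..
    qed
    then obtain C where C: "C \<in> components_of_graph (D - T) E" "\<not> refinable C" by blast
    have "finite (nbs D E C)"
    proof (rule finite_nbs_vertex_closure[OF _ C(1)[unfolded T_def]])
      fix \<rho> assume "\<rho> \<in> rays (D - vertex_closure D E (S D r n)) E"
      then have "\<rho> \<in> rays D E" by (rule rays_mono) blast
      then show "\<exists>F. finite F \<and> tail_component D E F \<rho> \<inter> S D r n = {}" by (rule away)
    qed
    then have regC: "region V E C" by (rule region_component[OF D(2) C(1)])
    have CD: "C \<subseteq> D - T" by (rule component_subset[OF C(1)])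
    obtain y where y: "y \<in> C" using component_nonempty[OF C(1)] by blast
    have "r \<notin> C" using CD ST by (auto simp: S_def)
    moreover have "(r, y) \<in> joined D E" using conn_joined[OF D(3) order_refl r] y CD by blast
    ultimately obtain r' where r': "r' \<in> C" "(r, r') \<in> joined (insert r' (D - C)) E"
      using joined_enter[of r y D E C] y by blast
    have "P (C, r')" using C(2) regC component_conn[OF C(1)] CD D(1) r'(1) by (auto simp: P_def B_def)
    moreover have "Q n s (C, r')" using CD ST r'(2) by (auto simp: Q_def D_def[symmetric] r_def[symmetric])
    ultimately show ?thesis by blast
  qed
  have "\<exists>C \<in> components_of_graph (A - {}) E. \<not> refinable C" using refinable_split[of A "{}"] nonref by auto
  then obtain C0 where C0: "C0 \<in> components_of_graph (A - {}) E" "\<not> refinable C0" by blast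
  obtain c0 where "c0 \<in> C0" using component_nonempty[OF C0(1)] by blast
  then have "P (C0, c0)"
    using component_subset[OF C0(1)] region_component_finite[OF A C0(1)] component_conn[OF C0(1)] C0(2)
    by (auto simp: P_def B_def)
  then obtain st where st: "\<And>n. P (st n)" "\<And>n. Q n (st n) (st (Suc n))"
    using dependent_nat_choice[of "\<lambda>_. P" Q] step by blast
  define D r where "D n = fst (st n)" and "r n = snd (st n)" for n
  have D: "D n \<subseteq> A" "region V E (D n)" "conn (D n) E" "\<not> refinable (D n)" and r: "r n \<in> D n" for n
    using st(1)[of n] by (auto simp: P_def B_def D_def r_def)
  have dec: "D (Suc n) \<subseteq> D n" and DS: "D (Suc n) \<inter> S (D n) (r n) n = {}"
    and link: "(r n, r (Suc n)) \<in> joined (insert (r (Suc n)) (D n - D (Suc n))) E" for n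
    using st(2)[of n] by (auto simp: Q_def D_def r_def)
  have rn: "r n \<in> D n - D (Suc n)" for n using r[of n] DS[of n] by (auto simp: S_def)
  obtain \<rho> where \<rho>D: "\<rho> \<in> rays (D 0) E"
    and \<rho>r: "\<And>n. \<forall>\<^sub>F j in sequentially. (r n, \<rho> j) \<in> joined (D n - (\<Inter>m. D m)) E"
    using nested_ray[of D r E, OF dec rn link] by blast
  have \<rho>A: "\<rho> \<in> rays A E" by (rule rays_mono[OF \<rho>D D(1)])
  obtain F where F: "finite F" "good (tail_component V E F \<rho>)" using locally_good[OF \<rho>A] by (auto simp: locally_good_def)
  define X where "X = F \<inter> (\<Inter>m. D m)"
  have "\<forall>f\<in>F - X. \<exists>n. f \<notin> D n" by (auto simp: X_def)
  then obtain g where g: "\<And>f. f \<in> F - X \<Longrightarrow> f \<notin> D (g f)" by metis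
  \<comment> \<open>Late enough that \<open>D n\<close> contains no vertex of \<open>F\<close>
    outside \<open>X\<close>, and large enough for subsets of \<open>X\<close> to obey the size
    bound of step \<open>n\<close>.\<close>
  define n where "n = Max (insert (card X) (g ` F))"
  have gn: "g f \<le> n" if "f \<in> F" for f using that F(1) by (simp add: n_def)
  have card_n: "card X \<le> n" using F(1) by (simp add: n_def)
  have FX: "F \<inter> D n = X"
  proof
    show "F \<inter> D n \<subseteq> X"
    proof
      fix f assume f: "f \<in> F \<inter> D n"
      have "D n \<subseteq> D (g f)" using lift_Suc_antimono_le[of D, OF dec gn] f by blast
      then show "f \<in> X" using g[of f] f by blast
    qed
  qed (auto simp: X_def)
  have XD: "X \<subseteq> D m" for m by (auto simp: X_def)
  have finX: "finite X" using F(1) by (simp add: X_def)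
  let ?C = "tail_component V E F \<rho>"
  have AV: "A \<subseteq> V" using A by (simp add: region_def)
  \<comment> \<open>The paths from \<open>r n\<close> to the ray avoid
    \<open>\<Inter>m. D m\<close>, hence \<open>X\<close>; as they run in \<open>D n\<close>, they
    miss the rest of \<open>F\<close> too.\<close>
  have rC: "r n \<in> ?C"
  proof -
    have sub: "D n - (\<Inter>m. D m) \<subseteq> V - F" using D(1)[of n] AV FX by (auto simp: X_def)
    show ?thesis unfolding tail_component_def mem_Collect_eq
      using \<rho>r[of n] by (rule eventually_mono) (use joined_mono[OF _ sub] joined_sym in metis)
  qed
  have "\<exists>C' \<in> components_of_graph (D n - X) E. \<not> refinable C'"
  proof (rule ccontr)
    assume "\<not> ?thesis"
    then have "refinable (D n)" by (intro refinable_split[of "D n" X] ray_leaves_finite[OF _ finX]) blast+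
    with D(4) show False by blast
  qed
  then obtain C' where C': "C' \<in> components_of_graph (D n - X) E" "\<not> refinable C'" by blast
  have regC': "region V E C'" by (rule region_component_finite[OF D(2) C'(1) finX])
  have C'D: "C' \<subseteq> D n - X" by (rule component_subset[OF C'(1)])
  \<comment> \<open>Otherwise \<open>C'\<close> would lie in the good component \<open>?C\<close>,
    and good regions are refinable.\<close>
  have "r n \<notin> C'"
  proof
    assume rC': "r n \<in> C'"
    have sub: "D n - X \<subseteq> V - F" using D(1)[of n] AV FX by blast
    have "y \<in> ?C" if "y \<in> C'" for y
      using tail_component_closed[OF rC joined_mono[OF component_joined[OF C'(1) rC' that] sub]] .
    then have "C' \<subseteq> ?C" by blast
    then have "refinable C'" using refinable_good[OF regC' good_mono[OF F(2) _ regC']] by blast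
    with C'(2) show False ..
  qed
  obtain v where v: "v \<in> C'" using component_nonempty[OF C'(1)] by blast
  have nj: "(r n, v) \<notin> joined (D n - X) E"
    using component_closed[OF C'(1) v] joined_sym[of "r n" v] \<open>r n \<notin> C'\<close> by blast
  have "r n \<notin> X" using rn[of n] XD[of "Suc n"] by blast
  moreover have "v \<notin> X" using v C'D by blast
  ultimately obtain T where T: "T \<subseteq> X" "min_separator (D n) E (r n) v T"
    using min_separator_exists[OF finX XD _ _ nj] by blast
  have "C' \<subseteq> joined (D n - T) E `` {v}"
  proof
    fix y assume "y \<in> C'"
    then have "(v, y) \<in> joined (D n - X) E" using component_joined[OF C'(1) v] by blast
    then have "(v, y) \<in> joined (D n - T) E" by (rule joined_mono) (use T(1) in blast)
    then show "y \<in> joined (D n - T) E `` {v}" by simp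
  qed
  then have "\<not> refinable (joined (D n - T) E `` {v})" using refinable_mono[OF _ _ regC'] C'(2) by blast
  moreover have "card T \<le> n" using card_mono[OF finX T(1)] card_n by simp
  ultimately have "T \<in> bad_separators (D n) (r n) n" using T(2) unfolding bad_separators_def by blast
  then have "T \<subseteq> S (D n) (r n) n" unfolding S_def by blast
  moreover have "T \<subseteq> D (Suc n)" using T(1) XD by blast
  \<comment> \<open>\<open>T\<close> was deleted at step \<open>n\<close> but lies in every
    \<open>D m\<close>. So it is empty, and the empty set separates nothing in the connected set
    \<open>D n\<close>.\<close>
  ultimately have "T = {}" using DS[of n] by blast
  moreover have "(r n, v) \<in> joined (D n) E" using conn_joined[OF D(3) order_refl r] v C'D by blast
  ultimately show False using T(2) by (simp add: min_separator_def)
qed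

text \<open>Local goodness is open, so the rays without it have an envelope. Locally good rays leave
  the envelope, and the components outside it contain only locally good rays.\<close>

lemma refinable_region:
  assumes A: "region V E A"
  shows "refinable A"
proof -
  have AV: "A \<subseteq> V" using A by (simp add: region_def)
  have opn: "\<exists>F. finite F \<and> (\<forall>\<sigma>\<in>rays A E.
      (\<forall>\<^sub>F n in sequentially. \<sigma> n \<in> tail_component A E F \<rho>) \<longrightarrow> \<not> \<not> locally_good \<sigma>)"
    if \<rho>: "\<rho> \<in> rays A E" "\<not> \<not> locally_good \<rho>" for \<rho>
  proof -
    obtain F where F: "finite F" "good (tail_component V E F \<rho>)" using \<rho>(2) by (auto simp: locally_good_def)
    have "locally_good \<sigma>" if \<sigma>: "\<sigma> \<in> rays A E" "\<forall>\<^sub>F n in sequentially. \<sigma> n \<in> tail_component A E F \<rho>" for \<sigma>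
    proof -
      have "\<forall>\<^sub>F n in sequentially. \<sigma> n \<in> tail_component V E F \<rho>"
        using \<sigma>(2) by (rule eventually_mono) (use tail_component_mono[OF AV order_refl, of E F \<rho>] in blast)
      then have "\<exists>\<^sub>F n in sequentially. \<sigma> n \<in> tail_component V E F \<rho>"
        by (rule eventually_frequently[OF sequentially_bot])
      then have "tail_component V E F \<sigma> = tail_component V E F \<rho>"
        by (rule tail_component_eqI[OF rays_mono[OF \<sigma>(1) AV] F(1)
            tail_component_in_components[OF rays_mono[OF \<rho>(1) AV] F(1)]])
      then show ?thesis using F by (auto simp: locally_good_def)
    qed
    with F(1) show ?thesis by blast
  qed
  obtain T where T: "T \<subseteq> A" "\<And>C. C \<in> components_of_graph (A - T) E \<Longrightarrow> finite (nbs A E C)"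
    and leave: "\<And>\<rho>. \<rho> \<in> rays A E \<Longrightarrow> \<not> \<not> locally_good \<rho> \<Longrightarrow> \<forall>\<^sub>F n in sequentially. \<rho> n \<notin> T"
    and inside: "\<And>\<rho>. \<rho> \<in> rays (A - T) E \<Longrightarrow> \<not> \<not> locally_good \<rho>"
    using envelope[of A E "\<lambda>\<rho>. \<not> locally_good \<rho>", OF opn] by blast
  show ?thesis
  proof (rule refinable_split)
    fix C assume C: "C \<in> components_of_graph (A - T) E"
    show "refinable C"
    proof (rule refinable_if_all_locally_good)
      show "region V E C" by (rule region_component[OF A C T(2)[OF C]])
      show "locally_good \<rho>" if "\<rho> \<in> rays C E" for \<rho>
        using inside[OF rays_mono[OF that component_subset[OF C]]] by simp
    qed
  qed (use leave in blast)
qed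

end

section \<open>Attaching graphs to vertices\<close>

text \<open>The map is given on rays, so that it can be used without choosing representatives of
  ends. \<open>fwd\<close> is continuity. \<open>bwd\<close> gives openness, and also injectivity,
  since equal images force equal tail components for every finite \<open>F\<close>.\<close>

lemma homeomorphic_end_topologyI:
  fixes h :: "(nat \<Rightarrow> 'w) \<Rightarrow> 'a"
  assumes h: "\<And>\<rho>. \<rho> \<in> rays W D \<Longrightarrow> h \<rho> \<in> topspace S"
    and surj: "\<And>y. y \<in> topspace S \<Longrightarrow> \<exists>\<rho>\<in>rays W D. h \<rho> = y"
    and eq: "\<And>\<rho> \<sigma>. \<rho> \<in> rays W D \<Longrightarrow> \<sigma> \<in> rays W D \<Longrightarrow> end_of W D \<rho> = end_of W D \<sigma> \<Longrightarrow> h \<rho> = h \<sigma>"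
    and fwd: "\<And>U \<rho>. openin S U \<Longrightarrow> \<rho> \<in> rays W D \<Longrightarrow> h \<rho> \<in> U \<Longrightarrow> \<exists>F. finite F \<and>
      (\<forall>\<sigma>\<in>rays W D. tail_component W D F \<sigma> = tail_component W D F \<rho> \<longrightarrow> h \<sigma> \<in> U)"
    and bwd: "\<And>F \<rho>. finite F \<Longrightarrow> \<rho> \<in> rays W D \<Longrightarrow> \<exists>U. openin S U \<and> h \<rho> \<in> U \<and>
      (\<forall>\<sigma>\<in>rays W D. h \<sigma> \<in> U \<longrightarrow> tail_component W D F \<sigma> = tail_component W D F \<rho>)"
  shows "S homeomorphic_space end_topology W D"
proof -
  define k where "k \<epsilon> = h (SOME \<rho>. \<rho> \<in> rays W D \<and> \<epsilon> = end_of W D \<rho>)" for \<epsilon>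
  have k: "k (end_of W D \<rho>) = h \<rho>" if "\<rho> \<in> rays W D" for \<rho>
  proof -
    have "\<exists>\<sigma>. \<sigma> \<in> rays W D \<and> end_of W D \<rho> = end_of W D \<sigma>" using that by blast
    from someI_ex[OF this] show ?thesis unfolding k_def
      by (elim conjE) (rule eq[OF that, symmetric])
  qed
  have cont: "continuous_map (end_topology W D) S k"
    unfolding continuous_map_def topspace_end_topology
  proof (intro conjI allI impI)
    show "k \<in> graph_ends W D \<rightarrow> topspace S" using k h by (auto elim!: graph_endsE)
    fix U assume U: "openin S U"
    show "openin (end_topology W D) {\<epsilon> \<in> graph_ends W D. k \<epsilon> \<in> U}"
      unfolding openin_end_topology_iff
    proof (intro conjI ballI impI)
      fix \<rho> assume \<rho>: "\<rho> \<in> rays W D" "end_of W D \<rho> \<in> {\<epsilon> \<in> graph_ends W D. k \<epsilon> \<in> U}"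
      then obtain F where "finite F"
        "\<And>\<sigma>. \<sigma> \<in> rays W D \<Longrightarrow> tail_component W D F \<sigma> = tail_component W D F \<rho> \<Longrightarrow> h \<sigma> \<in> U"
        using fwd[OF U \<rho>(1)] k by auto
      then show "\<exists>F. finite F \<and> (\<forall>\<sigma>\<in>rays W D. tail_component W D F \<sigma> = tail_component W D F \<rho> \<longrightarrow>
          end_of W D \<sigma> \<in> {\<epsilon> \<in> graph_ends W D. k \<epsilon> \<in> U})"
        by (intro exI[of _ F]) (auto simp: k intro: end_of_in_graph_ends)
    qed blast
  qed
  have "inj_on k (graph_ends W D)"
  proof (rule inj_onI)
    fix \<epsilon> \<eta> assume "\<epsilon> \<in> graph_ends W D" "\<eta> \<in> graph_ends W D" "k \<epsilon> = k \<eta>"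
    then obtain \<rho> \<sigma> where \<rho>: "\<rho> \<in> rays W D" "\<epsilon> = end_of W D \<rho>" and \<sigma>: "\<sigma> \<in> rays W D" "\<eta> = end_of W D \<sigma>"
      and eq': "h \<rho> = h \<sigma>" using k by (metis graph_endsE)
    have "tail_component W D F \<sigma> = tail_component W D F \<rho>" if "finite F" for F
      using bwd[OF that \<rho>(1)] \<sigma>(1) eq' by auto
    then show "\<epsilon> = \<eta>" using end_of_eq_iff[OF \<rho>(1) \<sigma>(1)] \<rho>(2) \<sigma>(2) by simp
  qed
  moreover have "k ` graph_ends W D = topspace S"
  proof
    show "k ` graph_ends W D \<subseteq> topspace S" using k h by (auto elim!: graph_endsE)
    show "topspace S \<subseteq> k ` graph_ends W D" using surj k end_of_in_graph_ends by (metis image_eqI subsetI)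
  qed
  moreover have "open_map (end_topology W D) S k"
    unfolding open_map_def
  proof (intro allI impI)
    fix O' assume O: "openin (end_topology W D) O'"
    show "openin S (k ` O')"
    proof (subst openin_subopen, intro ballI)
      fix y assume "y \<in> k ` O'"
      then obtain \<epsilon> where \<epsilon>: "\<epsilon> \<in> O'" "y = k \<epsilon>" by blast
      then have "\<epsilon> \<in> graph_ends W D" using openin_subset[OF O] by (auto simp: topspace_end_topology)
      then obtain \<rho> where \<rho>: "\<rho> \<in> rays W D" "\<epsilon> = end_of W D \<rho>" by (rule graph_endsE)
      have "\<exists>F. finite F \<and> (\<forall>\<sigma>\<in>rays W D.
          tail_component W D F \<sigma> = tail_component W D F \<rho> \<longrightarrow> end_of W D \<sigma> \<in> O')"
        using O[unfolded openin_end_topology_iff] \<rho>(1) \<epsilon>(1)[unfolded \<rho>(2)] by simp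
      then obtain F where F: "finite F" "\<And>\<sigma>. \<sigma> \<in> rays W D \<Longrightarrow>
          tail_component W D F \<sigma> = tail_component W D F \<rho> \<Longrightarrow> end_of W D \<sigma> \<in> O'" by auto
      obtain U where U: "openin S U" "h \<rho> \<in> U"
        "\<And>\<sigma>. \<sigma> \<in> rays W D \<Longrightarrow> h \<sigma> \<in> U \<Longrightarrow> tail_component W D F \<sigma> = tail_component W D F \<rho>"
        using bwd[OF F(1) \<rho>(1)] by blast
      have "U \<subseteq> k ` O'"
      proof
        fix z assume z: "z \<in> U"
        then have "z \<in> topspace S" using openin_subset[OF U(1)] by blast
        then obtain \<sigma> where \<sigma>: "\<sigma> \<in> rays W D" "h \<sigma> = z" using surj by blast
        then have "end_of W D \<sigma> \<in> O'" using F(2) U(3) z by blast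
        then show "z \<in> k ` O'" using k[OF \<sigma>(1)] \<sigma>(2) by (intro image_eqI) auto
      qed
      moreover have "y \<in> U" using U(2) k[OF \<rho>(1)] \<rho>(2) \<epsilon>(2) by simp
      ultimately show "\<exists>T. openin S T \<and> y \<in> T \<and> T \<subseteq> k ` O'" using U(1) by blast
    qed
  qed
  ultimately have "homeomorphic_map (end_topology W D) S k"
    using cont by (intro bijective_open_imp_homeomorphic_map) (simp_all add: topspace_end_topology)
  then show ?thesis
    using homeomorphic_space homeomorphic_space_sym by blast
qed

text \<open>The vertices \<open>i \<in> I\<close> of a graph \<open>(P, K)\<close> are joined completely to disjoint graphs \<open>(W i, D i)\<close>. As
  \<open>i\<close> is then a cut vertex, the ends of the new graph are those of \<open>(P, K)\<close> and those of the \<open>(W i, D i)\<close>.\<close>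

locale attached_graphs =
  fixes P :: "'k set" and K :: "'k set set" and I :: "'k set"
    and W :: "'k \<Rightarrow> 'w set" and D :: "'k \<Rightarrow> 'w set set"
  assumes K: "simple_graph P K" and IP: "I \<subseteq> P" and D: "\<And>i. i \<in> I \<Longrightarrow> simple_graph (W i) (D i)"
begin

definition verts :: "('k + 'k \<times> 'w) set" where
  "verts = Inl ` P \<union> Inr ` (SIGMA i:I. W i)"

definition edges :: "('k + 'k \<times> 'w) set set" where
  "edges = {{Inl p, Inl q} | p q. {p, q} \<in> K} \<union>
    {{Inr (i, v), Inr (i, w)} | i v w. i \<in> I \<and> {v, w} \<in> D i} \<union>
    {{Inl i, Inr (i, w)} | i w. i \<in> I \<and> w \<in> W i}"

lemma verts_iff [simp]: "Inl p \<in> verts \<longleftrightarrow> p \<in> P" "Inr (i, w) \<in> verts \<longleftrightarrow> i \<in> I \<and> w \<in> W i"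
  by (auto simp: verts_def)

lemma edges_iff [simp]:
  "{Inl p, Inl q} \<in> edges \<longleftrightarrow> {p, q} \<in> K"
  "{Inr (i, v), Inr (j, w)} \<in> edges \<longleftrightarrow> i = j \<and> i \<in> I \<and> {v, w} \<in> D i"
  "{Inl p, Inr (i, w)} \<in> edges \<longleftrightarrow> p = i \<and> i \<in> I \<and> w \<in> W i"
  "{Inr (i, w), Inl p} \<in> edges \<longleftrightarrow> p = i \<and> i \<in> I \<and> w \<in> W i"
  by (auto simp: edges_def doubleton_eq_iff insert_commute)

lemma simple_graph_edges: "simple_graph verts edges"
  unfolding simple_graph_def
proof
  have KP: "p \<in> P \<and> q \<in> P \<and> p \<noteq> q" if "{p, q} \<in> K" for p q
    using K that by (fastforce simp: simple_graph_def)
  have DW: "v \<in> W i \<and> w \<in> W i \<and> v \<noteq> w" if "i \<in> I" "{v, w} \<in> D i" for i v w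
    using D[OF that(1)] that(2) by (fastforce simp: simple_graph_def)
  fix e assume "e \<in> edges"
  then show "e \<subseteq> verts \<and> card e = 2" unfolding edges_def using KP DW IP by auto
qed

lemma ray_Inl: "\<rho> \<in> rays P K \<Longrightarrow> (\<lambda>n. Inl (\<rho> n)) \<in> rays verts edges"
  by (auto simp: rays_def inj_def)

lemma ray_Inr: "i \<in> I \<Longrightarrow> \<rho> \<in> rays (W i) (D i) \<Longrightarrow> (\<lambda>n. Inr (i, \<rho> n)) \<in> rays verts edges"
  by (auto simp: rays_def inj_def)

lemma ray_stays:
  assumes r: "r \<in> rays verts edges" and n: "r n = Inr (i, w)" "\<And>m. m \<ge> n \<Longrightarrow> r m \<noteq> Inl i" and "m \<ge> n"
  shows "\<exists>v. r m = Inr (i, v)"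
  using assms(4)
proof (induction m rule: dec_induct)
  case base
  then show ?case using n by blast
next
  case (step m)
  then obtain v where "r m = Inr (i, v)" by blast
  moreover have "{r m, r (Suc m)} \<in> edges" using r by (simp add: rays_def)
  moreover have "r (Suc m) \<noteq> Inl i" using n(2) step.hyps by simp
  ultimately show ?case by (cases "r (Suc m)") auto
qed

lemma ray_enters:
  assumes r: "r \<in> rays verts edges" and "r m = Inl p" "m < n" "r n = Inr (i, w)"
  shows "\<exists>l<n. r l = Inl i"
  using assms(3,4)
proof (induction n arbitrary: w)
  case (Suc n)
  have e: "{r n, r (Suc n)} \<in> edges" using r by (simp add: rays_def)
  show ?case
  proof (cases "r n")
    case (Inl q)
    then show ?thesis using e Suc.prems by auto
  next
    case (Inr jv)
    then obtain v where "r n = Inr (i, v)" using e Suc.prems by (cases jv) auto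
    moreover from this have "m < n" using Suc.prems(1) assms(2) by (cases "m = n") auto
    ultimately show ?thesis using Suc.IH less_SucI by blast
  qed
qed simp

text \<open>The copy of \<open>(W i, D i)\<close> can be entered and left only through
  \<open>Inl i\<close>, and a ray uses \<open>Inl i\<close> at most once.\<close>

lemma ray_cases:
  assumes r: "r \<in> rays verts edges"
  obtains (Inl) m \<rho> where "\<rho> \<in> rays P K" "\<And>n. r (n + m) = Inl (\<rho> n)"
  | (Inr) i m \<rho> where "i \<in> I" "\<rho> \<in> rays (W i) (D i)" "\<And>n. r (n + m) = Inr (i, \<rho> n)"
proof -
  have inj: "r m = r n \<Longrightarrow> m = n" for m n using r by (auto simp: rays_def inj_def)
  have Inr': thesis if n: "r m = Inr (i, w)" "\<And>k. k \<ge> m \<Longrightarrow> r k \<noteq> Inl i" for m i w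
  proof -
    have "\<exists>v. r (k + m) = Inr (i, v)" for k using ray_stays[OF r n] by simp
    then obtain \<rho> where \<rho>: "\<And>k. r (k + m) = Inr (i, \<rho> k)" by metis
    have i: "i \<in> I" using ray_mem[OF r, of m] n(1) by simp
    have "\<rho> k \<in> W i" "{\<rho> k, \<rho> (Suc k)} \<in> D i" for k
      using ray_mem[OF r, of "k + m"] \<rho>[of k] \<rho>[of "Suc k"] r by (auto simp: rays_def dest!: spec[of _ "k + m"])
    moreover have "inj \<rho>"
    proof (rule injI)
      fix k l assume "\<rho> k = \<rho> l"
      then have "r (k + m) = r (l + m)" by (simp add: \<rho>)
      from inj[OF this] show "k = l" by simp
    qed
    ultimately have "\<rho> \<in> rays (W i) (D i)" by (auto simp: rays_def)
    with i \<rho> show thesis using Inr by blast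
  qed
  show thesis
  proof (cases "\<exists>m p. r m = Inl p")
    case True
    then obtain m p where m: "r m = Inl p" by blast
    show thesis
    proof (cases "\<exists>n>m. \<exists>i w. r n = Inr (i, w)")
      case True
      then obtain n i w where n: "n > m" "r n = Inr (i, w)" by blast
      obtain l where "l < n" "r l = Inl i" using ray_enters[OF r m n] by blast
      then have "r k \<noteq> Inl i" if "k \<ge> n" for k using inj[of l k] that by auto
      with n(2) show thesis by (rule Inr')
    next
      case False
      have "\<exists>q. r (n + m) = Inl q" for n
      proof (cases n)
        case (Suc k)
        then have "\<nexists>iw. r (n + m) = Inr iw" using False by fastforce
        then show ?thesis by (cases "r (n + m)") auto
      qed (use m in auto)
      then obtain \<rho> where \<rho>: "\<And>n. r (n + m) = Inl (\<rho> n)" by metis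
      have "\<rho> k \<in> P" "{\<rho> k, \<rho> (Suc k)} \<in> K" for k
        using ray_mem[OF r, of "k + m"] \<rho>[of k] \<rho>[of "Suc k"] r by (auto simp: rays_def dest!: spec[of _ "k + m"])
      moreover have "inj \<rho>"
      proof (rule injI)
        fix k l assume "\<rho> k = \<rho> l"
        then have "r (k + m) = r (l + m)" by (simp add: \<rho>)
        from inj[OF this] show "k = l" by simp
      qed
      ultimately have "\<rho> \<in> rays P K" by (auto simp: rays_def)
      with \<rho> show thesis using Inl by blast
    qed
  next
    case False
    then have no: "r k \<noteq> Inl q" for k q by blast
    obtain i w where "r 0 = Inr (i, w)" using no by (cases "r 0") auto
    then show thesis using Inr' no by blast
  qed
qed

text \<open>Collapse each copy onto its attachment vertex. The walk has to start in
  \<open>P\<close>: then a copy can be entered only through some \<open>Inl i\<close> outside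
  \<open>F\<close>, so the collapsed walk avoids \<open>F\<close>.\<close>

lemma joined_proj:
  assumes "(Inl p, y) \<in> joined (verts - F) edges"
  shows "(p, case_sum id fst y) \<in> joined (P - Inl -` F) K"
  using assms
proof (induction rule: joined_induct)
  case base
  then show ?case using joined_mem[OF assms] by (auto intro: joined_refl)
next
  case (step y z)
  have y: "y \<in> verts - F" "z \<in> verts - F" using joined_mem[OF step.hyps(1)] step.hyps(2) by auto
  show ?case
  proof (cases "\<exists>q q'. y = Inl q \<and> z = Inl q'")
    case True
    then obtain q q' where q: "y = Inl q" "z = Inl q'" by blast
    then have "(q, q') \<in> joined (P - Inl -` F) K" using y step.hyps(3) by (intro joined_edge) auto
    with step.IH q show ?thesis by (auto intro: joined_trans)
  next
    case False
    then have "case_sum id fst z = case_sum id fst y"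
      using step.hyps(3) by (cases y; cases z) (auto simp: split: prod.splits)
    with step.IH show ?thesis by simp
  qed
qed

lemma joined_Inl:
  "(p, q) \<in> joined (P - Inl -` F) K \<Longrightarrow> (Inl p, Inl q) \<in> joined (verts - F) edges"
  by (erule joined_map) auto

lemma joined_Inr:
  assumes "i \<in> I"
  shows "(v, w) \<in> joined (W i - {w. Inr (i, w) \<in> F}) (D i) \<Longrightarrow>
    (Inr (i, v), Inr (i, w)) \<in> joined (verts - F) edges"
  by (erule joined_map[where \<phi> = "\<lambda>w. Inr (i, w)"]) (use assms in auto)

text \<open>Once \<open>Inl i\<close> is deleted, no edge links copy \<open>i\<close> to the
  rest.\<close>

lemma joined_Inr_cut:
  assumes "Inl i \<in> F" "(Inr (i, v), y) \<in> joined (verts - F) edges"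
  shows "\<exists>w. y = Inr (i, w) \<and> (v, w) \<in> joined (W i - {w. Inr (i, w) \<in> F}) (D i)"
  using assms(2)
proof (induction rule: joined_induct)
  case base
  then show ?case using joined_mem[OF assms(2)] by (auto intro: joined_refl)
next
  case (step y z)
  then obtain w where w: "y = Inr (i, w)" "(v, w) \<in> joined (W i - {w. Inr (i, w) \<in> F}) (D i)" by blast
  have z: "z \<in> verts - F" by (rule step.hyps)
  then obtain u where u: "z = Inr (i, u)" "{w, u} \<in> D i"
    using step.hyps(3) w(1) assms(1) by (cases z) auto
  have "(w, u) \<in> joined (W i - {w. Inr (i, w) \<in> F}) (D i)"
    using u z joined_mem[OF w(2)] by (intro joined_edge) auto
  with w(2) u(1) show ?case by (auto intro: joined_trans)
qed

lemma tail_component_Inl_iff: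
  "Inl p \<in> tail_component verts edges F (\<lambda>n. Inl (\<rho> n)) \<longleftrightarrow> p \<in> tail_component P K (Inl -` F) \<rho>"
  unfolding tail_component_def mem_Collect_eq
  by (intro eventually_cong refl arg_cong[where f = "\<lambda>Q. eventually Q _"] ext iffI)
    (use joined_proj[of _ "Inl p" F] joined_Inl[of _ p F] in auto)

lemma tail_component_Inl_Inr:
  assumes "Inr (i, w) \<in> tail_component verts edges F (\<lambda>n. Inl (\<rho> n))"
  shows "i \<in> tail_component P K (Inl -` F) \<rho>"
  using assms unfolding tail_component_def mem_Collect_eq
  by (rule eventually_mono) (use joined_proj[of _ "Inr (i, w)" F] in auto)

lemma tail_component_Inr_iff:
  assumes "i \<in> I" "Inl i \<in> F"
  shows "Inr (i, w) \<in> tail_component verts edges F (\<lambda>n. Inr (i, \<rho> n)) \<longleftrightarrow>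
    w \<in> tail_component (W i) (D i) {w. Inr (i, w) \<in> F} \<rho>"
  unfolding tail_component_def mem_Collect_eq
  by (intro arg_cong[where f = "\<lambda>Q. eventually Q _"] ext iffI)
    (use joined_Inr_cut[OF assms(2), of _ "Inr (i, w)"] joined_Inr[OF assms(1), of _ w F] in auto)

lemma tail_component_Inr_subset:
  assumes "Inl i \<in> F" "y \<in> tail_component verts edges F (\<lambda>n. Inr (i, \<rho> n))"
  shows "\<exists>w. y = Inr (i, w)"
proof -
  obtain n where "(Inr (i, \<rho> n), y) \<in> joined (verts - F) edges"
    using assms(2) eventually_happens'[OF sequentially_bot] unfolding tail_component_def by blast
  then show ?thesis using joined_Inr_cut[OF assms(1)] by blast
qed

end

text \<open>\<open>S\<close> consists of disjoint open end spaces \<open>Y i\<close> and at most one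
  further point \<open>x\<close>. If \<open>(P, K)\<close> has no ray, this is a topological sum.
  Otherwise \<open>(P, K)\<close> has exactly one end, which stands for \<open>x\<close>; then
  \<open>nb1\<close> and \<open>nb2\<close> say that its tail components describe how the
  \<open>Y i\<close> accumulate at \<open>x\<close>.\<close>

lemma end_space_attach:
  fixes S :: "'a topology" and P :: "'k set"
  assumes K: "simple_graph P K" and IP: "I \<subseteq> P"
    and Y: "\<And>i. i \<in> I \<Longrightarrow> openin S (Y i)" "\<And>i. i \<in> I \<Longrightarrow> end_space (subtopology S (Y i))"
    and disj: "\<And>i j. i \<in> I \<Longrightarrow> j \<in> I \<Longrightarrow> i \<noteq> j \<Longrightarrow> Y i \<inter> Y j = {}"
    and top0: "rays P K = {} \<Longrightarrow> topspace S = (\<Union>i\<in>I. Y i)"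
    and top1: "rays P K \<noteq> {} \<Longrightarrow> topspace S = insert x (\<Union>i\<in>I. Y i)"
    and x: "\<And>i. rays P K \<noteq> {} \<Longrightarrow> i \<in> I \<Longrightarrow> x \<notin> Y i"
    and one: "\<And>\<rho> \<sigma> F. \<rho> \<in> rays P K \<Longrightarrow> \<sigma> \<in> rays P K \<Longrightarrow> finite F \<Longrightarrow>
      tail_component P K F \<sigma> = tail_component P K F \<rho>"
    and nb1: "\<And>\<rho> F. \<rho> \<in> rays P K \<Longrightarrow> finite F \<Longrightarrow> \<exists>U. openin S U \<and> x \<in> U \<and>
      (\<forall>i\<in>I. Y i \<inter> U \<noteq> {} \<longrightarrow> i \<in> tail_component P K F \<rho>)"
    and nb2: "\<And>\<rho> U. \<rho> \<in> rays P K \<Longrightarrow> openin S U \<Longrightarrow> x \<in> U \<Longrightarrow> \<exists>F. finite F \<and>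
      (\<forall>i\<in>I. i \<in> tail_component P K F \<rho> \<longrightarrow> Y i \<subseteq> U)"
  shows "end_space S"
proof -
  have "\<forall>i\<in>I. \<exists>W D. simple_graph (W :: (nat + 'a) set) D \<and>
      subtopology S (Y i) homeomorphic_space end_topology W D"
    using Y(2) unfolding end_space_def by blast
  then have "\<exists>W D. \<forall>i\<in>I. simple_graph (W i :: (nat + 'a) set) (D i) \<and>
      subtopology S (Y i) homeomorphic_space end_topology (W i) (D i)" by (simp only: bchoice_iff)
  then obtain W :: "'k \<Rightarrow> (nat + 'a) set" and D where WD: "\<And>i. i \<in> I \<Longrightarrow> simple_graph (W i) (D i)"
    and homeo: "\<And>i. i \<in> I \<Longrightarrow> subtopology S (Y i) homeomorphic_space end_topology (W i) (D i)" by blast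
  have "\<forall>i\<in>I. \<exists>g. homeomorphic_map (end_topology (W i) (D i)) (subtopology S (Y i)) g"
    using homeo homeomorphic_space homeomorphic_space_sym by blast
  then have "\<exists>g. \<forall>i\<in>I. homeomorphic_map (end_topology (W i) (D i)) (subtopology S (Y i)) (g i)"
    by (simp only: bchoice_iff)
  then obtain g where g: "\<And>i. i \<in> I \<Longrightarrow> homeomorphic_map (end_topology (W i) (D i)) (subtopology S (Y i)) (g i)"
    by blast
  interpret attached_graphs P K I W D
    by unfold_locales (use K IP WD in auto)
  let ?T = "tail_component verts edges"
  define F' where "F' F i = {w. Inr (i, w) \<in> F}" for F :: "('k + 'k \<times> (nat + 'a)) set" and i
  have finF: "finite (Inl -` F)" "finite (F' F i)" if "finite F" for F i
  proof -
    show "finite (Inl -` F)" using that by (intro finite_vimageI) auto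
    have "F' F i = (\<lambda>w. Inr (i, w)) -` F" by (auto simp: F'_def)
    then show "finite (F' F i)" using that by (auto intro!: finite_vimageI injI)
  qed
  have gY: "g i ` graph_ends (W i) (D i) = Y i" if "i \<in> I" for i
    using homeomorphic_imp_surjective_map[OF g[OF that]] openin_subset[OF Y(1)[OF that]]
    by (auto simp: topspace_end_topology)
  have g_in: "g i (end_of (W i) (D i) \<rho>) \<in> Y i" if "i \<in> I" "\<rho> \<in> rays (W i) (D i)" for i \<rho>
    using gY[OF that(1)] end_of_in_graph_ends[OF that(2)] by blast
  have g_inj: "end_of (W i) (D i) \<rho> = end_of (W i) (D i) \<sigma>"
    if "i \<in> I" "\<rho> \<in> rays (W i) (D i)" "\<sigma> \<in> rays (W i) (D i)"
      "g i (end_of (W i) (D i) \<rho>) = g i (end_of (W i) (D i) \<sigma>)" for i \<rho> \<sigma>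
    using inj_onD[OF homeomorphic_imp_injective_map[OF g[OF that(1)]] that(4)]
      end_of_in_graph_ends[OF that(2)] end_of_in_graph_ends[OF that(3)]
    by (simp add: topspace_end_topology)
  define A where "A r \<rho> \<longleftrightarrow> \<rho> \<in> rays P K \<and> (\<exists>m. \<forall>n. r (n + m) = Inl (\<rho> n))"
    for r :: "nat \<Rightarrow> 'k + 'k \<times> (nat + 'a)" and \<rho>
  define B where "B r i \<rho> \<longleftrightarrow> i \<in> I \<and> \<rho> \<in> rays (W i) (D i) \<and> (\<exists>m. \<forall>n. r (n + m) = Inr (i, \<rho> n))"
    for r :: "nat \<Rightarrow> 'k + 'k \<times> (nat + 'a)" and i \<rho>
  \<comment> \<open>\<open>R r y\<close> means that \<open>r\<close> represents the point
    \<open>y\<close>. It is a relation because \<open>\<rho>\<close> depends on the chosen tail of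
    \<open>r\<close>; \<open>R_uniq\<close> shows that \<open>y\<close> depends only on the end of
    \<open>r\<close>.\<close>
  define R where "R r y \<longleftrightarrow> (\<exists>\<rho>. A r \<rho> \<and> y = x) \<or> (\<exists>i \<rho>. B r i \<rho> \<and> y = g i (end_of (W i) (D i) \<rho>))"
    for r y
  have A_tail: "?T F r = ?T F (\<lambda>n. Inl (\<rho> n))" if A: "A r \<rho>" for r \<rho> F
  proof -
    obtain m where "(\<lambda>n. r (n + m)) = (\<lambda>n. Inl (\<rho> n))" using A by (auto simp: A_def fun_eq_iff)
    then show ?thesis using tail_component_shift[of verts edges F r m] by simp
  qed
  have B_tail: "?T F r = ?T F (\<lambda>n. Inr (i, \<rho> n))" if B: "B r i \<rho>" for r i \<rho> F
  proof -
    obtain m where "(\<lambda>n. r (n + m)) = (\<lambda>n. Inr (i, \<rho> n))" using B by (auto simp: B_def fun_eq_iff)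
    then show ?thesis using tail_component_shift[of verts edges F r m] by simp
  qed
  have T_ne: "\<exists>n. r n \<in> ?T F r" if "r \<in> rays verts edges" "finite F" for r F
    using tail_component_mem[OF that] eventually_happens'[OF sequentially_bot] by blast
  have eqI: "?T F r = ?T F s" if "r \<in> rays verts edges" "s \<in> rays verts edges" "finite F"
    "\<forall>\<^sub>F n in sequentially. r n \<in> ?T F s" for r s F
    by (rule tail_component_eqI[OF that(1,3) tail_component_in_components[OF that(2,3)]
        eventually_frequently[OF sequentially_bot that(4)]])
  have AA: "?T F s = ?T F r" if "A r \<rho>" "A s \<sigma>" "finite F" for r s \<rho> \<sigma> F
  proof -
    have \<rho>: "\<rho> \<in> rays P K" and \<sigma>: "\<sigma> \<in> rays P K" using that by (auto simp: A_def)
    have "tail_component P K (Inl -` F) \<sigma> = tail_component P K (Inl -` F) \<rho>"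
      by (rule one[OF \<rho> \<sigma> finF(1)[OF that(3)]])
    then have "\<forall>\<^sub>F n in sequentially. \<sigma> n \<in> tail_component P K (Inl -` F) \<rho>"
      using tail_component_mem[OF \<sigma> finF(1)[OF that(3)]] by metis
    then have "\<forall>\<^sub>F n in sequentially. Inl (\<sigma> n) \<in> ?T F (\<lambda>n. Inl (\<rho> n))"
      by (simp only: tail_component_Inl_iff)
    from eqI[OF ray_Inl[OF \<sigma>] ray_Inl[OF \<rho>] that(3) this] show ?thesis
      using A_tail[OF that(1)] A_tail[OF that(2)] by simp
  qed
  have AB: "i \<in> tail_component P K (Inl -` F) \<rho>" if "A r \<rho>" "B s i \<sigma>" "finite F" "?T F s = ?T F r" for r s \<rho> i \<sigma> F
  proof -
    have "(\<lambda>n. Inr (i, \<sigma> n)) \<in> rays verts edges" using that(2) ray_Inr by (auto simp: B_def)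
    from T_ne[OF this that(3)] obtain n where "Inr (i, \<sigma> n) \<in> ?T F (\<lambda>n. Inr (i, \<sigma> n))" by blast
    then have "Inr (i, \<sigma> n) \<in> ?T F (\<lambda>n. Inl (\<rho> n))"
      using A_tail[OF that(1)] B_tail[OF that(2)] that(4) by simp
    then show ?thesis by (rule tail_component_Inl_Inr)
  qed
  have BA: "?T F s = ?T F r" if "A r \<rho>" "B s i \<sigma>" "finite F" "i \<in> tail_component P K (Inl -` F) \<rho>" for r s \<rho> i \<sigma> F
  proof -
    have i: "i \<in> I" and \<sigma>: "\<sigma> \<in> rays (W i) (D i)" and \<rho>: "\<rho> \<in> rays P K"
      using that by (auto simp: A_def B_def)
    have iT: "Inl i \<in> ?T F (\<lambda>n. Inl (\<rho> n))" using that(4) by (simp only: tail_component_Inl_iff)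
    have "i \<notin> Inl -` F" using that(4) tail_component_subset[of P K "Inl -` F" \<rho>] by blast
    then have iF: "Inl i \<in> verts - F" using i IP by auto
    have "\<forall>\<^sub>F n in sequentially. Inr (i, \<sigma> n) \<notin> F"
      using ray_leaves_finite[OF ray_Inr[OF i \<sigma>] that(3)] .
    then have "\<forall>\<^sub>F n in sequentially. Inr (i, \<sigma> n) \<in> ?T F (\<lambda>n. Inl (\<rho> n))"
    proof (rule eventually_mono)
      fix n assume "Inr (i, \<sigma> n) \<notin> F"
      then have "(Inl i, Inr (i, \<sigma> n)) \<in> joined (verts - F) edges"
        using iF i ray_mem[OF \<sigma>, of n] by (intro joined_edge) auto
      then show "Inr (i, \<sigma> n) \<in> ?T F (\<lambda>n. Inl (\<rho> n))" by (rule tail_component_closed[OF iT])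
    qed
    from eqI[OF ray_Inr[OF i \<sigma>] ray_Inl[OF \<rho>] that(3) this] show ?thesis
      using A_tail[OF that(1)] B_tail[OF that(2)] by simp
  qed
  have BB: "?T F s = ?T F r" if "B r i \<rho>" "B s i \<sigma>" "finite F"
    "tail_component (W i) (D i) (F' F i) \<sigma> = tail_component (W i) (D i) (F' F i) \<rho>" for r s i \<rho> \<sigma> F
  proof -
    have i: "i \<in> I" and \<sigma>: "\<sigma> \<in> rays (W i) (D i)" and \<rho>: "\<rho> \<in> rays (W i) (D i)"
      using that by (auto simp: B_def)
    have "\<forall>\<^sub>F n in sequentially. \<sigma> n \<in> tail_component (W i) (D i) (F' F i) \<rho>"
      using tail_component_mem[OF \<sigma> finF(2)[OF that(3)]] that(4) by metis
    then have "\<forall>\<^sub>F n in sequentially. Inr (i, \<sigma> n) \<in> ?T F (\<lambda>n. Inr (i, \<rho> n))"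
    proof (rule eventually_mono)
      fix n assume n: "\<sigma> n \<in> tail_component (W i) (D i) (F' F i) \<rho>"
      show "Inr (i, \<sigma> n) \<in> ?T F (\<lambda>n. Inr (i, \<rho> n))"
        unfolding tail_component_def mem_Collect_eq
        using n[unfolded tail_component_def mem_Collect_eq F'_def]
        by (rule eventually_mono) (rule joined_Inr[OF i])
    qed
    from eqI[OF ray_Inr[OF i \<sigma>] ray_Inr[OF i \<rho>] that(3) this] show ?thesis
      using B_tail[OF that(1)] B_tail[OF that(2)] by simp
  qed
  \<comment> \<open>Deleting \<open>Inl i\<close> isolates copy \<open>i\<close>, so a ray with the
    same tail component as \<open>r\<close> has its tail in that copy.\<close>
  have cut: "\<exists>\<sigma>. B s i \<sigma> \<and> z = g i (end_of (W i) (D i) \<sigma>) \<and>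
      tail_component (W i) (D i) (F' F i) \<sigma> = tail_component (W i) (D i) (F' F i) \<rho>"
    if r: "B r i \<rho>" and s: "R s z" and F: "finite F" "Inl i \<in> F" and eq: "?T F s = ?T F r"
    for r s i \<rho> z F
  proof -
    have i: "i \<in> I" and \<rho>: "\<rho> \<in> rays (W i) (D i)" using r by (auto simp: B_def)
    from s consider \<sigma> where "A s \<sigma>" | j \<sigma> where "B s j \<sigma>" "z = g j (end_of (W j) (D j) \<sigma>)"
      by (auto simp: R_def)
    then show ?thesis
    proof cases
      case 1
      then have "(\<lambda>n. Inl (\<sigma> n)) \<in> rays verts edges" using ray_Inl by (auto simp: A_def)
      from T_ne[OF this F(1)] obtain n where "Inl (\<sigma> n) \<in> ?T F (\<lambda>n. Inr (i, \<rho> n))"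
        using eq A_tail[OF 1] B_tail[OF r] by auto
      from tail_component_Inr_subset[OF F(2) this] show ?thesis by simp
    next
      case 2
      have \<sigma>: "\<sigma> \<in> rays (W j) (D j)" and j: "j \<in> I" using 2 by (auto simp: B_def)
      have T: "?T F (\<lambda>n. Inr (j, \<sigma> n)) = ?T F (\<lambda>n. Inr (i, \<rho> n))"
        using eq B_tail[OF 2(1)] B_tail[OF r] by simp
      from T_ne[OF ray_Inr[OF j \<sigma>] F(1)] obtain n where "Inr (j, \<sigma> n) \<in> ?T F (\<lambda>n. Inr (i, \<rho> n))"
        unfolding T by blast
      from tail_component_Inr_subset[OF F(2) this] have ij: "j = i" by simp
      have "tail_component (W i) (D i) (F' F i) \<sigma> = tail_component (W i) (D i) (F' F i) \<rho>"
        using tail_component_Inr_iff[OF i F(2), of _ \<rho>] tail_component_Inr_iff[OF i F(2), of _ \<sigma>] T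
        unfolding ij F'_def by blast
      with 2 show ?thesis unfolding ij by blast
    qed
  qed
  have R_ex: "\<exists>y. R r y" if "r \<in> rays verts edges" for r
    using that
  proof (cases rule: ray_cases)
    case (Inl m \<rho>)
    then show ?thesis unfolding R_def A_def by blast
  next
    case (Inr i m \<rho>)
    then show ?thesis unfolding R_def B_def by blast
  qed
  have R_uniq: "y = z" if "R r y" "R s z" "\<And>F. finite F \<Longrightarrow> ?T F s = ?T F r" for r s y z
  proof -
    have main: "y = z" if r: "B r i \<rho>" "y = g i (end_of (W i) (D i) \<rho>)" and s: "R s z"
      and eq: "\<And>F. finite F \<Longrightarrow> ?T F s = ?T F r" for r s y z i \<rho>
    proof -
      have i: "i \<in> I" and \<rho>: "\<rho> \<in> rays (W i) (D i)" using r by (auto simp: B_def)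
      obtain \<sigma> where \<sigma>: "B s i \<sigma>" "z = g i (end_of (W i) (D i) \<sigma>)"
        using cut[OF r(1) s, of "{Inl i}"] eq[of "{Inl i}"] by auto
      have "tail_component (W i) (D i) F0 \<sigma> = tail_component (W i) (D i) F0 \<rho>" if F0: "finite F0" for F0
      proof -
        \<comment> \<open>\<open>Inl i\<close> is added to the image of \<open>F0\<close> so that
          \<open>tail_component_Inr_iff\<close> applies.\<close>
        define F where "F = insert (Inl i) ((\<lambda>w. Inr (i, w)) ` F0)"
        have F: "finite F" "Inl i \<in> F" "F' F i = F0" using F0 by (auto simp: F_def F'_def)
        have T: "?T F (\<lambda>n. Inr (i, \<sigma> n)) = ?T F (\<lambda>n. Inr (i, \<rho> n))"
          using eq[OF F(1)] B_tail[OF \<sigma>(1)] B_tail[OF r(1)] by simp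
        show ?thesis
          using tail_component_Inr_iff[OF i F(2), of _ \<rho>] tail_component_Inr_iff[OF i F(2), of _ \<sigma>] T
          unfolding F(3)[symmetric] F'_def by blast
      qed
      moreover have "\<sigma> \<in> rays (W i) (D i)" using \<sigma>(1) by (auto simp: B_def)
      ultimately have "end_of (W i) (D i) \<rho> = end_of (W i) (D i) \<sigma>" using end_of_eq_iff[OF \<rho>] by blast
      then show ?thesis using r(2) \<sigma>(2) by simp
    qed
    from that(1) consider \<rho> where "A r \<rho>" "y = x" | i \<rho> where "B r i \<rho>" "y = g i (end_of (W i) (D i) \<rho>)"
      by (auto simp: R_def)
    then show ?thesis
    proof cases
      case 1
      from that(2) consider \<sigma> where "z = x" | i \<sigma> where "B s i \<sigma>" "z = g i (end_of (W i) (D i) \<sigma>)"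
        by (auto simp: R_def)
      then show ?thesis
      proof cases
        case 2
        \<comment> \<open>\<open>main\<close> with the two rays exchanged.\<close>
        have "z = y" by (rule main[OF 2 that(1)]) (use that(3) in simp)
        then show ?thesis by simp
      qed (use 1 in simp)
    next
      case 2
      show ?thesis by (rule main[OF 2 that(2,3)])
    qed
  qed
  define h where "h r = (SOME y. R r y)" for r
  have h: "R r (h r)" if "r \<in> rays verts edges" for r unfolding h_def by (rule someI_ex[OF R_ex[OF that]])
  have h_eq: "h r = y" if "r \<in> rays verts edges" "R r y" for r y
    by (rule R_uniq[OF h[OF that(1)] that(2) refl])
  have R_cases: "(\<exists>\<rho>. A r \<rho> \<and> y = x) \<or> (\<exists>i \<rho>. B r i \<rho> \<and> y = g i (end_of (W i) (D i) \<rho>))" if "R r y" for r y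
    using that by (simp only: R_def)
  have A_ray: "rays P K \<noteq> {}" if "A r \<rho>" for r \<rho> using that by (auto simp: A_def)
  have "S homeomorphic_space end_topology verts edges"
  proof (rule homeomorphic_end_topologyI[where h = h])
    fix r assume r: "r \<in> rays verts edges"
    from R_cases[OF h[OF r]] show "h r \<in> topspace S"
    proof (elim disjE exE conjE)
      fix \<rho> assume "A r \<rho>" "h r = x"
      then show ?thesis using top1[OF A_ray] by simp
    next
      fix i \<rho> assume "B r i \<rho>" "h r = g i (end_of (W i) (D i) \<rho>)"
      then have "i \<in> I" "h r \<in> Y i" using g_in by (auto simp: B_def)
      then show ?thesis using openin_subset[OF Y(1)] by blast
    qed
  next
    fix y assume y: "y \<in> topspace S"
    have Yi: "\<exists>r\<in>rays verts edges. h r = y" if i: "i \<in> I" "y \<in> Y i" for i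
    proof -
      obtain \<rho> where \<rho>: "\<rho> \<in> rays (W i) (D i)" "y = g i (end_of (W i) (D i) \<rho>)"
        using gY[OF i(1)] i(2) by (auto elim: graph_endsE)
      have "B (\<lambda>n. Inr (i, \<rho> n)) i \<rho>" unfolding B_def using i(1) \<rho>(1) by (auto intro!: exI[of _ 0])
      then have "R (\<lambda>n. Inr (i, \<rho> n)) y" using \<rho>(2) unfolding R_def by blast
      then show ?thesis using h_eq[OF ray_Inr[OF i(1) \<rho>(1)]] ray_Inr[OF i(1) \<rho>(1)] by blast
    qed
    show "\<exists>r\<in>rays verts edges. h r = y"
    proof (cases "\<exists>i\<in>I. y \<in> Y i")
      case False
      then have "rays P K \<noteq> {}" using y top0 by blast
      then have "y = x" using y top1 False by blast
      obtain \<rho> where \<rho>: "\<rho> \<in> rays P K" using \<open>rays P K \<noteq> {}\<close> by blast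
      have "A (\<lambda>n. Inl (\<rho> n)) \<rho>" unfolding A_def using \<rho> by (auto intro!: exI[of _ 0])
      then have "R (\<lambda>n. Inl (\<rho> n)) y" using \<open>y = x\<close> unfolding R_def by blast
      then show ?thesis using h_eq[OF ray_Inl[OF \<rho>]] ray_Inl[OF \<rho>] by blast
    qed (use Yi in blast)
  next
    fix r s assume r: "r \<in> rays verts edges" and s: "s \<in> rays verts edges"
      and "end_of verts edges r = end_of verts edges s"
    then have "?T F s = ?T F r" if "finite F" for F using end_of_eq_iff[OF r s] that by blast
    then show "h r = h s" by (rule R_uniq[OF h[OF r] h[OF s]])
  next
    fix U r assume U: "openin S U" and r: "r \<in> rays verts edges" "h r \<in> U"
    from R_cases[OF h[OF r(1)]]
    show "\<exists>F. finite F \<and> (\<forall>s\<in>rays verts edges. ?T F s = ?T F r \<longrightarrow> h s \<in> U)"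
    proof (elim disjE exE conjE)
      fix \<rho> assume \<rho>: "A r \<rho>" "h r = x"
      then have "\<rho> \<in> rays P K" by (simp add: A_def)
      with nb2[OF this U] r(2) \<rho>(2) obtain F0 where F0: "finite F0"
        "\<And>i. i \<in> I \<Longrightarrow> i \<in> tail_component P K F0 \<rho> \<Longrightarrow> Y i \<subseteq> U" by auto
      define F :: "('k + 'k \<times> (nat + 'a)) set" where "F = Inl ` F0"
      have F: "finite F" "Inl -` F = F0" using F0(1) by (auto simp: F_def)
      have "h s \<in> U" if s: "s \<in> rays verts edges" "?T F s = ?T F r" for s
        using R_cases[OF h[OF s(1)]]
      proof (elim disjE exE conjE)
        fix i \<sigma> assume \<sigma>: "B s i \<sigma>" "h s = g i (end_of (W i) (D i) \<sigma>)"
        have "i \<in> tail_component P K F0 \<rho>" using AB[OF \<rho>(1) \<sigma>(1) F(1) s(2)] F(2) by simp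
        moreover have "i \<in> I" "h s \<in> Y i" using \<sigma> g_in by (auto simp: B_def)
        ultimately show "h s \<in> U" using F0(2) by blast
      qed (use r(2) \<rho>(2) in simp)
      with F(1) show ?thesis by blast
    next
      fix i \<rho> assume \<rho>: "B r i \<rho>" "h r = g i (end_of (W i) (D i) \<rho>)"
      then have i: "i \<in> I" and \<rho>W: "\<rho> \<in> rays (W i) (D i)" by (auto simp: B_def)
      have "openin (subtopology S (Y i)) (U \<inter> Y i)" using U openin_subtopology by blast
      from openin_continuous_map_preimage[OF homeomorphic_imp_continuous_map[OF g[OF i]] this]
      have "openin (end_topology (W i) (D i)) {\<epsilon> \<in> graph_ends (W i) (D i). g i \<epsilon> \<in> U \<inter> Y i}"
        by (simp add: topspace_end_topology)
      moreover have "end_of (W i) (D i) \<rho> \<in> {\<epsilon> \<in> graph_ends (W i) (D i). g i \<epsilon> \<in> U \<inter> Y i}"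
        using end_of_in_graph_ends[OF \<rho>W] g_in[OF i \<rho>W] r(2) \<rho>(2) by simp
      ultimately have "\<exists>F. finite F \<and> (\<forall>\<sigma>\<in>rays (W i) (D i).
          tail_component (W i) (D i) F \<sigma> = tail_component (W i) (D i) F \<rho> \<longrightarrow>
          end_of (W i) (D i) \<sigma> \<in> {\<epsilon> \<in> graph_ends (W i) (D i). g i \<epsilon> \<in> U \<inter> Y i})"
        using \<rho>W unfolding openin_end_topology_iff by blast
      then obtain F0 where F0: "finite F0" "\<And>\<sigma>. \<sigma> \<in> rays (W i) (D i) \<Longrightarrow>
          tail_component (W i) (D i) F0 \<sigma> = tail_component (W i) (D i) F0 \<rho> \<Longrightarrow>
          g i (end_of (W i) (D i) \<sigma>) \<in> U" by auto
      define F where "F = insert (Inl i) ((\<lambda>w. Inr (i, w)) ` F0)"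
      have F: "finite F" "Inl i \<in> F" "F' F i = F0" using F0(1) by (auto simp: F_def F'_def)
      have "h s \<in> U" if s: "s \<in> rays verts edges" "?T F s = ?T F r" for s
      proof -
        obtain \<sigma> where "B s i \<sigma>" "h s = g i (end_of (W i) (D i) \<sigma>)"
          "tail_component (W i) (D i) F0 \<sigma> = tail_component (W i) (D i) F0 \<rho>"
          using cut[OF \<rho>(1) h[OF s(1)] F(1,2) s(2)] F(3) by auto
        then show ?thesis using F0(2) by (auto simp: B_def)
      qed
      with F(1) show ?thesis by blast
    qed
  next
    fix F :: "('k + 'k \<times> (nat + 'a)) set" and r assume F: "finite F" and r: "r \<in> rays verts edges"
    from R_cases[OF h[OF r]]
    show "\<exists>U. openin S U \<and> h r \<in> U \<and> (\<forall>s\<in>rays verts edges. h s \<in> U \<longrightarrow> ?T F s = ?T F r)"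
    proof (elim disjE exE conjE)
      fix \<rho> assume \<rho>: "A r \<rho>" "h r = x"
      then have "\<rho> \<in> rays P K" by (simp add: A_def)
      from nb1[OF this finF(1)[OF F]] obtain U where U: "openin S U" "x \<in> U"
        "\<And>i. i \<in> I \<Longrightarrow> Y i \<inter> U \<noteq> {} \<Longrightarrow> i \<in> tail_component P K (Inl -` F) \<rho>" by blast
      have "?T F s = ?T F r" if s: "s \<in> rays verts edges" "h s \<in> U" for s
        using R_cases[OF h[OF s(1)]]
      proof (elim disjE exE conjE)
        fix \<sigma> assume "A s \<sigma>"
        then show ?thesis using AA[OF \<rho>(1) _ F] by blast
      next
        fix i \<sigma> assume \<sigma>: "B s i \<sigma>" "h s = g i (end_of (W i) (D i) \<sigma>)"
        then have "i \<in> I" "h s \<in> Y i" using g_in by (auto simp: B_def)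
        then have "i \<in> tail_component P K (Inl -` F) \<rho>" using U(3) s(2) by blast
        then show ?thesis by (rule BA[OF \<rho>(1) \<sigma>(1) F])
      qed
      with U \<rho>(2) show ?thesis by auto
    next
      fix i \<rho> assume \<rho>: "B r i \<rho>" "h r = g i (end_of (W i) (D i) \<rho>)"
      then have i: "i \<in> I" and \<rho>W: "\<rho> \<in> rays (W i) (D i)" by (auto simp: B_def)
      define N where "N = {end_of (W i) (D i) \<sigma> | \<sigma>. \<sigma> \<in> rays (W i) (D i) \<and>
        tail_component (W i) (D i) (F' F i) \<sigma> = tail_component (W i) (D i) (F' F i) \<rho>}"
      have "openin (end_topology (W i) (D i)) N"
        unfolding N_def by (rule openin_tail_component_nbhd[OF \<rho>W finF(2)[OF F]])
      then have "openin (subtopology S (Y i)) (g i ` N)"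
        using homeomorphic_imp_open_map[OF g[OF i]] by (simp add: open_map_def)
      then have oN: "openin S (g i ` N)" using openin_trans_full[OF _ Y(1)[OF i]] by blast
      have NE: "N \<subseteq> graph_ends (W i) (D i)" by (auto simp: N_def intro: end_of_in_graph_ends)
      have NY: "g i ` N \<subseteq> Y i" using NE gY[OF i] by blast
      have "h r \<in> g i ` N" using \<rho>W \<rho>(2) by (auto simp: N_def)
      moreover have "?T F s = ?T F r" if s: "s \<in> rays verts edges" "h s \<in> g i ` N" for s
        using R_cases[OF h[OF s(1)]]
      proof (elim disjE exE conjE)
        fix \<sigma> assume "A s \<sigma>" "h s = x"
        then show ?thesis using x[OF A_ray i] s(2) NY by auto
      next
        fix j \<sigma> assume \<sigma>: "B s j \<sigma>" "h s = g j (end_of (W j) (D j) \<sigma>)"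
        then have j: "j \<in> I" and \<sigma>W: "\<sigma> \<in> rays (W j) (D j)" by (auto simp: B_def)
        have "h s \<in> Y j" using g_in[OF j \<sigma>W] \<sigma>(2) by simp
        then have ij: "j = i" using disj[OF j i] s(2) NY by blast
        obtain \<tau> where \<tau>: "\<tau> \<in> rays (W i) (D i)" "h s = g i (end_of (W i) (D i) \<tau>)"
          "tail_component (W i) (D i) (F' F i) \<tau> = tail_component (W i) (D i) (F' F i) \<rho>"
          using s(2) by (auto simp: N_def)
        have "end_of (W i) (D i) \<tau> = end_of (W i) (D i) \<sigma>"
          using g_inj[OF i \<tau>(1), of \<sigma>] \<sigma>W \<sigma>(2) \<tau>(2) unfolding ij by simp
        then have "tail_component (W i) (D i) (F' F i) \<sigma> = tail_component (W i) (D i) (F' F i) \<rho>"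
          using end_of_eq_iff[OF \<tau>(1), of \<sigma>] \<sigma>W \<tau>(3) finF(2)[OF F] unfolding ij by simp
        then show ?thesis using BB[OF \<rho>(1) _ F] \<sigma>(1) unfolding ij by blast
      qed
      ultimately show ?thesis using oN by blast
    qed
  qed
  then show ?thesis by (rule end_space_if_homeomorphic[OF simple_graph_edges])
qed

section \<open>Scattered subspaces\<close>

definition ends_in :: "'v set \<Rightarrow> 'v set set \<Rightarrow> 'v set \<Rightarrow> (nat \<Rightarrow> 'v) set set" where
  "ends_in V E C = {end_of V E \<rho> | \<rho>. \<rho> \<in> rays V E \<and> (\<forall>\<^sub>F n in sequentially. \<rho> n \<in> C)}"

lemma ends_in_subset: "ends_in V E C \<subseteq> graph_ends V E"
  by (auto simp: ends_in_def intro: end_of_in_graph_ends)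

lemma ends_in_mono: "B \<subseteq> C \<Longrightarrow> ends_in V E B \<subseteq> ends_in V E C"
  unfolding ends_in_def by (auto elim!: eventually_mono)

lemma ends_in_whole: "ends_in V E V = graph_ends V E"
  using ends_in_subset[of V E V] by (auto simp: ends_in_def ray_mem elim!: graph_endsE)

lemma end_of_shift:
  assumes "\<rho> \<in> rays V E" "(\<lambda>n. \<rho> (n + m)) \<in> rays V E"
  shows "end_of V E (\<lambda>n. \<rho> (n + m)) = end_of V E \<rho>"
  using end_of_eq_iff[OF assms(2,1)] by (simp add: tail_component_shift)

lemma ends_inE:
  assumes "\<epsilon> \<in> ends_in V E C" "C \<subseteq> V"
  obtains \<rho> where "\<rho> \<in> rays C E" "\<epsilon> = end_of V E \<rho>"
proof -
  obtain \<rho> m where \<rho>: "\<rho> \<in> rays V E" "\<epsilon> = end_of V E \<rho>" "\<And>n. n \<ge> m \<Longrightarrow> \<rho> n \<in> C"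
    using assms(1) unfolding ends_in_def eventually_sequentially by blast
  have "(\<lambda>n. \<rho> (n + m)) \<in> rays C E" by (rule ray_shift[OF \<rho>(1,3)])
  moreover from rays_mono[OF this assms(2)] have "\<epsilon> = end_of V E (\<lambda>n. \<rho> (n + m))"
    using end_of_shift[OF \<rho>(1)] \<rho>(2) by simp
  ultimately show thesis using that by blast
qed

lemma tail_component_nbs_subset:
  assumes "\<rho> \<in> rays V E" "region V E C" "\<forall>\<^sub>F n in sequentially. \<rho> n \<in> C"
  shows "tail_component V E (nbs V E C) \<rho> \<subseteq> C"
proof
  fix y assume y: "y \<in> tail_component V E (nbs V E C) \<rho>"
  have "\<forall>\<^sub>F n in sequentially. (\<rho> n, y) \<in> joined (V - nbs V E C) E \<and> \<rho> n \<in> C"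
    using y assms(3) unfolding tail_component_def by (simp add: eventually_conj)
  then obtain n where "(\<rho> n, y) \<in> joined (V - nbs V E C) E" "\<rho> n \<in> C"
    using eventually_happens'[OF sequentially_bot] by blast
  from joined_nbs[OF this order_refl] joined_mem[of _ y] show "y \<in> C" by blast
qed

lemma tail_component_nbs_eq:
  assumes "\<rho> \<in> rays V E" "\<sigma> \<in> rays V E" "region V E C" "\<forall>\<^sub>F n in sequentially. \<rho> n \<in> C"
    and "tail_component V E (nbs V E C) \<sigma> = tail_component V E (nbs V E C) \<rho>"
  shows "\<forall>\<^sub>F n in sequentially. \<sigma> n \<in> C"
proof -
  have "finite (nbs V E C)" using assms(3) by (simp add: region_def)
  from tail_component_mem[OF assms(2) this] show ?thesis
    by (rule eventually_mono) (use tail_component_nbs_subset[OF assms(1,3,4)] assms(5) in blast)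
qed

text \<open>One ray of the end decides for all of them: deleting the finite set
  \<open>nbs V E C\<close> confines its tail component to \<open>C\<close>, and equivalent rays
  share that component.\<close>

lemma end_of_in_ends_in_iff:
  assumes "region V E C" "\<rho> \<in> rays V E"
  shows "end_of V E \<rho> \<in> ends_in V E C \<longleftrightarrow> (\<forall>\<^sub>F n in sequentially. \<rho> n \<in> C)"
proof
  assume "end_of V E \<rho> \<in> ends_in V E C"
  then obtain \<sigma> where \<sigma>: "\<sigma> \<in> rays V E" "end_of V E \<sigma> = end_of V E \<rho>" "\<forall>\<^sub>F n in sequentially. \<sigma> n \<in> C"
    by (auto simp: ends_in_def)
  have "finite (nbs V E C)" using assms(1) by (simp add: region_def)
  then have "tail_component V E (nbs V E C) \<rho> = tail_component V E (nbs V E C) \<sigma>"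
    using end_of_eq_iff[OF \<sigma>(1) assms(2)] \<sigma>(2) by blast
  then show "\<forall>\<^sub>F n in sequentially. \<rho> n \<in> C" by (rule tail_component_nbs_eq[OF \<sigma>(1) assms(2,1) \<sigma>(3)])
qed (use assms in \<open>auto simp: ends_in_def\<close>)

lemma openin_ends_in:
  assumes C: "region V E C"
  shows "openin (end_topology V E) (ends_in V E C)"
  unfolding openin_end_topology_iff
proof (intro conjI ballI impI ends_in_subset)
  fix \<rho> assume \<rho>: "\<rho> \<in> rays V E" "end_of V E \<rho> \<in> ends_in V E C"
  have fin: "finite (nbs V E C)" using C by (simp add: region_def)
  have ev: "\<forall>\<^sub>F n in sequentially. \<rho> n \<in> C" using \<rho> end_of_in_ends_in_iff[OF C \<rho>(1)] by simp
  show "\<exists>F. finite F \<and> (\<forall>\<sigma>\<in>rays V E. tail_component V E F \<sigma> = tail_component V E F \<rho> \<longrightarrow>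
      end_of V E \<sigma> \<in> ends_in V E C)"
  proof (intro exI[of _ "nbs V E C"] conjI fin ballI impI)
    fix \<sigma> assume \<sigma>: "\<sigma> \<in> rays V E" "tail_component V E (nbs V E C) \<sigma> = tail_component V E (nbs V E C) \<rho>"
    show "end_of V E \<sigma> \<in> ends_in V E C"
      using tail_component_nbs_eq[OF \<rho>(1) \<sigma>(1) C ev \<sigma>(2)] end_of_in_ends_in_iff[OF C \<sigma>(1)] by simp
  qed
qed

lemma ends_in_disjoint:
  assumes "region V E B" "region V E C" "B \<inter> C = {}"
  shows "ends_in V E B \<inter> ends_in V E C = {}"
proof (rule ccontr)
  assume "\<not> ?thesis"
  then obtain \<epsilon> where \<epsilon>: "\<epsilon> \<in> ends_in V E B" "\<epsilon> \<in> ends_in V E C" by blast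
  then obtain \<rho> where \<rho>: "\<rho> \<in> rays V E" "\<epsilon> = end_of V E \<rho>" by (auto simp: ends_in_def)
  have "\<forall>\<^sub>F n in sequentially. \<rho> n \<in> B" "\<forall>\<^sub>F n in sequentially. \<rho> n \<in> C"
    using end_of_in_ends_in_iff[OF assms(1) \<rho>(1)] end_of_in_ends_in_iff[OF assms(2) \<rho>(1)] \<epsilon> \<rho>(2) by simp_all
  then have "\<forall>\<^sub>F n in sequentially. \<rho> n \<in> B \<inter> C" by (simp add: eventually_conj)
  with assms(3) show False by simp
qed

section \<open>The subspace of ends and its good regions\<close>

locale end_subspace =
  fixes V :: "'v set" and E :: "'v set set" and X :: "(nat \<Rightarrow> 'v) set set"
  assumes X: "X \<subseteq> graph_ends V E"
begin

text \<open>Asking for all subregions at once makes \<open>good_mono\<close> hold by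
  definition.\<close>

definition good :: "'v set \<Rightarrow> bool" where
  "good C \<longleftrightarrow> (\<forall>B\<subseteq>C. region V E B \<longrightarrow> end_space (subtopology (end_topology V E) (X \<inter> ends_in V E B)))"

sublocale good_regions V E good
  by unfold_locales (auto simp: good_def)

abbreviation space_in :: "'v set \<Rightarrow> (nat \<Rightarrow> 'v) set topology" where
  "space_in C \<equiv> subtopology (end_topology V E) (X \<inter> ends_in V E C)"

lemma topspace_space_in: "topspace (space_in C) = X \<inter> ends_in V E C"
  using X by (auto simp: topspace_end_topology)

lemma openin_space_in:
  assumes "region V E C" "C \<subseteq> A"
  shows "openin (space_in A) (X \<inter> ends_in V E C)"
proof -
  have "X \<inter> ends_in V E C = ends_in V E C \<inter> (X \<inter> ends_in V E A)" using ends_in_mono[OF assms(2), of V E] by blast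
  then show ?thesis using openin_ends_in[OF assms(1)] by (simp only: openin_subtopology) blast
qed

lemma subtopology_space_in:
  assumes "C \<subseteq> A"
  shows "subtopology (space_in A) (X \<inter> ends_in V E C) = space_in C"
proof -
  have "X \<inter> ends_in V E A \<inter> (X \<inter> ends_in V E C) = X \<inter> ends_in V E C"
    using ends_in_mono[OF assms, of V E] by blast
  then show ?thesis by (simp add: subtopology_subtopology)
qed

text \<open>A partition into good regions exhibits the space as a topological sum. It is realised by
  attaching to the edgeless graph on \<open>\<D>\<close>, which has no rays and so adds no
  point.\<close>

lemma end_space_if_locally_good:
  assumes A: "region V E A" and locally_good: "\<And>\<rho>. \<rho> \<in> rays A E \<Longrightarrow> end_of V E \<rho> \<in> X \<Longrightarrow> locally_good \<rho>"
  shows "end_space (space_in A)"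
proof -
  have AV: "A \<subseteq> V" using A by (simp add: region_def)
  obtain \<D> where \<D>: "(\<forall>C\<in>\<D>. C \<subseteq> A \<and> region V E C \<and> good C) \<and> disjoint \<D> \<and>
    (\<forall>\<rho>\<in>rays A E. locally_good \<rho> \<longrightarrow> (\<exists>C\<in>\<D>. \<forall>\<^sub>F n in sequentially. \<rho> n \<in> C))"
    using refinable_region[OF A] unfolding refinable_def ..
  then have D: "C \<subseteq> A" "region V E C" "good C" if "C \<in> \<D>" for C using that by auto
  have hit: "\<exists>C\<in>\<D>. \<forall>\<^sub>F n in sequentially. \<rho> n \<in> C" if "\<rho> \<in> rays A E" "locally_good \<rho>" for \<rho>
    using \<D> that by simp
  have no_rays: "rays \<D> {} = {}" by (auto simp: rays_def)
  show ?thesis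
  proof (rule end_space_attach[where P = \<D> and K = "{}" and I = \<D> and Y = "\<lambda>C. X \<inter> ends_in V E C"])
    show "end_space (subtopology (space_in A) (X \<inter> ends_in V E C))" if "C \<in> \<D>" for C
      using D[OF that] by (simp add: subtopology_space_in good_def)
    show "X \<inter> ends_in V E B \<inter> (X \<inter> ends_in V E C) = {}" if "B \<in> \<D>" "C \<in> \<D>" "B \<noteq> C" for B C
    proof -
      have "B \<inter> C = {}" using \<D> that by (simp add: disjoint_def)
      then show ?thesis using ends_in_disjoint[OF D(2)[OF that(1)] D(2)[OF that(2)]] by blast
    qed
    show "topspace (space_in A) = (\<Union>C\<in>\<D>. X \<inter> ends_in V E C)"
    proof
      show "topspace (space_in A) \<subseteq> (\<Union>C\<in>\<D>. X \<inter> ends_in V E C)"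
      proof
        fix \<epsilon> assume "\<epsilon> \<in> topspace (space_in A)"
        then have \<epsilon>: "\<epsilon> \<in> X" "\<epsilon> \<in> ends_in V E A" unfolding topspace_space_in by auto
        obtain \<rho> where \<rho>: "\<rho> \<in> rays A E" "\<epsilon> = end_of V E \<rho>" using ends_inE[OF \<epsilon>(2) AV] by blast
        then have "locally_good \<rho>" using locally_good \<epsilon>(1) by blast
        from hit[OF \<rho>(1) this] obtain C where "C \<in> \<D>" "\<forall>\<^sub>F n in sequentially. \<rho> n \<in> C" ..
        then show "\<epsilon> \<in> (\<Union>C\<in>\<D>. X \<inter> ends_in V E C)"
          using \<rho> \<epsilon>(1) rays_mono[OF \<rho>(1) AV] by (auto simp: ends_in_def)
      qed
      show "(\<Union>C\<in>\<D>. X \<inter> ends_in V E C) \<subseteq> topspace (space_in A)"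
        unfolding topspace_space_in using ends_in_mono[OF D(1), of _ V E] by blast
    qed
  qed (use no_rays D openin_space_in in \<open>auto simp: simple_graph_def\<close>)
qed

text \<open>The components of the envelope of \<open>x\<close> are contracted; all rays of the resulting graph lift to rays
  of \<open>x\<close>. The spaces of the components are then attached to that graph.\<close>

lemma end_space_one_bad:
  assumes A: "region V E A" and x: "x \<in> X" "x \<in> ends_in V E A"
    and locally_good: "\<And>\<rho>. \<rho> \<in> rays A E \<Longrightarrow> end_of V E \<rho> \<in> X \<Longrightarrow> end_of V E \<rho> \<noteq> x \<Longrightarrow> locally_good \<rho>"
  shows "end_space (space_in A)"
proof -
  have AV: "A \<subseteq> V" and finA: "finite (nbs V E A)" using A by (auto simp: region_def)
  obtain \<xi> where \<xi>: "\<xi> \<in> rays A E" "x = end_of V E \<xi>" using ends_inE[OF x(2) AV] by blast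
  have \<xi>V: "\<xi> \<in> rays V E" by (rule rays_mono[OF \<xi>(1) AV])
  have opn: "\<exists>F. finite F \<and> (\<forall>\<sigma>\<in>rays A E.
      (\<forall>\<^sub>F n in sequentially. \<sigma> n \<in> tail_component A E F \<rho>) \<longrightarrow> \<not> end_of V E \<sigma> = x)"
    if \<rho>: "\<rho> \<in> rays A E" "\<not> end_of V E \<rho> = x" for \<rho>
  proof -
    have \<rho>V: "\<rho> \<in> rays V E" by (rule rays_mono[OF \<rho>(1) AV])
    obtain F where F: "finite F" "tail_component V E F \<xi> \<noteq> tail_component V E F \<rho>"
      using \<rho>(2) end_of_eq_iff[OF \<rho>V \<xi>V] \<xi>(2) by blast
    have "end_of V E \<sigma> \<noteq> x" if \<sigma>: "\<sigma> \<in> rays A E" "\<forall>\<^sub>F n in sequentially. \<sigma> n \<in> tail_component A E F \<rho>" for \<sigma>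
    proof
      assume \<sigma>x: "end_of V E \<sigma> = x"
      have \<sigma>V: "\<sigma> \<in> rays V E" by (rule rays_mono[OF \<sigma>(1) AV])
      have "\<forall>\<^sub>F n in sequentially. \<sigma> n \<in> tail_component V E F \<rho>"
        using \<sigma>(2) by (rule eventually_mono) (use tail_component_mono[OF AV order_refl, of E F \<rho>] in blast)
      then have "tail_component V E F \<sigma> = tail_component V E F \<rho>"
        by (intro tail_component_eqI[OF \<sigma>V F(1) tail_component_in_components[OF \<rho>V F(1)]]
            eventually_frequently[OF sequentially_bot])
      moreover have "tail_component V E F \<sigma> = tail_component V E F \<xi>"
        using end_of_eq_iff[OF \<xi>V \<sigma>V] \<sigma>x \<xi>(2) F(1) by blast
      ultimately show False using F(2) by simp
    qed
    with F(1) show ?thesis by blast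
  qed
  obtain T where T: "T \<subseteq> A" and fin_nbs: "\<And>C. C \<in> components_of_graph (A - T) E \<Longrightarrow> finite (nbs A E C)"
    and leave: "\<And>\<rho>. \<rho> \<in> rays A E \<Longrightarrow> \<not> end_of V E \<rho> = x \<Longrightarrow> \<forall>\<^sub>F n in sequentially. \<rho> n \<notin> T"
    and inside: "\<And>\<rho>. \<rho> \<in> rays (A - T) E \<Longrightarrow> \<not> end_of V E \<rho> = x"
    using envelope[of A E "\<lambda>\<rho>. end_of V E \<rho> = x", OF opn] by blast
  define I where "I = components_of_graph (A - T) E"
  \<comment> \<open>Vertices of the contracted graph: the components of \<open>A - T\<close>, and a
    singleton for each vertex of \<open>T\<close>. The sets in \<open>P\<close> partition
    \<open>A\<close>, with projection \<open>\<pi>\<close>.\<close>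
  define P where "P = I \<union> (\<lambda>t. {t}) ` T"
  define K where "K = {{B, C} | B C. B \<in> P \<and> C \<in> P \<and> B \<noteq> C \<and> (\<exists>b\<in>B. \<exists>c\<in>C. {b, c} \<in> E)}"
  define \<pi> where "\<pi> a = (if a \<in> T then {a} else joined (A - T) E `` {a})" for a
  have I: "C \<subseteq> A - T" "finite (nbs A E C)" "conn C E" "region V E C" if "C \<in> I" for C
    using that component_subset fin_nbs component_conn region_component[OF A] unfolding I_def by blast+
  have P_sub: "B \<subseteq> A" if "B \<in> P" for B using that I(1) T by (auto simp: P_def)
  have P_conn: "conn B E" if "B \<in> P" for B
    using that I(3) by (auto simp: P_def conn_def intro: joined_refl)
  have P_ne: "B \<noteq> {}" if "B \<in> P" for B
    using that component_nonempty by (auto simp: P_def I_def)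
  have \<pi>_in: "a \<in> \<pi> a" "\<pi> a \<in> P" if "a \<in> A" for a
    using that component_of[of a "A - T" E] joined_refl[of a "A - T" E]
    by (auto simp: \<pi>_def P_def I_def)
  have \<pi>_eq: "\<pi> a = B" if "B \<in> P" "a \<in> B" for a B
  proof (cases "B \<in> I")
    case True
    then show ?thesis using that(2) I(1)[OF True] component_eq[of B "A - T" E a] by (auto simp: \<pi>_def I_def)
  next
    case False
    then show ?thesis using that by (auto simp: \<pi>_def P_def)
  qed
  have K_edge: "{\<pi> a, \<pi> b} \<in> K" if "a \<in> A" "b \<in> A" "{a, b} \<in> E" "\<pi> a \<noteq> \<pi> b" for a b
    unfolding K_def using \<pi>_in[OF that(1)] \<pi>_in[OF that(2)] that(3,4) by blast
  have K_edgeD: "\<exists>b\<in>B. \<exists>c\<in>C. {b, c} \<in> E" if BC: "{B, C} \<in> K" for B C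
  proof -
    obtain B' C' b c where bc: "{B, C} = {B', C'}" "b \<in> B'" "c \<in> C'" "{b, c} \<in> E" "{c, b} \<in> E"
      using BC unfolding K_def by (auto simp: insert_commute)
    then have "B = B' \<and> C = C' \<or> B = C' \<and> C = B'" by (simp add: doubleton_eq_iff)
    then show ?thesis using bc(2-5) by blast
  qed
  \<comment> \<open>A finite vertex set doing the work of a finite set \<open>F\<close> of
    contracted vertices. A component in \<open>F\<close> may be infinite; deleting its finite
    neighbourhood instead stops walks from entering it. Adding \<open>nbs V E A\<close> keeps walks
    inside \<open>A\<close>.\<close>
  define G where "G F = {t. {t} \<in> F} \<union> (\<Union>C\<in>F \<inter> I. nbs A E C) \<union> nbs V E A" for F
  have G: "finite (G F)" if "finite F" for F
  proof -
    have "finite {t. {t} \<in> F}" using finite_vimageI[OF that, of "\<lambda>t. {t}"] by (simp add: vimage_def)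
    then show ?thesis using that I(2) finA by (auto simp: G_def)
  qed
  have to_A: "(a, b) \<in> joined (A - G F) E" if "(a, b) \<in> joined (V - G F) E" "a \<in> A" for a b F
    using joined_nbs[OF that] by (simp add: G_def)
  have to_P: "(\<pi> a, \<pi> b) \<in> joined (P - F) K" if ab: "(a, b) \<in> joined (A - G F) E" "\<pi> a \<notin> F" for a b F
    using ab(1)
  proof (induction rule: joined_induct)
    case base
    then show ?case using \<pi>_in(2) joined_mem[OF ab(1)] ab(2) by (auto intro: joined_refl)
  next
    case (step b c)
    have b: "b \<in> A - G F" and c: "c \<in> A - G F" using joined_mem[OF step.hyps(1)] step.hyps(2) by auto
    have \<pi>b: "\<pi> b \<notin> F" using joined_mem[OF step.IH] by blast
    show ?case
    proof (cases "\<pi> b = \<pi> c")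
      case False
      have "\<pi> c \<notin> F"
      proof
        assume cF: "\<pi> c \<in> F"
        show False
        proof (cases "\<pi> c \<in> I")
          case True
          have "b \<notin> \<pi> c" using False \<pi>_eq[OF \<pi>_in(2)] c by blast
          then have "b \<in> nbs A E (\<pi> c)"
            using b c \<pi>_in(1)[of c] step.hyps(3) by (auto simp: nbs_def insert_commute)
          with b cF True show False by (auto simp: G_def)
        next
          case False
          then have "\<pi> c = {c}" using \<pi>_in[of c] c by (auto simp: P_def)
          with cF c show False by (auto simp: G_def)
        qed
      qed
      then have "(\<pi> b, \<pi> c) \<in> joined (P - F) K"
        using \<pi>b b c \<pi>_in(2) K_edge[OF _ _ step.hyps(3) False] by (intro joined_edge) auto
      with step.IH show ?thesis by (rule joined_trans)
    qed (use step.IH in simp)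
  qed
  \<comment> \<open>Contracted walks lift because every contracted vertex is a connected set.
    Deleting all sets that meet \<open>F\<close> keeps the lift off \<open>F\<close>.\<close>
  have from_P: "(b, c) \<in> joined (A - F) E"
    if BC: "(B, C) \<in> joined (P - \<pi> ` (F \<inter> A)) K" and bc: "b \<in> B" "c \<in> C" for b c B C F
  proof -
    have off: "D \<subseteq> A - F" if "D \<in> P - \<pi> ` (F \<inter> A)" for D
      using that P_sub \<pi>_eq by fastforce
    have within: "(u, v) \<in> joined (A - F) E" if "D \<in> P - \<pi> ` (F \<inter> A)" "u \<in> D" "v \<in> D" for D u v
      using conn_joined[OF P_conn off that(2,3)] that(1) by blast
    have "\<forall>c\<in>C. (b, c) \<in> joined (A - F) E"
      using BC
    proof (induction rule: joined_induct)
      case base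
      then show ?case using within joined_mem[OF BC] bc(1) by blast
    next
      case (step C D)
      have C: "C \<in> P - \<pi> ` (F \<inter> A)" using joined_mem[OF step.hyps(1)] by blast
      obtain u v where uv: "u \<in> C" "v \<in> D" "{u, v} \<in> E" using K_edgeD[OF step.hyps(3)] by blast
      then have e: "(u, v) \<in> joined (A - F) E" using off[OF C] off[OF step.hyps(2)] by (intro joined_edge) auto
      show ?case
      proof
        fix d assume "d \<in> D"
        then have "(v, d) \<in> joined (A - F) E" using within[OF step.hyps(2) uv(2)] by blast
        with e have "(u, d) \<in> joined (A - F) E" by (rule joined_trans)
        with step.IH uv(1) show "(b, d) \<in> joined (A - F) E" using joined_trans by metis
      qed
    qed
    with bc(2) show ?thesis by blast
  qed
  \<comment> \<open>After the last visit of \<open>\<xi>\<close> to the finite set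
    \<open>nbs A E B\<close>, a visit to the component \<open>B\<close> would last forever, giving a
    ray of \<open>x\<close> outside \<open>T\<close>.\<close>
  have \<xi>_leaves: "\<exists>n. \<forall>m\<ge>n. \<xi> m \<notin> B" if "B \<in> P" for B
  proof (cases "B \<in> I")
    case True
    show ?thesis
    proof (rule ccontr)
      assume "\<not> ?thesis"
      then have often: "\<And>n. \<exists>m\<ge>n. \<xi> m \<in> B" by blast
      obtain n where n: "\<And>m. m \<ge> n \<Longrightarrow> \<xi> m \<notin> nbs A E B"
        using ray_leaves_finite[OF \<xi>(1) I(2)[OF True]] unfolding eventually_sequentially by blast
      obtain m where m: "m \<ge> n" "\<xi> m \<in> B" using often by blast
      have "\<xi> k \<in> B" if "k \<ge> m" for k
      proof -
        have "(\<xi> m, \<xi> k) \<in> joined (A - nbs A E B) E"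
          using ray_tail_joined[OF \<xi>(1), of m "A - nbs A E B" m k] n m(1) ray_mem[OF \<xi>(1)] that by simp
        from joined_nbs[OF this m(2) order_refl] show ?thesis using joined_mem by fast
      qed
      from ray_shift[OF \<xi>(1) this] have s: "(\<lambda>k. \<xi> (k + m)) \<in> rays B E" .
      have "(\<lambda>k. \<xi> (k + m)) \<in> rays V E" using rays_mono[OF s] I(1)[OF True] AV by blast
      then have "end_of V E (\<lambda>k. \<xi> (k + m)) = x" using end_of_shift[OF \<xi>V] \<xi>(2) by simp
      then show False using inside[OF rays_mono[OF s I(1)[OF True]]] by simp
    qed
  next
    case False
    then have "finite B" using that by (auto simp: P_def)
    from ray_leaves_finite[OF \<xi>(1) this] show ?thesis unfolding eventually_sequentially .
  qed
  have \<xi>A: "\<xi> n \<in> A" for n by (rule ray_mem[OF \<xi>(1)])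
  have K_rays: "rays P K \<noteq> {}"
  proof -
    define B where "B n = (\<lambda>m. \<pi> (\<xi> m)) ` {n..}" for n
    have "B (Suc n) \<subseteq> B n" for n by (auto simp: B_def)
    moreover have "(\<Inter>n. B n) = {}"
    proof (rule ccontr)
      assume "\<not> ?thesis"
      then obtain C where C: "\<And>n. C \<in> B n" by blast
      then have "C \<in> P" using \<pi>_in(2)[OF \<xi>A] by (auto simp: B_def)
      then obtain n where n: "\<And>m. m \<ge> n \<Longrightarrow> \<xi> m \<notin> C" using \<xi>_leaves by blast
      from C[of n] obtain m where "m \<ge> n" "C = \<pi> (\<xi> m)" by (auto simp: B_def)
      then show False using n \<pi>_in(1)[OF \<xi>A] by blast
    qed
    moreover have "(\<pi> (\<xi> n), \<pi> (\<xi> (Suc n))) \<in> joined (B n) K" for n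
    proof (cases "\<pi> (\<xi> n) = \<pi> (\<xi> (Suc n))")
      case True
      then show ?thesis by (auto simp: B_def intro!: joined_refl)
    next
      case False
      have "{\<xi> n, \<xi> (Suc n)} \<in> E" using \<xi>(1) by (simp add: rays_def)
      from K_edge[OF \<xi>A \<xi>A this False] show ?thesis by (intro joined_edge) (auto simp: B_def)
    qed
    ultimately obtain \<rho> where "\<rho> \<in> rays (B 0) K" using ray_exists[of B "\<lambda>n. \<pi> (\<xi> n)" K] by blast
    moreover have "B 0 \<subseteq> P" using \<pi>_in(2)[OF \<xi>A] by (auto simp: B_def)
    ultimately show ?thesis using rays_mono by blast
  qed
  \<comment> \<open>Any ray \<open>\<rho>\<close> of the contracted graph lifts to a ray
    \<open>\<tau>\<close> through the sets \<open>\<rho> n\<close>. If \<open>\<tau>\<close> did not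
    belong to \<open>x\<close>, it would have a tail in one component, but \<open>\<rho>\<close>
    visits that component at most once. So \<open>\<tau>\<close> is equivalent to
    \<open>\<xi>\<close>, and the projection of \<open>\<xi>\<close> follows \<open>\<rho>\<close>.
    In particular the contracted graph has only one end.\<close>
  have toward: "\<forall>\<^sub>F n in sequentially. \<pi> (\<xi> n) \<in> tail_component P K F \<rho>"
    if \<rho>: "\<rho> \<in> rays P K" and F: "finite F" for \<rho> F
  proof -
    have \<rho>P: "\<rho> n \<in> P" for n by (rule ray_mem[OF \<rho>])
    have \<rho>inj: "\<rho> m = \<rho> n \<Longrightarrow> m = n" for m n using \<rho> by (auto simp: rays_def inj_def)
    define B where "B n = (\<Union>m\<in>{n..}. \<rho> m)" for n
    have "\<forall>n. \<exists>a. a \<in> \<rho> n" using P_ne[OF \<rho>P] by blast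
    then obtain a where a: "\<And>n. a n \<in> \<rho> n" by metis
    have dec: "B (Suc n) \<subseteq> B n" for n by (force simp: B_def)
    have empty: "(\<Inter>n. B n) = {}"
    proof (rule ccontr)
      assume "\<not> ?thesis"
      then obtain c where c: "\<And>n. c \<in> B n" by blast
      from c[of 0] obtain k where k: "c \<in> \<rho> k" by (auto simp: B_def)
      from c[of "Suc k"] obtain l where l: "l \<ge> Suc k" "c \<in> \<rho> l" by (auto simp: B_def)
      have "\<rho> k = \<rho> l" using \<pi>_eq[OF \<rho>P k] \<pi>_eq[OF \<rho>P l(2)] by simp
      from \<rho>inj[OF this] l(1) show False by simp
    qed
    have link: "(a n, a (Suc n)) \<in> joined (B n) E" for n
    proof -
      have sub: "\<rho> m \<subseteq> B n" if "m \<ge> n" for m using that by (auto simp: B_def)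
      have "{\<rho> n, \<rho> (Suc n)} \<in> K" using \<rho> by (simp add: rays_def)
      then obtain u v where uv: "u \<in> \<rho> n" "v \<in> \<rho> (Suc n)" "{u, v} \<in> E" using K_edgeD by blast
      have "(a n, u) \<in> joined (B n) E" using conn_joined[OF P_conn[OF \<rho>P] sub[OF order_refl] a uv(1)] .
      moreover have "(u, v) \<in> joined (B n) E" using uv sub[of n] sub[of "Suc n"] by (intro joined_edge) auto
      moreover have "(v, a (Suc n)) \<in> joined (B n) E" using conn_joined[OF P_conn[OF \<rho>P] sub uv(2) a] by simp
      ultimately show ?thesis using joined_trans by metis
    qed
    obtain \<tau> where \<tau>: "\<tau> \<in> rays (B 0) E" "\<And>n. \<forall>\<^sub>F j in sequentially. (a n, \<tau> j) \<in> joined (B n) E"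
      using ray_exists[of B a E, OF dec empty link] by blast
    have \<tau>B: "\<forall>\<^sub>F j in sequentially. \<tau> j \<in> B n" for n
      using \<tau>(2)[of n] by (rule eventually_mono) (auto dest: joined_mem)
    have "B 0 \<subseteq> A" using P_sub[OF \<rho>P] by (auto simp: B_def)
    then have \<tau>A: "\<tau> \<in> rays A E" using rays_mono[OF \<tau>(1)] by blast
    have \<tau>V: "\<tau> \<in> rays V E" by (rule rays_mono[OF \<tau>A AV])
    have "end_of V E \<tau> = x"
    proof (rule ccontr)
      assume "end_of V E \<tau> \<noteq> x"
      from ray_tail_in_component[OF \<tau>A leave[OF \<tau>A this]]
      obtain C where C: "C \<in> I" "\<forall>\<^sub>F j in sequentially. \<tau> j \<in> C" unfolding I_def by blast
      have "\<exists>n. \<forall>m\<ge>n. \<rho> m \<noteq> C"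
      proof (cases "\<exists>k. \<rho> k = C")
        case True
        then obtain k where "\<rho> k = C" by blast
        then have "\<rho> m \<noteq> C" if "m \<ge> Suc k" for m using \<rho>inj[of m k] that by auto
        then show ?thesis by blast
      qed blast
      then obtain n where n: "\<And>m. m \<ge> n \<Longrightarrow> \<rho> m \<noteq> C" by blast
      have "\<forall>\<^sub>F j in sequentially. \<tau> j \<in> C \<and> \<tau> j \<in> B n" using C(2) \<tau>B[of n] by (rule eventually_conj)
      then obtain j where j: "\<tau> j \<in> C" "\<tau> j \<in> B n" using eventually_happens'[OF sequentially_bot] by blast
      then obtain m where "m \<ge> n" "\<tau> j \<in> \<rho> m" by (auto simp: B_def)
      moreover have "C \<in> P" using C(1) by (simp add: P_def)
      ultimately have "\<rho> m = C" using \<pi>_eq[OF \<rho>P] \<pi>_eq[of C "\<tau> j"] j(1) by metis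
      then show False using n \<open>m \<ge> n\<close> by blast
    qed
    then have "tail_component V E (G F) \<xi> = tail_component V E (G F) \<tau>"
      using end_of_eq_iff[OF \<tau>V \<xi>V] \<xi>(2) G[OF F] by blast
    then have "\<forall>\<^sub>F n in sequentially. \<xi> n \<in> tail_component V E (G F) \<tau>"
      using tail_component_mem[OF \<xi>V G[OF F]] by metis
    then show ?thesis
    proof (rule eventually_mono)
      fix i assume i: "\<xi> i \<in> tail_component V E (G F) \<tau>"
      obtain n where n: "\<And>m. m \<ge> n \<Longrightarrow> \<rho> m \<notin> F"
        using ray_leaves_finite[OF \<rho> F] unfolding eventually_sequentially by blast
      have "\<forall>\<^sub>F j in sequentially. (\<tau> j, \<xi> i) \<in> joined (V - G F) E \<and> \<tau> j \<in> B n"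
        using i[unfolded tail_component_def mem_Collect_eq] \<tau>B[of n] by (rule eventually_conj)
      then obtain j where j: "(\<tau> j, \<xi> i) \<in> joined (V - G F) E" "\<tau> j \<in> B n"
        using eventually_happens'[OF sequentially_bot] by blast
      from j(2) obtain k where k: "k \<ge> n" "\<tau> j \<in> \<rho> k" by (auto simp: B_def)
      have "\<pi> (\<tau> j) = \<rho> k" by (rule \<pi>_eq[OF \<rho>P k(2)])
      then have "(\<rho> k, \<pi> (\<xi> i)) \<in> joined (P - F) K"
        using to_P[OF to_A[OF j(1)]] ray_mem[OF \<tau>A] n[OF k(1)] by simp
      moreover have "(\<rho> m, \<rho> k) \<in> joined (P - F) K" if "m \<ge> n" for m
        using ray_tail_joined[OF \<rho>, of n "P - F" m k] n \<rho>P that k(1) by simp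
      ultimately have "(\<rho> m, \<pi> (\<xi> i)) \<in> joined (P - F) K" if "m \<ge> n" for m
        using joined_trans that by metis
      then show "\<pi> (\<xi> i) \<in> tail_component P K F \<rho>"
        unfolding tail_component_def eventually_sequentially by blast
    qed
  qed
  have near: "\<exists>i. \<pi> (\<xi> i) \<in> tail_component P K F \<rho> \<and> \<xi> i \<in> tail_component V E F0 \<xi>"
    if "\<rho> \<in> rays P K" "finite F" "finite F0" for \<rho> F F0
    using eventually_happens'[OF sequentially_bot
        eventually_conj[OF toward[OF that(1,2)] tail_component_mem[OF \<xi>V that(3)]]] .
  show ?thesis
  proof (rule end_space_attach[where P = P and K = K and I = I and Y = "\<lambda>C. X \<inter> ends_in V E C" and x = x])
    show "simple_graph P K"
      unfolding simple_graph_def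
    proof
      fix e assume "e \<in> K"
      then obtain B C where "e = {B, C}" "B \<in> P" "C \<in> P" "B \<noteq> C" unfolding K_def by blast
      then show "e \<subseteq> P \<and> card e = 2" by simp
    qed
    show "I \<subseteq> P" by (simp add: P_def)
    show "topspace (space_in A) = (\<Union>C\<in>I. X \<inter> ends_in V E C)" if "rays P K = {}" using K_rays that by blast
  next
    fix C assume C: "C \<in> I"
    have CA: "C \<subseteq> A" using I(1)[OF C] by blast
    show "openin (space_in A) (X \<inter> ends_in V E C)" by (rule openin_space_in[OF I(4)[OF C] CA])
    have "end_space (space_in C)"
    proof (rule end_space_if_locally_good[OF I(4)[OF C]])
      fix \<rho> assume \<rho>: "\<rho> \<in> rays C E" "end_of V E \<rho> \<in> X"
      show "locally_good \<rho>"
        by (rule locally_good[OF rays_mono[OF \<rho>(1) CA] \<rho>(2)]) (rule inside[OF rays_mono[OF \<rho>(1) I(1)[OF C]]])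
    qed
    then show "end_space (subtopology (space_in A) (X \<inter> ends_in V E C))"
      by (simp only: subtopology_space_in[OF CA])
    show "x \<notin> X \<inter> ends_in V E C"
    proof
      assume "x \<in> X \<inter> ends_in V E C"
      then obtain \<rho> where "\<rho> \<in> rays C E" "x = end_of V E \<rho>"
        using ends_inE[of x V E C] CA AV by blast
      then show False using inside[OF rays_mono[OF _ I(1)[OF C]]] by blast
    qed
  next
    fix B C assume BC: "B \<in> I" "C \<in> I" "B \<noteq> C"
    then have "B \<inter> C = {}" unfolding I_def by (rule component_disjoint)
    then show "X \<inter> ends_in V E B \<inter> (X \<inter> ends_in V E C) = {}"
      using ends_in_disjoint[OF I(4)[OF BC(1)] I(4)[OF BC(2)]] by blast
  next
    show "topspace (space_in A) = insert x (\<Union>C\<in>I. X \<inter> ends_in V E C)"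
    proof
      show "topspace (space_in A) \<subseteq> insert x (\<Union>C\<in>I. X \<inter> ends_in V E C)"
      proof
        fix \<epsilon> assume "\<epsilon> \<in> topspace (space_in A)"
        then have \<epsilon>: "\<epsilon> \<in> X" "\<epsilon> \<in> ends_in V E A" unfolding topspace_space_in by auto
        obtain \<rho> where \<rho>: "\<rho> \<in> rays A E" "\<epsilon> = end_of V E \<rho>" using ends_inE[OF \<epsilon>(2) AV] by blast
        show "\<epsilon> \<in> insert x (\<Union>C\<in>I. X \<inter> ends_in V E C)"
        proof (cases "\<epsilon> = x")
          case False
          then have "\<not> end_of V E \<rho> = x" using \<rho>(2) by simp
          from ray_tail_in_component[OF \<rho>(1) leave[OF \<rho>(1) this]]
          obtain C where "C \<in> I" "\<forall>\<^sub>F n in sequentially. \<rho> n \<in> C" unfolding I_def by blast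
          then show ?thesis using \<rho> \<epsilon>(1) rays_mono[OF \<rho>(1) AV] by (auto simp: ends_in_def)
        qed simp
      qed
      have "ends_in V E C \<subseteq> ends_in V E A" if "C \<in> I" for C
        by (rule ends_in_mono) (use I(1)[OF that] in blast)
      then show "insert x (\<Union>C\<in>I. X \<inter> ends_in V E C) \<subseteq> topspace (space_in A)"
        unfolding topspace_space_in using x by blast
    qed
  next
    fix \<rho> \<sigma> and F :: "'v set set" assume r: "\<rho> \<in> rays P K" "\<sigma> \<in> rays P K" and F: "finite F"
    obtain i where i: "\<pi> (\<xi> i) \<in> tail_component P K F \<rho>" "\<pi> (\<xi> i) \<in> tail_component P K F \<sigma>"
      using eventually_happens'[OF sequentially_bot eventually_conj[OF toward[OF r(1) F] toward[OF r(2) F]]] by blast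
    then show "tail_component P K F \<sigma> = tail_component P K F \<rho>"
      using component_disjoint[OF tail_component_in_components[OF r(1) F] tail_component_in_components[OF r(2) F]]
      by blast
  next
    fix \<rho> and F :: "'v set set" assume \<rho>: "\<rho> \<in> rays P K" and F: "finite F"
    \<comment> \<open>A ray with a tail in \<open>C\<close> that \<open>G F\<close> does not
      separate from \<open>\<xi>\<close> projects to a connection between
      \<open>\<pi> (\<xi> i)\<close> and \<open>C\<close> in \<open>P - F\<close>.\<close>
    let ?N = "{end_of V E \<sigma> | \<sigma>. \<sigma> \<in> rays V E \<and> tail_component V E (G F) \<sigma> = tail_component V E (G F) \<xi>}"
    let ?U = "?N \<inter> (X \<inter> ends_in V E A)"
    have "openin (space_in A) ?U"
      using openin_tail_component_nbhd[OF \<xi>V G[OF F]] openin_subtopology by blast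
    moreover have "x \<in> ?U" using x \<xi>(2) \<xi>V by blast
    moreover have "C \<in> tail_component P K F \<rho>" if C: "C \<in> I" "X \<inter> ends_in V E C \<inter> ?U \<noteq> {}" for C
    proof -
      obtain \<sigma> where \<sigma>: "\<sigma> \<in> rays V E" "end_of V E \<sigma> \<in> ends_in V E C"
        "tail_component V E (G F) \<sigma> = tail_component V E (G F) \<xi>" using C(2) by blast
      have "\<forall>\<^sub>F n in sequentially. \<sigma> n \<in> C" using end_of_in_ends_in_iff[OF I(4)[OF C(1)] \<sigma>(1)] \<sigma>(2) by simp
      from eventually_happens'[OF sequentially_bot eventually_conj[OF this tail_component_mem[OF \<sigma>(1) G[OF F]]]]
      obtain n where n: "\<sigma> n \<in> C" "\<sigma> n \<in> tail_component V E (G F) \<xi>" using \<sigma>(3) by blast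
      obtain i where i: "\<pi> (\<xi> i) \<in> tail_component P K F \<rho>" "\<xi> i \<in> tail_component V E (G F) \<xi>"
        using near[OF \<rho> F G[OF F]] by blast
      have "\<pi> (\<xi> i) \<notin> F" using i(1) tail_component_subset[of P K F \<rho>] by blast
      from to_P[OF to_A[OF tail_component_joined[OF i(2) n(2)] \<xi>A] this]
      have "(\<pi> (\<xi> i), \<pi> (\<sigma> n)) \<in> joined (P - F) K" .
      moreover have "\<pi> (\<sigma> n) = C" using \<pi>_eq[OF _ n(1)] C(1) by (simp add: P_def)
      ultimately show ?thesis using tail_component_closed[OF i(1)] by simp
    qed
    ultimately show "\<exists>U. openin (space_in A) U \<and> x \<in> U \<and>
        (\<forall>C\<in>I. X \<inter> ends_in V E C \<inter> U \<noteq> {} \<longrightarrow> C \<in> tail_component P K F \<rho>)"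
      by (intro exI[of _ ?U]) blast
  next
    fix \<rho> U assume \<rho>: "\<rho> \<in> rays P K" and U: "openin (space_in A) U" "x \<in> U"
    then obtain O' where O: "openin (end_topology V E) O'" "U = O' \<inter> (X \<inter> ends_in V E A)"
      by (auto simp: openin_subtopology)
    have "end_of V E \<xi> \<in> O'" using U(2) O(2) \<xi>(2) by blast
    then have "\<exists>F. finite F \<and> (\<forall>\<sigma>\<in>rays V E. tail_component V E F \<sigma> = tail_component V E F \<xi> \<longrightarrow> end_of V E \<sigma> \<in> O')"
      using O(1)[unfolded openin_end_topology_iff] \<xi>V by blast
    then obtain F where F: "finite F" "\<And>\<sigma>. \<sigma> \<in> rays V E \<Longrightarrow>
        tail_component V E F \<sigma> = tail_component V E F \<xi> \<Longrightarrow> end_of V E \<sigma> \<in> O'" by blast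
    \<comment> \<open>Lifting with \<open>from_P\<close> puts the whole of \<open>C\<close> into the
      tail component of \<open>\<xi>\<close>, so every end in \<open>C\<close> is as close to
      \<open>x\<close> as \<open>F\<close> demands.\<close>
    let ?F = "\<pi> ` (F \<inter> A)"
    have fin: "finite ?F" using F(1) by simp
    have "X \<inter> ends_in V E C \<subseteq> U" if C: "C \<in> I" "C \<in> tail_component P K ?F \<rho>" for C
    proof
      fix \<epsilon> assume \<epsilon>: "\<epsilon> \<in> X \<inter> ends_in V E C"
      then obtain \<sigma> where \<sigma>: "\<sigma> \<in> rays V E" "\<epsilon> = end_of V E \<sigma>" "\<forall>\<^sub>F n in sequentially. \<sigma> n \<in> C"
        by (auto simp: ends_in_def)
      obtain i where i: "\<pi> (\<xi> i) \<in> tail_component P K ?F \<rho>" "\<xi> i \<in> tail_component V E F \<xi>"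
        using near[OF \<rho> fin F(1)] by blast
      have "c \<in> tail_component V E F \<xi>" if "c \<in> C" for c
      proof (rule tail_component_closed[OF i(2)])
        have "(\<xi> i, c) \<in> joined (A - F) E"
          by (rule from_P[OF tail_component_joined[OF i(1) C(2)] \<pi>_in(1)[OF \<xi>A] that])
        then show "(\<xi> i, c) \<in> joined (V - F) E" by (rule joined_mono) (use AV in blast)
      qed
      then have "\<forall>\<^sub>F n in sequentially. \<sigma> n \<in> tail_component V E F \<xi>" using \<sigma>(3) by (auto elim: eventually_mono)
      then have "tail_component V E F \<sigma> = tail_component V E F \<xi>"
        by (intro tail_component_eqI[OF \<sigma>(1) F(1) tail_component_in_components[OF \<xi>V F(1)]]
            eventually_frequently[OF sequentially_bot])
      then have "\<epsilon> \<in> O'" using F(2) \<sigma>(1,2) by blast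
      moreover have "C \<subseteq> A" using I(1)[OF C(1)] by blast
      ultimately show "\<epsilon> \<in> U" using \<epsilon> ends_in_mono[of C A V E] O(2) by blast
    qed
    with fin show "\<exists>F. finite F \<and> (\<forall>C\<in>I. C \<in> tail_component P K F \<rho> \<longrightarrow> X \<inter> ends_in V E C \<subseteq> U)" by blast
  qed
qed

text \<open>Goodness of the component around the isolated bad end \<open>x\<close> has to be checked
  on every subregion \<open>B\<close>. If \<open>x\<close> lies in \<open>B\<close>, it is the only
  bad end there and \<open>end_space_one_bad\<close> applies; otherwise all ends of \<open>X\<close>
  in \<open>B\<close> are locally good.\<close>

lemma scattered_imp_end_space:
  assumes scattered: "scattered_space (subtopology (end_topology V E) X)"
  shows "end_space (subtopology (end_topology V E) X)"
proof -
  define Bad where "Bad = {end_of V E \<rho> | \<rho>. \<rho> \<in> rays V E \<and> end_of V E \<rho> \<in> X \<and> \<not> locally_good \<rho>}"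
  have "Bad = {}"
  proof (rule ccontr)
    assume ne: "Bad \<noteq> {}"
    have BX: "Bad \<subseteq> X" by (auto simp: Bad_def)
    then have "Bad \<subseteq> topspace (subtopology (end_topology V E) X)" using X by (auto simp: topspace_end_topology)
    with scattered ne obtain x where x: "x \<in> Bad" "openin (subtopology (subtopology (end_topology V E) X) Bad) {x}"
      unfolding scattered_space_def by blast
    have "X \<inter> Bad = Bad" using BX by blast
    with x(2) obtain O' where O: "openin (end_topology V E) O'" "{x} = O' \<inter> Bad"
      by (auto simp: subtopology_subtopology openin_subtopology)
    obtain \<xi> where \<xi>: "\<xi> \<in> rays V E" "x = end_of V E \<xi>" "\<not> locally_good \<xi>" using x(1) by (auto simp: Bad_def)
    have "end_of V E \<xi> \<in> O'" using O(2) \<xi>(2) by blast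
    then have "\<exists>F. finite F \<and> (\<forall>\<sigma>\<in>rays V E. tail_component V E F \<sigma> = tail_component V E F \<xi> \<longrightarrow> end_of V E \<sigma> \<in> O')"
      using O(1)[unfolded openin_end_topology_iff] \<xi>(1) by blast
    then obtain F where F: "finite F" "\<And>\<sigma>. \<sigma> \<in> rays V E \<Longrightarrow>
        tail_component V E F \<sigma> = tail_component V E F \<xi> \<Longrightarrow> end_of V E \<sigma> \<in> O'" by blast
    let ?C = "tail_component V E F \<xi>"
    have CV: "?C \<subseteq> V" using tail_component_subset[of V E F \<xi>] by blast
    have ok: "locally_good \<sigma>" if \<sigma>: "\<sigma> \<in> rays ?C E" "end_of V E \<sigma> \<in> X" "end_of V E \<sigma> \<noteq> x" for \<sigma>
    proof (rule ccontr)
      assume "\<not> locally_good \<sigma>"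
      have \<sigma>V: "\<sigma> \<in> rays V E" by (rule rays_mono[OF \<sigma>(1) CV])
      have "tail_component V E F \<sigma> = ?C"
        using ray_mem[OF \<sigma>(1)]
        by (intro tail_component_eqI[OF \<sigma>V F(1) tail_component_in_components[OF \<xi>(1) F(1)]]
            eventually_frequently[OF sequentially_bot]) simp
      then have "end_of V E \<sigma> \<in> O' \<inter> Bad" using F(2)[OF \<sigma>V] \<sigma>V \<sigma>(2) \<open>\<not> locally_good \<sigma>\<close> by (auto simp: Bad_def)
      then have "end_of V E \<sigma> \<in> {x}" unfolding O(2) .
      with \<sigma>(3) show False by simp
    qed
    have "good ?C"
      unfolding good_def
    proof (intro allI impI)
      fix B assume B: "B \<subseteq> ?C" "region V E B"
      show "end_space (space_in B)"
      proof (cases "x \<in> ends_in V E B")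
        case True
        show ?thesis
          by (rule end_space_one_bad[OF B(2) _ True]) (use x(1) BX ok rays_mono[OF _ B(1)] in blast)+
      next
        case False
        show ?thesis
        proof (rule end_space_if_locally_good[OF B(2)])
          fix \<rho> assume \<rho>: "\<rho> \<in> rays B E" "end_of V E \<rho> \<in> X"
          have \<rho>V: "\<rho> \<in> rays V E" using rays_mono[OF \<rho>(1)] B(1) CV by blast
          have "end_of V E \<rho> \<in> ends_in V E B"
            using end_of_in_ends_in_iff[OF B(2) \<rho>V] ray_mem[OF \<rho>(1)] by simp
          with False have "end_of V E \<rho> \<noteq> x" by metis
          then show "locally_good \<rho>" by (rule ok[OF rays_mono[OF \<rho>(1) B(1)] \<rho>(2)])
        qed
      qed
    qed
    then have "locally_good \<xi>" using F(1) by (auto simp: locally_good_def)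
    with \<xi>(3) show False ..
  qed
  then have "locally_good \<rho>" if "\<rho> \<in> rays V E" "end_of V E \<rho> \<in> X" for \<rho> using that by (auto simp: Bad_def)
  then have "end_space (space_in V)" by (rule end_space_if_locally_good[OF region_whole])
  moreover have "X \<inter> ends_in V E V = X" using X by (auto simp: ends_in_whole)
  ultimately show ?thesis by simp
qed

end

theorem corollary5p11:
  fixes V :: "'v set" and E :: "'v set set" and X :: "(nat \<Rightarrow> 'v) set set"
  assumes "simple_graph V E"
    and "X \<subseteq> graph_ends V E"
    and "X \<prec> (UNIV :: nat set set)"
  shows "scattered_space (subtopology (end_topology V E) X)
    \<longleftrightarrow> end_space (subtopology (end_topology V E) X)"
proof
  interpret end_subspace V E X by unfold_locales (rule assms(2))
  show "end_space (subtopology (end_topology V E) X)"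
    if "scattered_space (subtopology (end_topology V E) X)"
    using that by (rule scattered_imp_end_space)
  have "topspace (subtopology (end_topology V E) X) = X"
    using assms(2) by (auto simp: topspace_end_topology)
  then show "scattered_space (subtopology (end_topology V E) X)"
    if "end_space (subtopology (end_topology V E) X)"
    using end_space_imp_scattered[OF that] assms(3) by simp
qed

end
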